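(* Let $\sigma>\frac94$ and let $\phi:\mathbb{R}^2\to\mathbb{R}$ satisfy, for some $C_1>0$, $$|\phi(x,y)|\le C_1\langle x\rangle^{-\sigma}\ \text{ for } x>0,\ y\in\mathbb{R},\qquad \|\langle x\rangle^{-1}\phi(x,y)\|_{L^2_{y\in\mathbb{R},\,x<0}}\le C_1 .$$ Let $\Phi_x(x,y,t)=\iint A_x(x',y',t)\,\phi(x+t-x',y-y')\,dx'\,dy'$. Then for $t>0$, $x>0$ and $y\in\mathbb{R}$, $$|\Phi_x(x,y,t)|\lesssim C_1\,t^{-13/12}\begin{cases}\langle x\rangle^{-\sigma+\frac94}&\text{if }t<1,\\ \langle x\rangle^{-\tilde\sigma}&\text{if }t>1,\end{cases}$$ where $\tilde\sigma=\min(\sigma-\frac94,\ \frac23\sigma-\frac5{12})$.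
   Context: For $t>0$, $A_x(x,y,t)=\iint_{\mathbb{R}^2}i\xi\,e^{i(t\xi^3+t\xi\eta^2+x\xi+y\eta)}\,d\xi\,d\eta$, understood as an oscillatory integral; it is the $x$-derivative of the smooth function $A(x,y,t)=\iint_{\mathbb{R}^2}e^{i(t\xi^3+t\xi\eta^2+x\xi+y\eta)}\,d\xi\,d\eta$. $\langle x\rangle=(1+x^2)^{1/2}$. $\lesssim$ denotes an inequality up to a multiplicative constant independent of $\phi,C_1,x,y,t$ (it may depend on $\sigma$). *)

theory Defs
  imports "HOL-Analysis.Analysis"
begin

(* the Japanese bracket *)
definition bracket :: "real \<Rightarrow> real" where
  "bracket x = (1 + x\<^sup>2) powr (1 / 2)"

(* D j k is the mixed partial derivative of order j in the first and k in the second
   variable.  Total differentiability of every D j k makes \<kappa> of class C^\<infinity>; the last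
   conjunct is the rapid decay of all derivatives. *)
definition schwartz :: "(real \<times> real \<Rightarrow> complex) \<Rightarrow> bool" where
  "schwartz \<kappa> \<longleftrightarrow> (\<exists>D :: nat \<Rightarrow> nat \<Rightarrow> real \<times> real \<Rightarrow> complex.
     D 0 0 = \<kappa> \<and>
     (\<forall>j k p. (D j k has_derivative
        (\<lambda>h. of_real (fst h) * D (Suc j) k p + of_real (snd h) * D j (Suc k) p)) (at p)) \<and>
     (\<forall>j k N. bounded (range (\<lambda>p. of_real ((1 + norm p) ^ N) * D j k p))))"

(* Oscillatory integrals in the usual sense: the integrand is cut off by \<kappa>(\<epsilon> p) with
   \<kappa>(0) = 1, and as \<epsilon> tends to 0 the limit must exist and be the same for all \<kappa>. *)
definition has_oscillatory_integral :: "(real \<times> real \<Rightarrow> complex) \<Rightarrow> complex \<Rightarrow> bool" where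
  "has_oscillatory_integral f L \<longleftrightarrow>
     (\<forall>\<kappa>. schwartz \<kappa> \<and> \<kappa> 0 = 1 \<longrightarrow>
       ((\<lambda>\<epsilon>. LINT p|lborel. \<kappa> (\<epsilon> *\<^sub>R p) * f p) \<longlongrightarrow> L) (at_right 0))"

definition oscillatory_integral :: "(real \<times> real \<Rightarrow> complex) \<Rightarrow> complex" where
  "oscillatory_integral f = (THE L. has_oscillatory_integral f L)"

definition A_x :: "real \<Rightarrow> real \<Rightarrow> real \<Rightarrow> complex" where
  "A_x x y t = oscillatory_integral (\<lambda>(\<xi>, \<eta>).
     \<i> * of_real \<xi> * exp (\<i> * of_real (t * \<xi> ^ 3 + t * \<xi> * \<eta>\<^sup>2 + x * \<xi> + y * \<eta>)))"

(* A is, up to rescaling, Ai(u) * Ai(v) with u, v proportional to x' + y'/sqrt 3 and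
   x' - y'/sqrt 3.  So for t > 0 and x > 0, if \<phi> has the decay for x > 0 with \<sigma> > 2 and
   the weighted L2 bound for x < 0, the integral converges absolutely. *)
definition Phi_x :: "(real \<times> real \<Rightarrow> real) \<Rightarrow> real \<Rightarrow> real \<Rightarrow> real \<Rightarrow> complex" where
  "Phi_x \<phi> x y t =
     (LINT (x', y')|lebesgue. A_x x' y' t * of_real (\<phi> (x + t - x', y - y')))"

definition in_L2_on :: "(real \<times> real) set \<Rightarrow> (real \<times> real \<Rightarrow> real) \<Rightarrow> bool" where
  "in_L2_on S f \<longleftrightarrow>
     set_borel_measurable lebesgue S f \<and> set_integrable lebesgue S (\<lambda>p. (f p)\<^sup>2)"

definition L2_norm_on :: "(real \<times> real) set \<Rightarrow> (real \<times> real \<Rightarrow> real) \<Rightarrow> real" where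
  "L2_norm_on S f = sqrt (LINT p:S|lebesgue. (f p)\<^sup>2)"

end

theory Submission
  imports Defs "HOL-Complex_Analysis.Cauchy_Integral_Theorem" "HOL-Probability.Sinc_Integral"
begin

text \<open>
  The cubic \<open>t\<xi>\<^sup>3 + t\<xi>\<eta>\<^sup>2\<close> is \<open>u\<^sup>3 + v\<^sup>3\<close> in coordinates \<open>u, v\<close> proportional to
  \<open>\<xi> \<plusminus> \<eta>/\<surd>3\<close>, so \<open>A\<close> is a product of two Airy integrals in \<open>x \<plusminus> \<surd>3 y\<close>. The phase is
  noncharacteristic in \<open>\<xi>\<close>: repeated integration by parts in \<open>\<xi>\<close> alone shows that the
  oscillatory integral exists and does not depend on the cutoff, and a Gaussian cutoff adapted to
  \<open>u, v\<close> then gives the product. Shifting the contour of each Airy integral to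
  \<open>u + i(\<bar>u\<bar> + b)\<close> bounds it and its derivative: rapid decay to the right, growth of order 0 and
  1/4 to the left. With \<open>\<tau> = (4t)^(1/3)\<close> this yields
  \<open>\<bar>A\<^sub>x\<bar> \<lesssim> \<tau>^(-3) (1 + \<bar>x\<bar>/\<tau>)^(1/4)\<close> in the cone \<open>\<bar>y\<bar> \<le> -x\<close>, with enough decay outside it
  that absolute values suffice in the convolution. The resulting bound
  \<open>t^(-13/12) \<langle>x\<rangle>^(9/4 - \<sigma>)\<close> holds for all \<open>t > 0\<close>.
\<close>

section \<open>An Airy-type integral with a Gaussian cutoff\<close>

text \<open>The exponents come from the region u < 0 of the convolution variable u. There the main
  part of the kernel has size \<tau>^(-3) (|u|/\<tau>)^(1/4) on a cone whose slice at u has width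
  2|u|, while \<phi> is evaluated at abscissa z - u with z = x + t and is bounded by a multiple of
  (1 + z + |u|)^(-\<sigma>). Integrating |u|^(5/4) against this power converges exactly for \<sigma>
  > 9/4 and gives \<tau>^(-13/4) (1 + z)^(9/4 - \<sigma>), and \<tau>^(13/4) is t^(13/12) up to a
  constant. For u > 0 the obstacle is that the kernel decays only in u/\<tau>, and \<tau> is large
  when t is. The shift by t in the argument of \<phi> removes it: once u is comparable to z it is at
  least t/2, so \<tau>^2 is at most a multiple of u/\<tau>, and decay in u/\<tau> becomes decay in
  z. All Airy estimates are made for \<epsilon> > 0, where the integrals converge absolutely, with
  constants that survive the limit.\<close>

lemma has_bochner_integral_cauchy_kernel:
  fixes a c :: real
  assumes "c > 0"
  shows "has_bochner_integral lborel (\<lambda>x. 1 / (1 + ((x - a) / c)\<^sup>2)) (pi * c)"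
proof -
  have i: "integrable lborel (\<lambda>x::real. inverse (1 + x\<^sup>2))"
    using integrable_inverse_1_plus_square by (simp add: set_integrable_def)
  have v: "(LBINT x::real. inverse (1 + x\<^sup>2)) = pi"
    using LBINT_inverse_1_plus_square by (simp add: interval_lebesgue_integral_def set_lebesgue_integral_def)
  have "has_bochner_integral lborel (\<lambda>x::real. inverse (1 + x\<^sup>2)) pi"
    using i v by (simp add: has_bochner_integral_iff)
  then have "has_bochner_integral lborel (\<lambda>x. inverse (1 + (- a / c + 1 / c * x)\<^sup>2)) (pi /\<^sub>R \<bar>1 / c\<bar>)"
    by (subst (asm) lborel_has_bochner_integral_real_affine_iff[where c = "1 / c" and t = "- a / c"])
      (use assms in auto)
  moreover have "inverse (1 + (- a / c + 1 / c * x)\<^sup>2) = 1 / (1 + ((x - a) / c)\<^sup>2)" for x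
    by (simp add: diff_divide_distrib inverse_eq_divide)
  ultimately show ?thesis using assms by (simp add: mult.commute)
qed

lemma nn_integral_cauchy_kernel:
  fixes a c :: real
  assumes "c > 0"
  shows "(\<integral>\<^sup>+x. ennreal (1 / (1 + ((x - a) / c)\<^sup>2)) \<partial>lborel) = ennreal (pi * c)"
  using has_bochner_integral_cauchy_kernel[OF assms, of a]
  by (subst nn_integral_eq_integral) (auto simp: has_bochner_integral_iff add_nonneg_nonneg)

section \<open>Deforming the real line for entire integrands\<close>

lemma tendsto_integral_symmetric_interval:
  fixes f :: "real \<Rightarrow> complex"
  assumes "integrable lborel f"
  shows "(\<lambda>n. LINT x|lborel. indicator {- real n..real n} x *\<^sub>R f x) \<longlonglongrightarrow> (LINT x|lborel. f x)"
proof (rule integral_dominated_convergence[where w = "\<lambda>x. norm (f x)"])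
  show "AE x in lborel. (\<lambda>n. indicat_real {- real n..real n} x *\<^sub>R f x) \<longlonglongrightarrow> f x"
  proof (rule AE_I2, rule tendsto_eventually)
    fix x :: real
    obtain N where "real N \<ge> \<bar>x\<bar>" using real_arch_simple by blast
    then show "\<forall>\<^sub>F n in sequentially. indicat_real {- real n..real n} x *\<^sub>R f x = f x"
      by (intro eventually_sequentiallyI[of N]) (auto simp: indicator_def)
  qed
qed (use assms in \<open>auto simp: indicator_def\<close>)

lemma has_real_derivative_abs:
  fixes u :: real
  assumes "u \<noteq> 0"
  shows "(abs has_real_derivative sgn u) (at u)"
proof (cases "u > 0")
  case True
  have "((\<lambda>x. x) has_real_derivative sgn u) (at u)" using True by simp
  then show ?thesis
    by (rule has_field_derivative_transform_within_open[where S = "{0<..}"]) (use True in auto)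
next
  case False
  then have "((\<lambda>x. - x) has_real_derivative sgn u) (at u)"
    using assms by (auto intro!: derivative_eq_intros)
  then show ?thesis
    by (rule has_field_derivative_transform_within_open[where S = "{..<0}"]) (use assms False in auto)
qed

text \<open>An entire function has a primitive \<open>G\<close>, so the integral over
  \<open>{- n..n}\<close> and the integral along the graph u + i(|u| + b) are both differences of
  values of \<open>G\<close>. They differ by the change of \<open>G\<close> along the two vertical
  edges over n and -n, which \<open>e n\<close> controls and which vanishes in the limit. The factor
  \<open>sqrt 2\<close> is the speed of the bent path. Since \<open>b\<close> may be negative, the
  path may dip below the real axis near u = 0.\<close>

lemma contour_shift_bound:
  fixes g :: "complex \<Rightarrow> complex" and b :: real and m :: "real \<Rightarrow> real"
  assumes holo: "g holomorphic_on UNIV"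
    and int: "integrable lborel (\<lambda>u. g (of_real u))"
    and mint: "integrable lborel m"
    and bound: "\<And>u. norm (g (Complex u (\<bar>u\<bar> + b))) * sqrt 2 \<le> m u"
    and edge: "e \<longlonglongrightarrow> 0"
    and edge_bound: "\<forall>\<^sub>F n in sequentially. \<forall>u y. \<bar>u\<bar> = real n \<and> 0 \<le> y \<and> y \<le> real n + b \<longrightarrow>
           norm (g (Complex u y)) * (real n + b) \<le> e n"
  shows "norm (LINT u|lborel. g (of_real u)) \<le> (LINT u|lborel. m u)"
proof -
  obtain G where G: "\<And>z. (G has_field_derivative g z) (at z)"
    using holomorphic_convex_primitive'[of UNIV g] holo by auto
  have gcont: "continuous_on UNIV g"
    using holo holomorphic_on_imp_continuous_on by blast
  have m0: "0 \<le> m u" for u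
    using bound[of u] by (meson dual_order.trans mult_nonneg_nonneg norm_ge_zero real_sqrt_ge_zero zero_le_numeral)
  define \<gamma> where "\<gamma> u = Complex u (\<bar>u\<bar> + b)" for u
  have main: "norm (LINT x|lborel. indicator {- real n..real n} x *\<^sub>R g (of_real x)) \<le> (LINT u|lborel. m u) + 2 * e n"
    if n: "real n > \<bar>b\<bar>" and eb: "\<And>u y. \<bar>u\<bar> = real n \<Longrightarrow> 0 \<le> y \<Longrightarrow> y \<le> real n + b \<Longrightarrow>
           norm (g (Complex u y)) * (real n + b) \<le> e n" for n
  proof -
    have 1: "(LINT x|lborel. indicator {- real n..real n} x *\<^sub>R g (of_real x)) = G (of_real (real n)) - G (of_real (- real n))"
    proof (rule integral_FTC_atLeastAtMost)
      show "((\<lambda>x. G (complex_of_real x)) has_vector_derivative g (complex_of_real x)) (at x within {- real n..real n})" for x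
        by (rule has_vector_derivative_at_within)
           (use has_vector_derivative_real_field[OF G] in blast)
      show "continuous_on {- real n..real n} (\<lambda>x. g (complex_of_real x))"
        by (intro continuous_on_compose2[OF gcont] continuous_intros) auto
    qed auto
    have 2: "((\<lambda>u. (1 + \<i> * sgn u) * g (\<gamma> u)) has_integral (G (\<gamma> (real n)) - G (\<gamma> (- real n)))) {- real n..real n}"
    proof (rule fundamental_theorem_of_calculus_interior_strong[where S = "{0}"])
      fix u assume "u \<in> {- real n<..<real n} - {0}"
      then have u0: "u \<noteq> 0" by simp
      have "((\<lambda>u::real. complex_of_real u + \<i> * complex_of_real (\<bar>u\<bar> + b)) has_vector_derivative (1 + \<i> * complex_of_real (sgn u))) (at u)"
        using u0 by (auto intro!: derivative_eq_intros has_real_derivative_abs simp: has_real_derivative_iff_has_vector_derivative[symmetric])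
      then have \<gamma>d: "(\<gamma> has_vector_derivative (1 + \<i> * sgn u)) (at u)"
        by (simp add: \<gamma>_def[abs_def] Complex_eq del: of_real_add)
      from field_vector_diff_chain_at[OF \<gamma>d G]
      show "((\<lambda>u. G (\<gamma> u)) has_vector_derivative (1 + \<i> * sgn u) * g (\<gamma> u)) (at u)"
        by (simp add: o_def)
    next
      have "continuous_on UNIV G"
        using G by (meson DERIV_isCont continuous_at_imp_continuous_on)
      then show "continuous_on {- real n..real n} (\<lambda>u. G (\<gamma> u))"
        by (rule continuous_on_compose2)
          (auto simp: \<gamma>_def[abs_def] Complex_eq intro!: continuous_intros)
    qed auto
    have mi: "(m has_integral (LINT u:{- real n..real n}|lborel. m u)) {- real n..real n}"
    proof -
      have "set_integrable lborel {- real n..real n} m"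
        unfolding set_integrable_def by (intro integrable_mult_indicator mint) auto
      then show ?thesis using set_borel_integral_eq_integral by (metis integrable_integral)
    qed
    have 3: "norm (G (\<gamma> (real n)) - G (\<gamma> (- real n))) \<le> (LINT u|lborel. m u)"
    proof -
      have "norm (G (\<gamma> (real n)) - G (\<gamma> (- real n))) \<le> (LINT u:{- real n..real n}|lborel. m u)"
      proof (subst integral_unique[OF 2, symmetric], subst integral_unique[OF mi, symmetric], rule integral_norm_bound_integral)
        fix u :: real
        have "norm (1 + \<i> * complex_of_real (sgn u)) \<le> sqrt 2"
          by (auto simp: sgn_if cmod_def)
        then have "norm ((1 + \<i> * sgn u) * g (\<gamma> u)) \<le> sqrt 2 * norm (g (\<gamma> u))"
          by (simp add: norm_mult mult_right_mono)
        also have "\<dots> \<le> m u" using bound[of u] by (simp add: \<gamma>_def mult.commute)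
        finally show "norm ((1 + \<i> * sgn u) * g (\<gamma> u)) \<le> m u" .
      qed (use 2 mi in auto)
      also have "\<dots> \<le> (LINT u|lborel. m u)"
        unfolding set_lebesgue_integral_def
        by (intro integral_mono integrable_mult_indicator mint) (auto simp: indicator_def m0)
      finally show ?thesis .
    qed
    have 4: "norm (G (of_real u) - G (\<gamma> u)) \<le> e n" if u: "\<bar>u\<bar> = real n" for u
    proof -
      have seg: "\<exists>y. z = Complex u y \<and> 0 \<le> y \<and> y \<le> real n + b" if z: "z \<in> closed_segment (of_real u) (\<gamma> u)" for z
      proof -
        obtain t where t: "0 \<le> t" "t \<le> 1" "z = (1 - t) *\<^sub>R of_real u + t *\<^sub>R \<gamma> u"
          using z unfolding in_segment by blast
        have "z = Complex u (t * (real n + b))"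
          unfolding t(3) by (rule complex_eqI) (simp_all add: \<gamma>_def u algebra_simps)
        moreover have "0 \<le> t * (real n + b)" "t * (real n + b) \<le> real n + b"
          using t(1,2) n by (auto simp: mult_left_le_one_le)
        ultimately show ?thesis by blast
      qed
      have pos: "real n + b > 0" using n by linarith
      have "norm (G (of_real u) - G (\<gamma> u)) \<le> e n / (real n + b) * norm (complex_of_real u - \<gamma> u)"
      proof (rule field_differentiable_bound[where S = "closed_segment (of_real u) (\<gamma> u)" and f' = g])
        fix z assume "z \<in> closed_segment (complex_of_real u) (\<gamma> u)"
        then obtain y where "z = Complex u y" "0 \<le> y" "y \<le> real n + b" using seg by blast
        then show "norm (g z) \<le> e n / (real n + b)" using eb[of u y] u pos by (simp add: field_simps)
      qed (auto intro: has_field_derivative_at_within G)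
      also have "norm (complex_of_real u - \<gamma> u) = real n + b"
      proof -
        have "complex_of_real u - \<gamma> u = \<i> * of_real (- (real n + b))"
          by (rule complex_eqI) (simp_all add: \<gamma>_def u)
        show ?thesis
          unfolding \<open>complex_of_real u - \<gamma> u = _\<close> norm_mult norm_of_real
          by (simp only: norm_ii mult_1 abs_minus_cancel abs_of_pos[OF pos])
      qed
      finally have "norm (G (of_real u) - G (\<gamma> u)) \<le> e n / (real n + b) * (real n + b)" .
      then show ?thesis using pos by simp
    qed
    have "G (of_real (real n)) - G (of_real (- real n)) =
       ((G (\<gamma> (real n)) - G (\<gamma> (- real n))) + (G (of_real (real n)) - G (\<gamma> (real n)))) - (G (of_real (- real n)) - G (\<gamma> (- real n)))"
      by simp
    also have "norm \<dots> \<le> (norm (G (\<gamma> (real n)) - G (\<gamma> (- real n))) + norm (G (of_real (real n)) - G (\<gamma> (real n)))) + norm (G (of_real (- real n)) - G (\<gamma> (- real n)))"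
      by (intro order_trans[OF norm_triangle_ineq4] add_right_mono norm_triangle_ineq)
    also have "\<dots> \<le> (LINT u|lborel. m u) + 2 * e n"
      using 3 4[of "real n"] 4[of "- real n"] by simp
    finally show ?thesis unfolding 1 .
  qed
  have ev: "\<forall>\<^sub>F n in sequentially. norm (LINT x|lborel. indicator {- real n..real n} x *\<^sub>R g (of_real x)) \<le> (LINT u|lborel. m u) + 2 * e n"
    using edge_bound eventually_gt_at_top[of "nat \<lceil>\<bar>b\<bar>\<rceil>"]
  proof eventually_elim
    case (elim n)
    have "real n > \<bar>b\<bar>" using elim(2) by linarith
    then show ?case by (rule main) (use elim(1) in blast)
  qed
  have "(\<lambda>n. norm (LINT x|lborel. indicator {- real n..real n} x *\<^sub>R g (of_real x))) \<longlonglongrightarrow> norm (LINT u|lborel. g (of_real u))"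
    by (intro tendsto_norm tendsto_integral_symmetric_interval int)
  moreover have "(\<lambda>n. (LINT u|lborel. m u) + 2 * e n) \<longlonglongrightarrow> (LINT u|lborel. m u) + 2 * 0"
    by (intro tendsto_intros edge)
  ultimately show ?thesis
    using tendsto_le[OF _ _ _ ev] by auto
qed

section \<open>Airy integrals with a Gaussian cutoff on the bent contour\<close>

lemma power_times_exp_bounded:
  fixes a :: real
  assumes "a > 0"
  shows "\<exists>C>0. \<forall>x\<ge>0. x ^ n * exp (- (a * x)) \<le> C"
proof (intro exI conjI allI impI)
  fix x :: real assume x: "x \<ge> 0"
  have "(a * x) ^ n /\<^sub>R fact n \<le> (\<Sum>k. (a * x) ^ k /\<^sub>R fact k)"
    using sum_le_suminf[OF summable_exp_generic, of "{n}" "a * x"] assms x by simp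
  then have "(a * x) ^ n / fact n \<le> exp (a * x)"
    by (simp add: exp_def divide_inverse_commute)
  then have "x ^ n * a ^ n \<le> fact n * exp (a * x)"
    by (simp add: field_simps power_mult_distrib)
  then show "x ^ n * exp (- (a * x)) \<le> fact n / a ^ n"
    using assms by (simp add: exp_minus field_simps)
qed (use assms in auto)

text \<open>The cubic carries no factor 1/3, so the saddles solve 3 z^2 = -s, which is why the
  parameter is later written as -3 a^2 or 3 a^2. The index \<open>k\<close> = 0 gives the Airy
  integral and \<open>k\<close> = 1 its derivative in s up to the factor i.\<close>

definition airy_integrand :: "nat \<Rightarrow> real \<Rightarrow> real \<Rightarrow> complex \<Rightarrow> complex" where
  "airy_integrand k \<epsilon> s z = z ^ k * exp (- of_real (\<epsilon>\<^sup>2) * z\<^sup>2 + \<i> * z ^ 3 + \<i> * of_real s * z)"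

lemma norm_airy_integrand:
  "norm (airy_integrand k \<epsilon> s (Complex u y)) =
     sqrt (u\<^sup>2 + y\<^sup>2) ^ k * exp (- \<epsilon>\<^sup>2 * (u\<^sup>2 - y\<^sup>2) + y ^ 3 - 3 * u\<^sup>2 * y - s * y)"
proof -
  have "Re (- of_real (\<epsilon>\<^sup>2) * (Complex u y)\<^sup>2 + \<i> * (Complex u y) ^ 3 + \<i> * of_real s * Complex u y)
      = - \<epsilon>\<^sup>2 * (u\<^sup>2 - y\<^sup>2) + y ^ 3 - 3 * u\<^sup>2 * y - s * y"
    by (simp add: power2_eq_square power3_eq_cube algebra_simps)
  moreover have "norm (Complex u y) = sqrt (u\<^sup>2 + y\<^sup>2)" by (simp add: cmod_def)
  ultimately show ?thesis
    by (simp add: airy_integrand_def norm_mult norm_power)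
qed

lemma holomorphic_airy_integrand: "airy_integrand k \<epsilon> s holomorphic_on UNIV"
  unfolding airy_integrand_def[abs_def] by (intro holomorphic_intros)

lemma integrable_airy_integrand:
  assumes "\<epsilon> > 0"
  shows "integrable lborel (\<lambda>u. airy_integrand k \<epsilon> s (of_real u))"
proof -
  obtain C where C: "C > 0" "\<And>x. x \<ge> 0 \<Longrightarrow> x ^ k * exp (- (\<epsilon>\<^sup>2 / 2 * x)) \<le> C"
    using power_times_exp_bounded[of "\<epsilon>\<^sup>2 / 2" k] assms by auto
  \<comment> \<open>The Gaussian is cut in halves: one absorbs the power of u, the other is
    dominated by a Cauchy kernel of this scale, for which (u/c)^2 = \<epsilon>^2 u^2 / 2.\<close>
  define c where "c = sqrt 2 / \<epsilon>"
  have c: "c > 0" using assms by (simp add: c_def)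
  have c2: "(x / c)\<^sup>2 = \<epsilon>\<^sup>2 / 2 * x\<^sup>2" for x
    using assms by (simp add: c_def power_divide power_mult_distrib field_simps)
  have "integrable lborel (\<lambda>u. (1 + C) * (1 / (1 + ((u - 0) / c)\<^sup>2)))"
    using has_bochner_integral_cauchy_kernel[OF c, of 0] by (intro integrable_mult_right) (auto simp: has_bochner_integral_iff)
  then show ?thesis
  proof (rule Bochner_Integration.integrable_bound)
    show "(\<lambda>u. airy_integrand k \<epsilon> s (of_real u)) \<in> borel_measurable lborel"
      unfolding airy_integrand_def by measurable
    show "AE u in lborel. norm (airy_integrand k \<epsilon> s (complex_of_real u)) \<le> norm ((1 + C) * (1 / (1 + ((u - 0) / c)\<^sup>2)))"
    proof (rule AE_I2)
      fix u :: real
      have "norm (airy_integrand k \<epsilon> s (complex_of_real u)) = \<bar>u\<bar> ^ k * exp (- (\<epsilon>\<^sup>2 * u\<^sup>2))"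
        using norm_airy_integrand[of k \<epsilon> s u 0] by (simp add: complex_of_real_def)
      also have "\<dots> = \<bar>u\<bar> ^ k * exp (- (\<epsilon>\<^sup>2 / 2 * u\<^sup>2)) * exp (- (u / c)\<^sup>2)"
        by (simp add: c2 mult.assoc flip: exp_add)
      also have "\<dots> \<le> (1 + C) * (1 / (1 + (u / c)\<^sup>2))"
      proof (rule mult_mono)
        show "\<bar>u\<bar> ^ k * exp (- (\<epsilon>\<^sup>2 / 2 * u\<^sup>2)) \<le> 1 + C"
        proof (cases "\<bar>u\<bar> \<le> 1")
          case True
          then have "\<bar>u\<bar> ^ k * exp (- (\<epsilon>\<^sup>2 / 2 * u\<^sup>2)) \<le> 1 * 1"
            by (intro mult_mono power_le_one) auto
          then show ?thesis using C(1) by simp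
        next
          case False
          then have "\<bar>u\<bar> \<le> u\<^sup>2"
            by (metis abs_ge_zero linorder_not_le mult_left_mono mult.right_neutral order_less_imp_le power2_abs power2_eq_square)
          then have "\<bar>u\<bar> ^ k * exp (- (\<epsilon>\<^sup>2 / 2 * u\<^sup>2)) \<le> (u\<^sup>2) ^ k * exp (- (\<epsilon>\<^sup>2 / 2 * u\<^sup>2))"
            by (intro mult_right_mono power_mono) auto
          also have "\<dots> \<le> C" using C(2)[of "u\<^sup>2"] by simp
          finally show ?thesis by simp
        qed
        show "exp (- (u / c)\<^sup>2) \<le> 1 / (1 + (u / c)\<^sup>2)"
          using exp_ge_add_one_self[of "(u / c)\<^sup>2"]
          by (simp add: exp_minus inverse_eq_divide frac_le add_pos_nonneg)
      qed (use C in auto)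
      also have "\<dots> = norm ((1 + C) * (1 / (1 + ((u - 0) / c)\<^sup>2)))"
        using C by (simp add: abs_mult add_nonneg_nonneg)
      finally show "norm (airy_integrand k \<epsilon> s (complex_of_real u)) \<le> norm ((1 + C) * (1 / (1 + ((u - 0) / c)\<^sup>2)))" .
    qed
  qed
qed

text \<open>On the vertical edges |u| = n one has y <= 5n/4 for large n, and -3 u^2 y outweighs y^3,
  \<epsilon>^2 y^2 and |s| y together. What remains is exp(-\<epsilon>^2 n^2), which beats the power
  of z and the length of the edge. Hence only the modulus of the integrand on the bent path has to
  be estimated.\<close>

lemma airy_integral_contour_bound:
  assumes \<epsilon>: "\<epsilon> > 0" and m: "integrable lborel m"
    and bound: "\<And>u. sqrt (u\<^sup>2 + (\<bar>u\<bar> + b)\<^sup>2) ^ k *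
       exp (- \<epsilon>\<^sup>2 * (u\<^sup>2 - (\<bar>u\<bar> + b)\<^sup>2) + (\<bar>u\<bar> + b) ^ 3 - 3 * u\<^sup>2 * (\<bar>u\<bar> + b) - s * (\<bar>u\<bar> + b)) * sqrt 2 \<le> m u"
  shows "norm (LINT u|lborel. airy_integrand k \<epsilon> s (of_real u)) \<le> (LINT u|lborel. m u)"
proof (rule contour_shift_bound[where b = b and e = "\<lambda>n. (3 * real n) ^ k * exp (- \<epsilon>\<^sup>2 * (real n)\<^sup>2) * (2 * real n)"])
  show "(\<lambda>n. (3 * real n) ^ k * exp (- \<epsilon>\<^sup>2 * (real n)\<^sup>2) * (2 * real n)) \<longlonglongrightarrow> 0"
  proof -
    have "filterlim (\<lambda>n. \<epsilon>\<^sup>2 * real n) at_top sequentially"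
      using \<epsilon> by (intro filterlim_tendsto_pos_mult_at_top[OF tendsto_const] filterlim_real_sequentially) auto
    then have "((\<lambda>n. (\<epsilon>\<^sup>2 * real n) ^ (k + 1) / exp (\<epsilon>\<^sup>2 * real n)) \<longlongrightarrow> 0) sequentially"
      by (rule filterlim_compose[OF tendsto_power_div_exp_0])
    then have lim: "(\<lambda>n. 2 * 3 ^ k / (\<epsilon>\<^sup>2) ^ (k + 1) * ((\<epsilon>\<^sup>2 * real n) ^ (k + 1) / exp (\<epsilon>\<^sup>2 * real n))) \<longlonglongrightarrow> 0"
      by (rule tendsto_mult_right_zero)
    show ?thesis
    proof (rule tendsto_sandwich[OF _ _ tendsto_const lim])
      show "\<forall>\<^sub>F n in sequentially. 0 \<le> (3 * real n) ^ k * exp (- \<epsilon>\<^sup>2 * (real n)\<^sup>2) * (2 * real n)" by simp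
      show "\<forall>\<^sub>F n in sequentially. (3 * real n) ^ k * exp (- \<epsilon>\<^sup>2 * (real n)\<^sup>2) * (2 * real n) \<le>
              2 * 3 ^ k / (\<epsilon>\<^sup>2) ^ (k + 1) * ((\<epsilon>\<^sup>2 * real n) ^ (k + 1) / exp (\<epsilon>\<^sup>2 * real n))"
        using eventually_ge_at_top[of 1]
      proof eventually_elim
        case (elim n)
        have "real n \<le> (real n)\<^sup>2" using elim by (simp add: power2_eq_square)
        then have "exp (- \<epsilon>\<^sup>2 * (real n)\<^sup>2) \<le> exp (- (\<epsilon>\<^sup>2 * real n))"
          by (simp add: mult_left_mono)
        then have "(3 * real n) ^ k * exp (- \<epsilon>\<^sup>2 * (real n)\<^sup>2) * (2 * real n) \<le> (3 * real n) ^ k * exp (- (\<epsilon>\<^sup>2 * real n)) * (2 * real n)"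
          by (intro mult_mono mult_left_mono) auto
        also have "\<dots> = 2 * 3 ^ k / (\<epsilon>\<^sup>2) ^ (k + 1) * ((\<epsilon>\<^sup>2 * real n) ^ (k + 1) / exp (\<epsilon>\<^sup>2 * real n))"
          using \<epsilon> by (simp add: exp_minus field_simps power_mult_distrib)
        finally show ?case .
      qed
    qed
  qed
  show "\<forall>\<^sub>F n in sequentially. \<forall>u y. \<bar>u\<bar> = real n \<and> 0 \<le> y \<and> y \<le> real n + b \<longrightarrow>
      norm (airy_integrand k \<epsilon> s (Complex u y)) * (real n + b) \<le> (3 * real n) ^ k * exp (- \<epsilon>\<^sup>2 * (real n)\<^sup>2) * (2 * real n)"
    using filterlim_real_sequentially[unfolded filterlim_at_top, rule_format, of "4 * \<bar>b\<bar> + 2 * \<epsilon>\<^sup>2 + \<bar>s\<bar> + 1"]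
  proof eventually_elim
    case (elim n)
    let ?R = "real n"
    show ?case
    proof (intro allI impI, elim conjE)
      fix u y :: real assume u: "\<bar>u\<bar> = ?R" and y0: "0 \<le> y" and y1: "y \<le> ?R + b"
      have e2: "\<epsilon>\<^sup>2 \<ge> 0" by simp
      have R1: "?R \<ge> 1" "?R \<ge> 4 * \<bar>b\<bar>" "?R \<ge> 2 * \<epsilon>\<^sup>2 + \<bar>s\<bar>" using elim e2 by linarith+
      have u2: "u\<^sup>2 = ?R\<^sup>2" using u by (metis power2_abs)
      have y2: "y \<le> 5/4 * ?R" using y1 R1 by linarith
      have "y\<^sup>2 \<le> (5/4 * ?R)\<^sup>2" using y2 y0 by (intro power_mono) auto
      then have yy: "y\<^sup>2 \<le> 25/16 * ?R\<^sup>2" by (simp add: power2_eq_square)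
      have "?R * ?R \<ge> ?R * (2 * \<epsilon>\<^sup>2 + \<bar>s\<bar>)" using R1 by (intro mult_left_mono) auto
      moreover have "?R * \<bar>s\<bar> \<ge> 1 * \<bar>s\<bar>" using R1 by (intro mult_right_mono) auto
      ultimately have "?R\<^sup>2 \<ge> 2 * \<epsilon>\<^sup>2 * ?R + \<bar>s\<bar>" by (simp add: power2_eq_square algebra_simps)
      moreover have "\<epsilon>\<^sup>2 * y \<le> \<epsilon>\<^sup>2 * (5/4 * ?R)" using y2 by (intro mult_left_mono) auto
      moreover have "\<epsilon>\<^sup>2 * ?R \<ge> 0" by simp
      ultimately have "\<epsilon>\<^sup>2 * y + y\<^sup>2 - 3 * ?R\<^sup>2 - s \<le> 0" using yy by linarith
      then have "y * (\<epsilon>\<^sup>2 * y + y\<^sup>2 - 3 * ?R\<^sup>2 - s) \<le> 0" using y0 by (simp add: mult_nonneg_nonpos)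
      then have ex: "- \<epsilon>\<^sup>2 * (u\<^sup>2 - y\<^sup>2) + y ^ 3 - 3 * u\<^sup>2 * y - s * y \<le> - \<epsilon>\<^sup>2 * ?R\<^sup>2"
        unfolding u2 by (simp add: power2_eq_square power3_eq_cube algebra_simps)
      have "(3 * ?R)\<^sup>2 = 9 * ?R\<^sup>2" by (simp add: power_mult_distrib)
      then have "u\<^sup>2 + y\<^sup>2 \<le> (3 * ?R)\<^sup>2" using yy u2 zero_le_power2[of "?R"] by linarith
      then have "sqrt (u\<^sup>2 + y\<^sup>2) \<le> 3 * ?R" using R1 by (intro real_le_lsqrt) auto
      then have "sqrt (u\<^sup>2 + y\<^sup>2) ^ k \<le> (3 * ?R) ^ k" by (intro power_mono) auto
      then show "norm (airy_integrand k \<epsilon> s (Complex u y)) * (?R + b) \<le> (3 * ?R) ^ k * exp (- \<epsilon>\<^sup>2 * ?R\<^sup>2) * (2 * ?R)"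
        unfolding norm_airy_integrand using ex y0 y1 R1
        by (intro mult_mono) auto
    qed
  qed
  show "norm (airy_integrand k \<epsilon> s (Complex u (\<bar>u\<bar> + b))) * sqrt 2 \<le> m u" for u
    unfolding norm_airy_integrand by (rule bound)
qed (use m holomorphic_airy_integrand integrable_airy_integrand[OF \<epsilon>] in auto)

text \<open>Cubic exponential decay is traded for the Cauchy kernel, whose integral is explicit. All
  that is used of the exponential is 1 + x^3 <= exp(x^3).\<close>

lemma exp_minus_cube_bounds:
  fixes w :: real
  shows "exp (- (\<bar>w\<bar> ^ 3)) \<le> 2 / (1 + w\<^sup>2)" "\<bar>w\<bar> * exp (- (\<bar>w\<bar> ^ 3)) \<le> 2 / (1 + w\<^sup>2)"
proof -
  define x where "x = \<bar>w\<bar>"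
  have x: "x \<ge> 0" "w\<^sup>2 = x\<^sup>2" by (auto simp: x_def)
  have e: "exp (- (x ^ 3)) \<le> 1 / (1 + x ^ 3)"
    using exp_ge_add_one_self[of "x ^ 3"] x by (simp add: exp_minus inverse_eq_divide frac_le add_pos_nonneg)
  have 1: "1 + x\<^sup>2 \<le> 2 * (1 + x ^ 3)"
  proof (cases "x \<le> 1")
    case True
    then have "x\<^sup>2 \<le> 1" using x(1) by (simp add: power_le_one)
    moreover have "1 + p \<le> 2 * (1 + q)" if "p \<le> 1" "q \<ge> 0" for p q :: real using that by (simp add: algebra_simps)
    ultimately show ?thesis using x(1) by (metis zero_le_power)
  next
    case False
    then have "x ^ 2 \<le> x ^ 3" by (intro power_increasing) auto
    moreover have "1 + p \<le> 2 * (1 + q)" if "p \<le> q" "q \<ge> 0" for p q :: real using that by (simp add: algebra_simps)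
    ultimately show ?thesis using x(1) by (metis zero_le_power)
  qed
  have 2: "x * (1 + x\<^sup>2) \<le> 2 * (1 + x ^ 3)"
  proof (cases "x \<le> 1")
    case True
    have "0 \<le> x * (x * x)" using x(1) by (intro mult_nonneg_nonneg)
    then have "x \<le> x * (x * x) + 2" using True by linarith
    then show ?thesis by (simp add: distrib_left power2_eq_square power3_eq_cube)
  next
    case False
    then have "x ^ 1 \<le> x ^ 3" by (intro power_increasing) auto
    then show ?thesis using x by (simp add: distrib_left power2_eq_square power3_eq_cube)
  qed
  have p: "0 < 1 + x\<^sup>2" "0 < 1 + x ^ 3" using x by (auto intro: add_pos_nonneg)
  have "1 / (1 + x ^ 3) \<le> 2 / (1 + x\<^sup>2)" using 1 p by (simp add: field_simps)
  then show "exp (- (\<bar>w\<bar> ^ 3)) \<le> 2 / (1 + w\<^sup>2)" using e unfolding x_def[symmetric] x(2) by linarith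
  have "x * exp (- (x ^ 3)) \<le> x * (1 / (1 + x ^ 3))" using e x by (intro mult_left_mono)
  also have "\<dots> \<le> 2 / (1 + x\<^sup>2)" using 2 p by (simp add: field_simps)
  finally show "\<bar>w\<bar> * exp (- (\<bar>w\<bar> ^ 3)) \<le> 2 / (1 + w\<^sup>2)" unfolding x_def[symmetric] x(2) .
qed

lemma cauchy_kernel_abs_le:
  fixes u a c :: real
  shows "1 / (1 + ((\<bar>u\<bar> - a) / c)\<^sup>2) \<le> 1 / (1 + ((u - a) / c)\<^sup>2) + 1 / (1 + ((u - (- a)) / c)\<^sup>2)"
proof (cases "u \<ge> 0")
  case False
  then have "((\<bar>u\<bar> - a) / c)\<^sup>2 = ((u - (- a)) / c)\<^sup>2"
    by (simp add: power_divide power2_commute[of "- u"] power2_eq_square algebra_simps)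
  then show ?thesis by simp
qed simp

text \<open>
  For \<open>s = -3a\<^sup>2\<close> the contour passes through the saddles \<open>\<plusminus>a\<close> along the directions of steepest
  descent.
\<close>

lemma airy_integral_neg_bounds:
  fixes a \<epsilon> :: real
  assumes \<epsilon>: "\<epsilon> > 0" and a: "a > 0"
  defines "E \<equiv> exp (\<epsilon>\<^sup>2 * a\<^sup>2)"
  shows "norm (LINT u|lborel. airy_integrand 0 \<epsilon> (- 3 * a\<^sup>2) (of_real u)) \<le> 4 * sqrt 2 * pi * E"
    and "norm (LINT u|lborel. airy_integrand 1 \<epsilon> (- 3 * a\<^sup>2) (of_real u)) \<le> 8 * sqrt 2 * pi * (1 + sqrt a) * E"
proof -
  \<comment> \<open>The width of the Gaussian exp(-2 a w^2) at the saddles.\<close>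
  define c where "c = 1 / sqrt (2 * a)"
  have c: "c > 0" using a by (simp add: c_def)
  have c2: "(w / c)\<^sup>2 = 2 * a * w\<^sup>2" for w
    using a by (simp add: c_def power_mult_distrib)
  have ex: "- \<epsilon>\<^sup>2 * (u\<^sup>2 - (\<bar>u\<bar> + - a)\<^sup>2) + (\<bar>u\<bar> + - a) ^ 3 - 3 * u\<^sup>2 * (\<bar>u\<bar> + - a) - (- 3 * a\<^sup>2) * (\<bar>u\<bar> + - a)
      \<le> \<epsilon>\<^sup>2 * a\<^sup>2 + (- (\<bar>\<bar>u\<bar> - a\<bar> ^ 3) + (- (2 * a * (\<bar>u\<bar> - a)\<^sup>2)))" (is "?l \<le> ?r") for u
  proof -
    define v where "v = \<bar>u\<bar>"
    define w where "w = v - a"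
    have v: "v \<ge> 0" "u\<^sup>2 = v\<^sup>2" by (auto simp: v_def)
    \<comment> \<open>With w = |u| - a the cubic and linear terms combine to exactly -w^2 (2|u| +
      4a); no term linear in w survives, as the path crosses saddles. The Gaussian cutoff costs at
      most \<epsilon>^2 a^2, which \<open>E\<close> records and which tends to 0 with
      \<epsilon>.\<close>
    have l: "?l = - \<epsilon>\<^sup>2 * (2 * a * v - a\<^sup>2) - w\<^sup>2 * (2 * v + 4 * a)"
      unfolding v(2) v_def[symmetric] w_def by (simp add: power2_eq_square power3_eq_cube algebra_simps)
    have "\<bar>w\<bar> \<le> v + a" using v a by (auto simp: w_def)
    then have "w\<^sup>2 * (\<bar>w\<bar> + 2 * a) \<le> w\<^sup>2 * (2 * v + 4 * a)"
      using v a by (intro mult_left_mono) auto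
    moreover have "w\<^sup>2 * \<bar>w\<bar> = \<bar>w\<bar> ^ 3" by (simp add: power2_eq_square power3_eq_cube flip: abs_mult)
    moreover have "\<epsilon>\<^sup>2 * (2 * a * v) \<ge> 0" using v a by simp
    ultimately show ?thesis unfolding l
      unfolding v_def[symmetric] w_def[symmetric] by (simp add: algebra_simps)
  qed
  define K where "K c = (\<lambda>u. 1 / (1 + ((u - a) / c)\<^sup>2) + 1 / (1 + ((u - (- a)) / c)\<^sup>2))" for c
  have K: "has_bochner_integral lborel (K c) (2 * pi * c)" if "c > 0" for c
    unfolding K_def
    using has_bochner_integral_add[OF has_bochner_integral_cauchy_kernel[OF that, of a] has_bochner_integral_cauchy_kernel[OF that, of "- a"]]
    by (simp add: mult.assoc)
  have K_le: "1 / (1 + ((\<bar>u\<bar> - a) / c)\<^sup>2) \<le> K c u" for c u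
    unfolding K_def by (rule cauchy_kernel_abs_le)
  have Epos: "E > 0" by (simp add: E_def)
  have exE: "exp (- \<epsilon>\<^sup>2 * (u\<^sup>2 - (\<bar>u\<bar> + - a)\<^sup>2) + (\<bar>u\<bar> + - a) ^ 3 - 3 * u\<^sup>2 * (\<bar>u\<bar> + - a) - (- 3 * a\<^sup>2) * (\<bar>u\<bar> + - a))
     \<le> E * (exp (- (\<bar>\<bar>u\<bar> - a\<bar> ^ 3)) * exp (- (2 * a * (\<bar>u\<bar> - a)\<^sup>2)))" for u
    unfolding E_def exp_add[symmetric] using ex[of u] by simp
  have le2: "exp (- (2 * a * w\<^sup>2)) \<le> 1 / (1 + (w / c)\<^sup>2)" for w
    unfolding c2 using exp_ge_add_one_self[of "2 * a * w\<^sup>2"] a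
    by (simp add: exp_minus inverse_eq_divide frac_le add_pos_nonneg)
  have "norm (LINT u|lborel. airy_integrand 0 \<epsilon> (- 3 * a\<^sup>2) (of_real u)) \<le> (LINT u|lborel. sqrt 2 * E * 2 * K 1 u)"
  proof (rule airy_integral_contour_bound[OF \<epsilon>, where b = "- a"])
    show "integrable lborel (\<lambda>u. sqrt 2 * E * 2 * K 1 u)"
      using K[of 1] by (auto simp: has_bochner_integral_iff)
    fix u
    let ?w = "\<bar>u\<bar> - a"
    have "exp (- (\<bar>?w\<bar> ^ 3)) * exp (- (2 * a * ?w\<^sup>2)) \<le> 2 / (1 + ?w\<^sup>2) * 1"
      using a by (intro mult_mono exp_minus_cube_bounds) auto
    also have "\<dots> \<le> 2 * K 1 u" using K_le[of u 1] by simp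
    finally have *: "E * (exp (- (\<bar>?w\<bar> ^ 3)) * exp (- (2 * a * ?w\<^sup>2))) \<le> E * (2 * K 1 u)"
      using Epos by simp
    show "sqrt (u\<^sup>2 + (\<bar>u\<bar> + - a)\<^sup>2) ^ 0 * exp (- \<epsilon>\<^sup>2 * (u\<^sup>2 - (\<bar>u\<bar> + - a)\<^sup>2) + (\<bar>u\<bar> + - a) ^ 3 - 3 * u\<^sup>2 * (\<bar>u\<bar> + - a) - (- 3 * a\<^sup>2) * (\<bar>u\<bar> + - a)) * sqrt 2 \<le> sqrt 2 * E * 2 * K 1 u"
      using mult_right_mono[OF order_trans[OF exE[of u] *], of "sqrt 2"] by (simp add: mult_ac)
  qed
  also have "\<dots> = 4 * sqrt 2 * pi * E" using K[of 1] by (simp add: has_bochner_integral_iff)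
  finally show "norm (LINT u|lborel. airy_integrand 0 \<epsilon> (- 3 * a\<^sup>2) (of_real u)) \<le> 4 * sqrt 2 * pi * E" .
  have "norm (LINT u|lborel. airy_integrand 1 \<epsilon> (- 3 * a\<^sup>2) (of_real u)) \<le> (LINT u|lborel. sqrt 2 * E * (4 * K 1 u + a * K c u))"
  proof (rule airy_integral_contour_bound[OF \<epsilon>, where b = "- a"])
    show "integrable lborel (\<lambda>u. sqrt 2 * E * (4 * K 1 u + a * K c u))"
      using K[of 1] K[OF c] by (auto simp: has_bochner_integral_iff)
    fix u
    let ?w = "\<bar>u\<bar> - a"
    let ?e1 = "exp (- (\<bar>?w\<bar> ^ 3))" and ?e2 = "exp (- (2 * a * ?w\<^sup>2))"
    let ?e = "exp (- \<epsilon>\<^sup>2 * (u\<^sup>2 - (\<bar>u\<bar> + - a)\<^sup>2) + (\<bar>u\<bar> + - a) ^ 3 - 3 * u\<^sup>2 * (\<bar>u\<bar> + - a) - (- 3 * a\<^sup>2) * (\<bar>u\<bar> + - a))"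
    have "sqrt (u\<^sup>2 + (\<bar>u\<bar> + - a)\<^sup>2) \<le> \<bar>u\<bar> + \<bar>\<bar>u\<bar> + - a\<bar>" by (rule sqrt_sum_squares_le_sum_abs)
    also have "\<dots> \<le> 2 * \<bar>?w\<bar> + a" using abs_ge_self[of ?w] by simp
    finally have s: "sqrt (u\<^sup>2 + (\<bar>u\<bar> + - a)\<^sup>2) \<le> 2 * \<bar>?w\<bar> + a" .
    \<comment> \<open>Two scales: the part |w| of |z| is absorbed by the cubic decay with a bounded
      constant, whereas the part a is integrated against the Gaussian of width c. As a c is of order
      sqrt a, this is the origin of the growth |s|^(1/4).\<close>
    have "(2 * \<bar>?w\<bar> + a) * (?e1 * ?e2) = 2 * (\<bar>?w\<bar> * ?e1) * ?e2 + a * (?e1 * ?e2)"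
      by (simp add: algebra_simps)
    also have "\<dots> \<le> 2 * (2 / (1 + ?w\<^sup>2)) * 1 + a * (1 * (1 / (1 + (?w / c)\<^sup>2)))"
      using a le2 by (intro add_mono mult_mono exp_minus_cube_bounds) auto
    also have "\<dots> \<le> 4 * K 1 u + a * K c u"
      using K_le[of u 1] K_le[of u c] a by (intro add_mono) (auto intro!: mult_left_mono simp: divide_inverse)
    finally have k: "(2 * \<bar>?w\<bar> + a) * (?e1 * ?e2) \<le> 4 * K 1 u + a * K c u" .
    have "sqrt (u\<^sup>2 + (\<bar>u\<bar> + - a)\<^sup>2) ^ 1 * ?e * sqrt 2 \<le> (2 * \<bar>?w\<bar> + a) * (E * (?e1 * ?e2)) * sqrt 2"
      using s exE[of u] a Epos by (intro mult_mono) auto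
    also have "\<dots> = sqrt 2 * E * ((2 * \<bar>?w\<bar> + a) * (?e1 * ?e2))" by (simp add: mult_ac)
    also have "\<dots> \<le> sqrt 2 * E * (4 * K 1 u + a * K c u)"
      using k Epos by (intro mult_left_mono) auto
    finally show "sqrt (u\<^sup>2 + (\<bar>u\<bar> + - a)\<^sup>2) ^ 1 * ?e * sqrt 2 \<le> sqrt 2 * E * (4 * K 1 u + a * K c u)" .
  qed
  also have "\<dots> = sqrt 2 * E * (8 * pi + a * (2 * pi * c))"
    using K[of 1] K[OF c] by (simp add: has_bochner_integral_iff)
  also have "\<dots> \<le> sqrt 2 * E * (8 * pi * (1 + sqrt a))"
  proof -
    have "a * c = sqrt a / sqrt 2" using a
      by (simp add: c_def real_sqrt_mult field_simps)
    also have "\<dots> \<le> sqrt a" using a by (simp add: divide_le_eq)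
    finally have "a * c \<le> sqrt a" .
    then have "2 * pi * (a * c) \<le> 2 * pi * sqrt a" by simp
    also have "\<dots> \<le> 8 * pi * sqrt a" using a by simp
    finally have "8 * pi + a * (2 * pi * c) \<le> 8 * pi * (1 + sqrt a)" by (simp add: algebra_simps)
    then show ?thesis using Epos by (intro mult_left_mono) auto
  qed
  also have "\<dots> = 8 * sqrt 2 * pi * (1 + sqrt a) * E" by (simp only: mult_ac)
  finally show "norm (LINT u|lborel. airy_integrand 1 \<epsilon> (- 3 * a\<^sup>2) (of_real u)) \<le> 8 * sqrt 2 * pi * (1 + sqrt a) * E" .
qed

text \<open>With b = a the lowest point of the path is the saddle i a of z^3 + 3 a^2 z. Above the
  diagonals |y| = |u| the Gaussian factor grows; the condition \<epsilon>^2 <= a/4 lets half of the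
  decay exp(-y a^2) pay for this, which leaves exp(-a^3/2). For a = 0 the path runs along |y| = |u|,
  where the Gaussian factor has modulus 1.\<close>

lemma airy_integral_pos_bounds:
  fixes a \<epsilon> :: real
  assumes \<epsilon>: "\<epsilon> > 0" and a: "a \<ge> 0" and small: "a = 0 \<or> \<epsilon>\<^sup>2 \<le> a / 4" and k: "k = 0 \<or> k = 1"
  shows "norm (LINT u|lborel. airy_integrand k \<epsilon> (3 * a\<^sup>2) (of_real u)) \<le> 4 * sqrt 2 * pi * (1 + a) * exp (- (a ^ 3 / 2))"
proof -
  define K where "K = (\<lambda>u. 1 / (1 + ((u - 0) / 1)\<^sup>2) :: real)"
  have K: "has_bochner_integral lborel K pi"
    unfolding K_def using has_bochner_integral_cauchy_kernel[of 1 0] by simp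
  have K': "K u = 1 / (1 + u\<^sup>2)" for u by (simp add: K_def)
  have exE: "exp (- \<epsilon>\<^sup>2 * (u\<^sup>2 - (\<bar>u\<bar> + a)\<^sup>2) + (\<bar>u\<bar> + a) ^ 3 - 3 * u\<^sup>2 * (\<bar>u\<bar> + a) - (3 * a\<^sup>2) * (\<bar>u\<bar> + a))
     \<le> exp (- (a ^ 3 / 2)) * exp (- (\<bar>u\<bar> ^ 3))" (is "exp ?l \<le> _") for u
  proof -
    define v where "v = \<bar>u\<bar>"
    define y where "y = v + a"
    have v: "v \<ge> 0" "u\<^sup>2 = v\<^sup>2" by (auto simp: v_def)
    have y: "y \<ge> v" "y \<ge> a" "y \<ge> 0" using v a by (auto simp: y_def)
    have "?l = \<epsilon>\<^sup>2 * (a * (y + v)) + y * (y\<^sup>2 - 3 * v\<^sup>2 - 3 * a\<^sup>2)"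
      unfolding v(2) v_def[symmetric] y_def by (simp add: power2_eq_square power3_eq_cube algebra_simps)
    moreover have "\<epsilon>\<^sup>2 * (a * (y + v)) \<le> y * (a\<^sup>2 / 2)"
      using small
    proof
      assume e: "\<epsilon>\<^sup>2 \<le> a / 4"
      have "\<epsilon>\<^sup>2 * (a * (y + v)) \<le> a / 4 * (a * (2 * y))" using e a y v by (intro mult_mono) auto
      then show ?thesis by (simp add: power2_eq_square mult_ac)
    qed simp
    moreover have "y\<^sup>2 \<le> 2 * v\<^sup>2 + 2 * a\<^sup>2"
      using zero_le_power2[of "v - a"] unfolding y_def by (simp add: power2_eq_square algebra_simps)
    then have "y * (y\<^sup>2 - 3 * v\<^sup>2 - 3 * a\<^sup>2) \<le> y * (- v\<^sup>2 - a\<^sup>2)"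
      using y by (intro mult_left_mono) auto
    moreover have "y * v\<^sup>2 \<ge> v * v\<^sup>2" "y * (a\<^sup>2 / 2) \<ge> a * (a\<^sup>2 / 2)" using y by (auto intro!: mult_right_mono)
    ultimately have "?l \<le> - (a ^ 3 / 2) + - (v ^ 3)"
      by (simp add: power2_eq_square power3_eq_cube algebra_simps)
    then show ?thesis unfolding exp_add[symmetric] v_def[symmetric] by simp
  qed
  have "norm (LINT u|lborel. airy_integrand k \<epsilon> (3 * a\<^sup>2) (of_real u)) \<le> (LINT u|lborel. sqrt 2 * exp (- (a ^ 3 / 2)) * (4 + 4 * a) * K u)"
  proof (rule airy_integral_contour_bound[OF \<epsilon>, where b = a])
    show "integrable lborel (\<lambda>u. sqrt 2 * exp (- (a ^ 3 / 2)) * (4 + 4 * a) * K u)"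
      using K by (auto simp: has_bochner_integral_iff)
    fix u :: real
    let ?e = "exp (- \<epsilon>\<^sup>2 * (u\<^sup>2 - (\<bar>u\<bar> + a)\<^sup>2) + (\<bar>u\<bar> + a) ^ 3 - 3 * u\<^sup>2 * (\<bar>u\<bar> + a) - (3 * a\<^sup>2) * (\<bar>u\<bar> + a))"
    have Kn: "K u \<ge> 0" by (simp add: K')
    have s: "sqrt (u\<^sup>2 + (\<bar>u\<bar> + a)\<^sup>2) \<le> 2 * \<bar>u\<bar> + a"
      using sqrt_sum_squares_le_sum_abs[of u "\<bar>u\<bar> + a"] a by simp
    have b: "exp (- (\<bar>u\<bar> ^ 3)) \<le> 2 * K u" "\<bar>u\<bar> * exp (- (\<bar>u\<bar> ^ 3)) \<le> 2 * K u"
      using exp_minus_cube_bounds[of u] by (auto simp: K')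
    have ab: "a * exp (- (\<bar>u\<bar> ^ 3)) \<le> a * (2 * K u)" using b(1) a by (rule mult_left_mono)
    have aK: "a * K u \<ge> 0" using a Kn by simp
    have "sqrt (u\<^sup>2 + (\<bar>u\<bar> + a)\<^sup>2) ^ k * exp (- (\<bar>u\<bar> ^ 3)) \<le> (4 + 4 * a) * K u"
      using k
    proof
      assume "k = 0" then show ?thesis using b(1) Kn aK by (simp add: algebra_simps)
    next
      assume "k = 1"
      then have "sqrt (u\<^sup>2 + (\<bar>u\<bar> + a)\<^sup>2) ^ k * exp (- (\<bar>u\<bar> ^ 3)) \<le> (2 * \<bar>u\<bar> + a) * exp (- (\<bar>u\<bar> ^ 3))"
        using s by simp
      also have "\<dots> = 2 * (\<bar>u\<bar> * exp (- (\<bar>u\<bar> ^ 3))) + a * exp (- (\<bar>u\<bar> ^ 3))" by (simp add: algebra_simps)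
      also have "\<dots> \<le> 2 * (2 * K u) + a * (2 * K u)" using b(2) ab by (intro add_mono) auto
      also have "\<dots> \<le> (4 + 4 * a) * K u" using aK by (simp add: algebra_simps)
      finally show ?thesis .
    qed
    then have *: "(sqrt (u\<^sup>2 + (\<bar>u\<bar> + a)\<^sup>2) ^ k * exp (- (\<bar>u\<bar> ^ 3))) * (exp (- (a ^ 3 / 2)) * sqrt 2) \<le> (4 + 4 * a) * K u * (exp (- (a ^ 3 / 2)) * sqrt 2)"
      by (rule mult_right_mono) auto
    have "sqrt (u\<^sup>2 + (\<bar>u\<bar> + a)\<^sup>2) ^ k * ?e * sqrt 2 \<le> sqrt (u\<^sup>2 + (\<bar>u\<bar> + a)\<^sup>2) ^ k * (exp (- (a ^ 3 / 2)) * exp (- (\<bar>u\<bar> ^ 3))) * sqrt 2"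
      using exE[of u] by (intro mult_mono mult_left_mono) auto
    also have "\<dots> = (sqrt (u\<^sup>2 + (\<bar>u\<bar> + a)\<^sup>2) ^ k * exp (- (\<bar>u\<bar> ^ 3))) * (exp (- (a ^ 3 / 2)) * sqrt 2)"
      by (simp only: mult_ac)
    also note *
    also have "(4 + 4 * a) * K u * (exp (- (a ^ 3 / 2)) * sqrt 2) = sqrt 2 * exp (- (a ^ 3 / 2)) * (4 + 4 * a) * K u"
      by (simp only: mult_ac)
    finally show "sqrt (u\<^sup>2 + (\<bar>u\<bar> + a)\<^sup>2) ^ k * ?e * sqrt 2 \<le> sqrt 2 * exp (- (a ^ 3 / 2)) * (4 + 4 * a) * K u" .
  qed
  also have "\<dots> = 4 * sqrt 2 * pi * (1 + a) * exp (- (a ^ 3 / 2))"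
    using K by (simp add: has_bochner_integral_iff algebra_simps)
  finally show ?thesis .
qed

lemma power_times_exp_minus_cube_bounded:
  "\<exists>C>0. \<forall>a\<ge>0. (1 + a) ^ n * exp (- (a ^ 3 / 2)) \<le> (C::real)"
proof -
  obtain C where C: "C > 0" "\<And>x. x \<ge> 0 \<Longrightarrow> x ^ n * exp (- (1 / 2 * x)) \<le> (C::real)"
    using power_times_exp_bounded[of "1/2" n] by auto
  have "(1 + a) ^ n * exp (- (a ^ 3 / 2)) \<le> exp 1 * C" if a: "a \<ge> 0" for a :: real
  proof -
    have "a * 1 \<le> a * a\<^sup>2 + 1"
    proof (cases "a \<le> 1")
      case False
      then have "a * 1 \<le> a * a\<^sup>2" using a by (intro mult_left_mono) auto
      then show ?thesis by simp
    qed (use a in \<open>simp add: add_increasing\<close>)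
    then have "- (a ^ 3 / 2) \<le> 1 + - (1 / 2 * (1 + a))" by (simp add: power2_eq_square power3_eq_cube field_simps)
    then have "exp (- (a ^ 3 / 2)) \<le> exp 1 * exp (- (1 / 2 * (1 + a)))"
      unfolding exp_add[symmetric] by simp
    then have "(1 + a) ^ n * exp (- (a ^ 3 / 2)) \<le> (1 + a) ^ n * (exp 1 * exp (- (1 / 2 * (1 + a))))"
      using a by (intro mult_left_mono) auto
    also have "\<dots> = exp 1 * ((1 + a) ^ n * exp (- (1 / 2 * (1 + a))))" by (simp only: mult_ac)
    also have "\<dots> \<le> exp 1 * C" using C(2)[of "1 + a"] a by (intro mult_left_mono) auto
    finally show ?thesis .
  qed
  then show ?thesis using C(1) by (intro exI[of _ "exp 1 * C"]) auto
qed

definition airy_int :: "nat \<Rightarrow> real \<Rightarrow> real \<Rightarrow> complex" where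
  "airy_int k \<epsilon> s = (LINT u|lborel. airy_integrand k \<epsilon> s (of_real u))"

text \<open>How small \<epsilon> must be depends on s, but the constant does not; this is enough,
  since \<epsilon> tends to 0 with x, y and t fixed. On the right exp(-a^3/2) with a = sqrt(s/3)
  beats every power, so \<open>N\<close> is free; on the left a = sqrt(-s/3) turns sqrt a into the
  power 1/4 of s.\<close>

lemma airy_int_bounds:
  "\<exists>C>0. \<forall>s. \<forall>\<^sub>F \<epsilon> in at_right 0.
     norm (airy_int 0 \<epsilon> s) \<le> C / (1 + max 0 s) ^ N \<and>
     norm (airy_int 1 \<epsilon> s) \<le> C * (1 + max 0 (- s)) powr (1 / 4) / (1 + max 0 s) ^ N"
proof -
  obtain C where C: "C > 0" "\<And>a. a \<ge> 0 \<Longrightarrow> (1 + a) ^ (2 * N + 1) * exp (- (a ^ 3 / 2)) \<le> (C::real)"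
    using power_times_exp_minus_cube_bounded[of "2 * N + 1"] by auto
  \<comment> \<open>One summand for each sign of s. For s >= 0, the estimate 1 + s <= 3 (1 + a)^2
    produces 3^N and, with the prefactor 1 + a, the power 2N + 1. For s < 0, the 32 is 8 times 2
    from 1 + sqrt a <= 2 (1 - s)^(1/4), times 2 from
    \<open>exp (\<epsilon>\<^sup>2 * a\<^sup>2)\<close> < 2.\<close>
  define K where "K = 4 * sqrt 2 * pi * 3 ^ N * C + 32 * sqrt 2 * pi"
  have ineq: "4 * sqrt 2 * pi * 3 ^ N * C \<ge> 0" using C by simp
  have "\<forall>\<^sub>F \<epsilon> in at_right 0.
     norm (airy_int 0 \<epsilon> s) \<le> K / (1 + max 0 s) ^ N \<and>
     norm (airy_int 1 \<epsilon> s) \<le> K * (1 + max 0 (- s)) powr (1 / 4) / (1 + max 0 s) ^ N" for s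
  proof (cases "s < 0")
    case True
    define a where "a = sqrt (- s / 3)"
    have a: "a > 0" "s = - 3 * a\<^sup>2" using True by (simp_all add: a_def)
    have sa: "sqrt a \<le> (1 - s) powr (1 / 4)"
    proof -
      have "sqrt a = ((- s / 3) powr (1 / 2)) powr (1 / 2)"
      proof -
        have "(- s / 3) powr (1 / 2) = a" unfolding a_def by (rule powr_half_sqrt) (use True in simp)
        moreover have "a powr (1 / 2) = sqrt a" by (rule powr_half_sqrt) (use a in simp)
        ultimately show ?thesis by (simp only:)
      qed
      also have "\<dots> = (- s / 3) powr (1 / 4)" by (simp add: powr_powr)
      also have "\<dots> \<le> (1 - s) powr (1 / 4)" using True by (intro powr_mono2) auto
      finally show ?thesis .
    qed
    have s1: "1 \<le> (1 - s) powr (1 / 4)" using True by (intro ge_one_powr_ge_zero) auto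
    have "((\<lambda>\<epsilon>. exp (\<epsilon>\<^sup>2 * a\<^sup>2)) \<longlongrightarrow> exp (0\<^sup>2 * a\<^sup>2)) (at_right (0::real))"
      by (intro tendsto_intros)
    then have "\<forall>\<^sub>F \<epsilon> in at_right (0::real). exp (\<epsilon>\<^sup>2 * a\<^sup>2) < 2"
      by (rule order_tendstoD) simp
    with eventually_at_right_less[of 0] show ?thesis
    proof eventually_elim
      case (elim \<epsilon>)
      have "norm (airy_int 0 \<epsilon> s) \<le> 4 * sqrt 2 * pi * exp (\<epsilon>\<^sup>2 * a\<^sup>2)"
        unfolding airy_int_def a(2) by (rule airy_integral_neg_bounds(1)) (use elim a in auto)
      also have "\<dots> \<le> 4 * sqrt 2 * pi * 2" using elim by (intro mult_left_mono) auto
      also have "\<dots> \<le> K" unfolding K_def using ineq by simp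
      finally have 1: "norm (airy_int 0 \<epsilon> s) \<le> K" .
      have "norm (airy_int 1 \<epsilon> s) \<le> 8 * sqrt 2 * pi * (1 + sqrt a) * exp (\<epsilon>\<^sup>2 * a\<^sup>2)"
        unfolding airy_int_def a(2) by (rule airy_integral_neg_bounds(2)) (use elim a in auto)
      also have "\<dots> \<le> 8 * sqrt 2 * pi * (2 * (1 - s) powr (1 / 4)) * 2"
        using elim a s1 sa by (intro mult_mono mult_left_mono) auto
      also have "\<dots> = 32 * sqrt 2 * pi * (1 - s) powr (1 / 4)" by simp
      also have "\<dots> \<le> K * (1 - s) powr (1 / 4)" unfolding K_def using ineq by (intro mult_right_mono) auto
      finally show ?case using 1 True by (simp add: max_def)
    qed
  next
    case False
    define a where "a = sqrt (s / 3)"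
    have a: "a \<ge> 0" "s = 3 * a\<^sup>2" using False by (simp_all add: a_def)
    have "\<forall>\<^sub>F \<epsilon> in at_right (0::real). a = 0 \<or> \<epsilon>\<^sup>2 \<le> a / 4"
    proof (cases "a = 0")
      case False
      have "((\<lambda>\<epsilon>. \<epsilon>\<^sup>2) \<longlongrightarrow> 0\<^sup>2) (at_right (0::real))" by (intro tendsto_intros)
      then have "\<forall>\<^sub>F \<epsilon> in at_right (0::real). \<epsilon>\<^sup>2 < a / 4"
        by (rule order_tendstoD) (use False a in simp)
      then show ?thesis by eventually_elim simp
    qed simp
    with eventually_at_right_less[of 0] show ?thesis
    proof eventually_elim
      case (elim \<epsilon>)
      have b: "norm (airy_int k \<epsilon> s) \<le> K / (1 + s) ^ N" if k: "k = 0 \<or> k = 1" for k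
      proof -
        have "(1 + s) ^ N \<le> (3 * (1 + a)\<^sup>2) ^ N"
          unfolding a(2) using a(1) by (intro power_mono) (auto simp: power2_eq_square algebra_simps)
        then have "4 * sqrt 2 * pi * (1 + a) * exp (- (a ^ 3 / 2)) * (1 + s) ^ N
            \<le> 4 * sqrt 2 * pi * (1 + a) * exp (- (a ^ 3 / 2)) * (3 * (1 + a)\<^sup>2) ^ N"
          using a(1) by (intro mult_left_mono) auto
        also have "\<dots> = 4 * sqrt 2 * pi * 3 ^ N * ((1 + a) ^ (2 * N + 1) * exp (- (a ^ 3 / 2)))"
          by (simp add: power_mult_distrib power_mult)
        also have "\<dots> \<le> 4 * sqrt 2 * pi * 3 ^ N * C" using C(2)[OF a(1)] by (intro mult_left_mono) auto
        also have "\<dots> \<le> K" unfolding K_def by simp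
        finally have "4 * sqrt 2 * pi * (1 + a) * exp (- (a ^ 3 / 2)) \<le> K / (1 + s) ^ N"
          using False by (simp add: pos_le_divide_eq)
        moreover have "norm (airy_int k \<epsilon> s) \<le> 4 * sqrt 2 * pi * (1 + a) * exp (- (a ^ 3 / 2))"
          unfolding airy_int_def a(2) by (rule airy_integral_pos_bounds) (use elim a k in auto)
        ultimately show ?thesis by linarith
      qed
      have "max 0 (- s) = 0" "max 0 s = s" using False by auto
      then show ?case using b[of 0] b[of 1] by (simp del: One_nat_def)
    qed
  qed
  moreover have "K > 0" unfolding K_def using ineq by (intro add_nonneg_pos) auto
  ultimately show ?thesis by blast
qed

section \<open>Schwartz functions and oscillatory integrals in the plane\<close>

definition cauchy_kernel2 :: "real \<Rightarrow> real \<times> real \<Rightarrow> real" where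
  "cauchy_kernel2 c p = 1 / (1 + (fst p / c)\<^sup>2) * (1 / (1 + (snd p / c)\<^sup>2))"

lemma cauchy_kernel2_nonneg [simp]: "cauchy_kernel2 c p \<ge> 0"
  by (simp add: cauchy_kernel2_def)

lemma measurable_cauchy_kernel2 [measurable]: "cauchy_kernel2 c \<in> borel_measurable borel"
  unfolding cauchy_kernel2_def[abs_def] borel_prod[symmetric] by measurable

lemma nn_integral_cauchy_kernel2:
  assumes "c > 0"
  shows "(\<integral>\<^sup>+p. ennreal (cauchy_kernel2 c p) \<partial>lborel) = ennreal ((pi * c)\<^sup>2)"
proof -
  have k: "(\<integral>\<^sup>+v. ennreal (1 / (1 + (v / c)\<^sup>2)) \<partial>lborel) = ennreal (pi * c)"
    using nn_integral_cauchy_kernel[OF assms, of 0] by simp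
  have "(\<integral>\<^sup>+p. ennreal (cauchy_kernel2 c p) \<partial>lborel) =
      (\<integral>\<^sup>+u. (\<integral>\<^sup>+v. ennreal (1 / (1 + (u / c)\<^sup>2)) * ennreal (1 / (1 + (v / c)\<^sup>2)) \<partial>lborel) \<partial>lborel)"
  proof -
    have "(\<integral>\<^sup>+p. ennreal (cauchy_kernel2 c p) \<partial>lborel) =
      (\<integral>\<^sup>+u. (\<integral>\<^sup>+v. ennreal (cauchy_kernel2 c (u, v)) \<partial>lborel) \<partial>lborel)"
      by (subst lborel_prod[symmetric], subst lborel.nn_integral_fst[symmetric]) (auto simp: lborel_prod)
    moreover have "ennreal (cauchy_kernel2 c (u, v)) = ennreal (1 / (1 + (u / c)\<^sup>2)) * ennreal (1 / (1 + (v / c)\<^sup>2))" for u v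
      unfolding cauchy_kernel2_def by (subst ennreal_mult'[symmetric]) (auto simp del: times_divide_eq_left times_divide_eq_right)
    ultimately show ?thesis by simp
  qed
  also have "\<dots> = (\<integral>\<^sup>+u. ennreal (1 / (1 + (u / c)\<^sup>2)) * ennreal (pi * c) \<partial>lborel)"
    by (subst nn_integral_cmult) (auto simp: k)
  also have "\<dots> = ennreal (pi * c) * ennreal (pi * c)"
    by (subst nn_integral_multc) (simp_all add: k)
  also have "\<dots> = ennreal ((pi * c)\<^sup>2)"
    unfolding power2_eq_square using assms by (intro ennreal_mult''[symmetric]) simp
  finally show ?thesis .
qed

lemma integrable_cauchy_kernel2:
  assumes "c > 0"
  shows "integrable lborel (cauchy_kernel2 c)"
  by (rule integrableI_bounded) (auto simp: nn_integral_cauchy_kernel2[OF assms])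

lemma integral_deriv_eq_0:
  fixes F f :: "real \<Rightarrow> complex"
  assumes F: "\<And>x. (F has_vector_derivative f x) (at x)" and f: "continuous_on UNIV f"
    and bF: "\<And>x. norm (F x) \<le> C / (1 + x\<^sup>2)" and bf: "\<And>x. norm (f x) \<le> C / (1 + x\<^sup>2)"
  shows "(LINT x|lborel. f x) = 0"
proof -
  have "integrable lborel (\<lambda>x. C * (1 / (1 + ((x - 0) / 1)\<^sup>2)))"
    using has_bochner_integral_cauchy_kernel[of 1 0] by (intro integrable_mult_right) (auto simp: has_bochner_integral_iff)
  then have int: "integrable lborel f"
  proof (rule Bochner_Integration.integrable_bound)
    show "f \<in> borel_measurable lborel" using f by (simp add: borel_measurable_continuous_onI)
    show "AE x in lborel. norm (f x) \<le> norm (C * (1 / (1 + ((x - 0) / 1)\<^sup>2)))"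
      using bf order_trans[OF bf abs_ge_self] by (intro AE_I2) (simp add: abs_mult)
  qed
  have "(\<lambda>n. C / (1 + (real n)\<^sup>2)) \<longlonglongrightarrow> 0"
    by (intro tendsto_divide_0[OF tendsto_const] filterlim_at_top_imp_at_infinity filterlim_tendsto_add_at_top[OF tendsto_const]
         filterlim_pow_at_top filterlim_real_sequentially) auto
  then have "(\<lambda>n. F (real n)) \<longlonglongrightarrow> 0" "(\<lambda>n. F (- real n)) \<longlonglongrightarrow> 0"
  proof -
    assume lim: "(\<lambda>n. C / (1 + (real n)\<^sup>2)) \<longlonglongrightarrow> 0"
    show "(\<lambda>n. F (real n)) \<longlonglongrightarrow> 0"
      by (rule Lim_null_comparison[OF always_eventually lim]) (use bF in blast)
    show "(\<lambda>n. F (- real n)) \<longlonglongrightarrow> 0"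
      by (rule Lim_null_comparison[OF always_eventually lim]) (use bF[of "- real _"] in simp)
  qed
  then have "(\<lambda>n. F (real n) - F (- real n)) \<longlonglongrightarrow> 0 - 0"
    by (intro tendsto_diff)
  moreover have "(LINT x|lborel. indicator {- real n..real n} x *\<^sub>R f x) = F (real n) - F (- real n)" for n
    by (rule integral_FTC_atLeastAtMost) (auto intro: has_vector_derivative_at_within F continuous_on_subset[OF f])
  ultimately show ?thesis
    using tendsto_integral_symmetric_interval[OF int] LIMSEQ_unique by fastforce
qed

text \<open>By Fubini it suffices that each inner integral over a horizontal line vanishes. The
  product kernel plays two parts: as a bound of \<open>f\<close> it gives integrability over the
  plane, as a bound of \<open>F\<close> it kills the boundary terms on every line.\<close>

lemma integral_partial_deriv_eq_0:
  fixes F f :: "real \<times> real \<Rightarrow> complex"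
  assumes F: "\<And>u v. ((\<lambda>u. F (u, v)) has_vector_derivative f (u, v)) (at u)" and f: "continuous_on UNIV f"
    and bF: "\<And>p. norm (F p) \<le> C * cauchy_kernel2 1 p" and bf: "\<And>p. norm (f p) \<le> C * cauchy_kernel2 1 p"
  shows "(LINT p|lborel. f p) = 0"
proof -
  have int: "integrable lborel f"
  proof (rule Bochner_Integration.integrable_bound)
    show "integrable lborel (\<lambda>p. C * cauchy_kernel2 1 p)"
      by (intro integrable_mult_right integrable_cauchy_kernel2) simp
    show "f \<in> borel_measurable lborel" using f by (simp add: borel_measurable_continuous_onI)
    show "AE x in lborel. norm (f x) \<le> norm (C * cauchy_kernel2 1 x)"
      using order_trans[OF bf abs_ge_self] by auto
  qed
  have inner: "(LINT u|lborel. f (u, v)) = 0" for v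
  proof (rule integral_deriv_eq_0)
    show "((\<lambda>u. F (u, v)) has_vector_derivative f (u, v)) (at u)" for u by (rule F)
    show "continuous_on UNIV (\<lambda>u. f (u, v))"
      by (intro continuous_on_compose2[OF f] continuous_intros) auto
    show "norm (F (u, v)) \<le> C * (1 / (1 + v\<^sup>2)) / (1 + u\<^sup>2)" for u
      using bF[of "(u, v)"] by (simp add: cauchy_kernel2_def mult.commute)
    show "norm (f (u, v)) \<le> C * (1 / (1 + v\<^sup>2)) / (1 + u\<^sup>2)" for u
      using bf[of "(u, v)"] by (simp add: cauchy_kernel2_def mult.commute)
  qed
  have "(LINT p|lborel. f p) = (LINT v|lborel. LINT u|lborel. f (u, v))"
    using lborel_pair.integral_snd[of "\<lambda>u v. f (u, v)"] int by (simp add: lborel_prod)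
  then show ?thesis by (simp add: inner)
qed

section \<open>Schwartz cutoffs\<close>

lemma schwartzE:
  assumes "schwartz \<kappa>"
  obtains D where "D 0 0 = \<kappa>"
    "\<forall>j k p. (D j k has_derivative
        (\<lambda>h. of_real (fst h) * D (Suc j) k p + of_real (snd h) * D j (Suc k) p)) (at p)"
    "\<forall>j k N. bounded (range (\<lambda>p. of_real ((1 + norm p) ^ N) * D j k p))"
  using assms unfolding schwartz_def by (elim exE conjE)

lemma schwartz_decay:
  assumes "schwartz \<kappa>"
  obtains C where "C > 0" "\<And>p. norm (\<kappa> p) \<le> C / (1 + norm p) ^ N"
proof -
  obtain D where D: "D 0 0 = \<kappa>"
    and d: "\<forall>j k p. (D j k has_derivative
        (\<lambda>h. of_real (fst h) * D (Suc j) k p + of_real (snd h) * D j (Suc k) p)) (at p)"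
    and b: "\<forall>j k N. bounded (range (\<lambda>p. of_real ((1 + norm p) ^ N) * D j k p))"
    by (rule schwartzE[OF assms])
  from b[rule_format, of N 0 0] obtain C where C: "C > 0" "\<And>p. norm (of_real ((1 + norm p) ^ N) * \<kappa> p) \<le> C"
    unfolding bounded_pos D by auto
  have "norm (\<kappa> p) \<le> C / (1 + norm p) ^ N" for p
  proof -
    have "(1 + norm p) ^ N > 0" by (intro zero_less_power) (simp add: add_pos_nonneg)
    then show ?thesis using C(2)[of p] by (simp add: norm_mult field_simps del: of_real_power)
  qed
  with C(1) show ?thesis by (rule that)
qed

lemma schwartz_continuous:
  assumes "schwartz \<kappa>"
  shows "continuous_on UNIV \<kappa>"
proof -
  obtain D where D: "D 0 0 = \<kappa>"
    and d: "\<forall>j k p. (D j k has_derivative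
        (\<lambda>h. of_real (fst h) * D (Suc j) k p + of_real (snd h) * D j (Suc k) p)) (at p)"
    and b: "\<forall>j k N. bounded (range (\<lambda>p. of_real ((1 + norm p) ^ N) * D j k p))"
    by (rule schwartzE[OF assms])
  show ?thesis using d[rule_format, of 0 0] unfolding D
    by (intro continuous_at_imp_continuous_on ballI has_derivative_continuous) blast
qed

text \<open>Shifting the first index of the table \<open>D\<close> of derivatives shows that the
  class is closed under differentiation, so a differentiated cutoff can serve as a cutoff
  again.\<close>

lemma schwartz_partial_deriv:
  assumes "schwartz \<kappa>"
  obtains \<kappa>' where "schwartz \<kappa>'" "\<And>u v. ((\<lambda>u. \<kappa> (u, v)) has_vector_derivative \<kappa>' (u, v)) (at u)"
proof -
  obtain D where D: "D 0 0 = \<kappa>"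
    and d: "\<forall>j k p. (D j k has_derivative
        (\<lambda>h. of_real (fst h) * D (Suc j) k p + of_real (snd h) * D j (Suc k) p)) (at p)"
    and b: "\<forall>j k N. bounded (range (\<lambda>p. of_real ((1 + norm p) ^ N) * D j k p))"
    by (rule schwartzE[OF assms])
  have "schwartz (D 1 0)"
    unfolding schwartz_def
    by (intro exI[of _ "\<lambda>j k. D (Suc j) k"] conjI allI) (use d b in auto)
  moreover have "((\<lambda>u. \<kappa> (u, v)) has_vector_derivative D 1 0 (u, v)) (at u)" for u v
  proof -
    have "((\<lambda>u. (u, v)) has_derivative (\<lambda>h. (h, 0))) (at u)"
      by (auto intro!: derivative_eq_intros)
    from has_derivative_compose[OF this d[rule_format, of 0 0 "(u, v)"]] show ?thesis
      unfolding D has_vector_derivative_def by (simp add: scaleR_conv_of_real)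
  qed
  ultimately show ?thesis by (rule that)
qed

section \<open>Integration by parts in the first variable\<close>

definition phase :: "real \<Rightarrow> real \<Rightarrow> real \<Rightarrow> real \<times> real \<Rightarrow> real" where
  "phase t x y p = t * fst p ^ 3 + t * fst p * (snd p)\<^sup>2 + x * fst p + y * snd p"

definition ell :: "real \<Rightarrow> real \<Rightarrow> real \<times> real \<Rightarrow> real" where
  "ell t x p = t * (3 * (fst p)\<^sup>2 + (snd p)\<^sup>2) + (\<bar>x\<bar> + 1)"

text \<open>
  Symbols \<open>\<xi>\<^sup>a / ell\<^sup>b\<close> are closed under differentiation in \<open>\<xi>\<close>. The derivative of the phase in \<open>\<xi>\<close> may
  vanish for negative \<open>x\<close>; \<open>ell\<close> exceeds it by the constant \<open>\<bar>x\<bar> + 1 - x\<close> and is at least 1.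
\<close>

definition osc_symbol :: "real \<Rightarrow> real \<Rightarrow> real \<Rightarrow> nat \<Rightarrow> nat \<Rightarrow> real \<times> real \<Rightarrow> complex" where
  "osc_symbol t x y a b p = of_real (fst p ^ a / ell t x p ^ b) * exp (\<i> * of_real (phase t x y p))"

lemma ell_ge_1: "t > 0 \<Longrightarrow> ell t x p \<ge> 1"
  unfolding ell_def by (simp add: add_nonneg_nonneg)

lemma norm_osc_symbol:
  assumes "t > 0"
  shows "norm (osc_symbol t x y a b p) = \<bar>fst p\<bar> ^ a / ell t x p ^ b"
  using ell_ge_1[OF assms, of x p]
  by (simp add: osc_symbol_def norm_mult power_abs norm_divide norm_power)

lemma continuous_osc_symbol:
  assumes "t > 0"
  shows "continuous_on UNIV (osc_symbol t x y a b)"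
proof -
  have "ell t x p \<noteq> 0" for p using ell_ge_1[OF assms, of x p] by auto
  then show ?thesis
    unfolding osc_symbol_def[abs_def] phase_def
    by (intro continuous_intros) (auto simp: ell_def[abs_def] intro!: continuous_intros)
qed

text \<open>The \<xi>-derivative of the phase is \<open>ell\<close> - (|x| + 1 - x), so
  differentiating the exponential in the symbol (a, b + 1) returns the symbol (a, b) and an error of
  type (a, b + 1). Read backwards, this expresses (a, b) by a derivative and by (a - 1, b + 1), (a +
  1, b + 2) and (a, b + 1), whose orders a - 2b are lower by 3, 3 and 2. For a = 0 the truncated
  index \<open>a - 1\<close> comes with the coefficient 0.\<close>

lemma osc_symbol_partial_deriv:
  assumes t: "t > 0"
  shows "((\<lambda>u. osc_symbol t x y a (b + 1) (u, v)) has_vector_derivative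
     (of_nat a * osc_symbol t x y (a - 1) (b + 1) (u, v)
      - 6 * of_real t * of_nat (b + 1) * osc_symbol t x y (a + 1) (b + 2) (u, v)
      + \<i> * osc_symbol t x y a b (u, v)
      - \<i> * of_real (\<bar>x\<bar> + 1 - x) * osc_symbol t x y a (b + 1) (u, v))) (at u)"
proof -
  define e where "e = exp (\<i> * of_real (phase t x y (u, v)))"
  define d where "d = ell t x (u, v)"
  have d: "d > 0" using ell_ge_1[OF t, of x "(u, v)"] by (simp add: d_def)
  have phi: "((\<lambda>u. phase t x y (u, v)) has_real_derivative (d - (\<bar>x\<bar> + 1 - x))) (at u)"
    unfolding phase_def d_def ell_def fst_conv snd_conv
    by (auto intro!: derivative_eq_intros simp: power2_eq_square algebra_simps)
  have ed: "((\<lambda>u. exp (\<i> * of_real (phase t x y (u, v)))) has_vector_derivative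
       (\<i> * of_real (d - (\<bar>x\<bar> + 1 - x))) * e) (at u)"
  proof -
    have "((\<lambda>u. \<i> * complex_of_real (phase t x y (u, v))) has_vector_derivative \<i> * of_real (d - (\<bar>x\<bar> + 1 - x))) (at u)"
      using phi by (intro has_vector_derivative_mult_right has_vector_derivative_of_real) (simp add: has_real_derivative_iff_has_vector_derivative)
    from field_vector_diff_chain_at[OF this DERIV_exp] show ?thesis
      by (simp add: o_def e_def)
  qed
  have dd: "((\<lambda>u. ell t x (u, v)) has_real_derivative 6 * t * u) (at u)"
    unfolding ell_def fst_conv snd_conv by (auto intro!: derivative_eq_intros)
  have r: "((\<lambda>u. u ^ a / ell t x (u, v) ^ (b + 1)) has_real_derivative
      (real a * (u ^ (a - 1) / d ^ (b + 1)) - 6 * t * real (b + 1) * (u ^ (a + 1) / d ^ (b + 2)))) (at u)"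
  proof -
    have "((\<lambda>u. u ^ a / ell t x (u, v) ^ (b + 1)) has_real_derivative
       (real a * u ^ (a - 1) * d ^ (b + 1) - u ^ a * (real (b + 1) * d ^ b * (6 * t * u))) / (d ^ (b + 1) * d ^ (b + 1))) (at u)"
      unfolding d_def
    proof (rule DERIV_divide)
      show "((\<lambda>u. u ^ a) has_real_derivative real a * u ^ (a - 1)) (at u)"
        using DERIV_pow[of a u] unfolding One_nat_def .
      show "((\<lambda>u. ell t x (u, v) ^ (b + 1)) has_real_derivative real (b + 1) * ell t x (u, v) ^ b * (6 * t * u)) (at u)"
      proof -
        have "((\<lambda>u. ell t x (u, v) ^ (b + 1)) has_real_derivative real (b + 1) * (6 * t * u * ell t x (u, v) ^ b)) (at u)"
          using DERIV_power[OF dd, of "b + 1"] by simp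
        then show ?thesis by (simp only: mult_ac)
      qed
    qed (use d in \<open>simp_all add: d_def\<close>)
    also have "(real a * u ^ (a - 1) * d ^ (b + 1) - u ^ a * (real (b + 1) * d ^ b * (6 * t * u))) / (d ^ (b + 1) * d ^ (b + 1))
       = real a * (u ^ (a - 1) / d ^ (b + 1)) - 6 * t * real (b + 1) * (u ^ (a + 1) / d ^ (b + 2))"
    proof -
      have "(A * P - U * (n * Q * (6 * t * u))) / (P * P) = A / P - 6 * t * n * (U * u / (P * d))"
        if "P = Q * d" "Q > 0" for A P U n Q :: real
      proof -
        have "A * P / (P * P) = A / P" using that d by simp
        moreover have "U * (n * Q * (6 * t * u)) / (P * P) = Q * (6 * t * n * (U * u)) / (Q * (P * d))"
          unfolding that(1) by (simp add: mult_ac)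
        ultimately show ?thesis using that(2) by (simp add: diff_divide_distrib)
      qed
      from this[of "d ^ (b + 1)" "d ^ b" "real a * u ^ (a - 1)" "u ^ a" "real (b + 1)"] show ?thesis
        using d by (simp add: mult_ac)
    qed
    finally show ?thesis .
  qed
  have "((\<lambda>u. complex_of_real (u ^ a / ell t x (u, v) ^ (b + 1))) has_vector_derivative
      of_real (real a * (u ^ (a - 1) / d ^ (b + 1)) - 6 * t * real (b + 1) * (u ^ (a + 1) / d ^ (b + 2)))) (at u)"
    using r by (intro has_vector_derivative_of_real) (simp add: has_real_derivative_iff_has_vector_derivative)
  from has_vector_derivative_mult[OF this ed]
  have main: "((\<lambda>u. osc_symbol t x y a (b + 1) (u, v)) has_vector_derivative
      of_real (u ^ a / d ^ (b + 1)) * ((\<i> * of_real (d - (\<bar>x\<bar> + 1 - x))) * e) +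
      of_real (real a * (u ^ (a - 1) / d ^ (b + 1)) - 6 * t * real (b + 1) * (u ^ (a + 1) / d ^ (b + 2))) * e) (at u)"
    unfolding osc_symbol_def fst_conv d_def e_def .
  have q: "complex_of_real (u ^ a / d ^ b) = of_real (u ^ a / d ^ (b + 1)) * of_real d"
  proof -
    have "u ^ a / d ^ b = u ^ a / d ^ (b + 1) * d" using d by simp
    then show ?thesis by (simp only: of_real_mult)
  qed
  have r': "complex_of_real (real a * (u ^ (a - 1) / d ^ (b + 1)) - 6 * t * real (b + 1) * (u ^ (a + 1) / d ^ (b + 2)))
     = of_nat a * of_real (u ^ (a - 1) / d ^ (b + 1)) - 6 * of_real t * of_nat (b + 1) * of_real (u ^ (a + 1) / d ^ (b + 2))"
    by (simp only: of_real_diff of_real_mult of_real_of_nat_eq of_real_numeral)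
  have alg: "q1 * ((\<i> * (D - c)) * e) + (A * X - B * Y) * e = A * (X * e) - B * (Y * e) + \<i> * (q0 * e) - \<i> * c * (q1 * e)"
    if "q0 = q1 * D" for q0 q1 D c A B X Y :: complex
    unfolding that by (simp add: algebra_simps)
  show ?thesis
    using main[unfolded r' of_real_diff[of d] alg[OF q]]
    unfolding osc_symbol_def fst_conv d_def[symmetric] e_def[symmetric] .
qed

lemma cauchy_kernel2_ge: "1 / (1 + norm p) ^ 4 \<le> cauchy_kernel2 1 p"
proof -
  have f: "1 + (fst p)\<^sup>2 \<le> (1 + norm p)\<^sup>2" "1 + (snd p)\<^sup>2 \<le> (1 + norm p)\<^sup>2"
  proof -
    have "(fst p)\<^sup>2 + (snd p)\<^sup>2 = (norm p)\<^sup>2"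
      by (cases p) (simp add: norm_Pair)
    moreover have "(1 + norm p)\<^sup>2 = 1 + 2 * norm p + (norm p)\<^sup>2" by (simp add: power2_eq_square algebra_simps)
    ultimately show "1 + (fst p)\<^sup>2 \<le> (1 + norm p)\<^sup>2" "1 + (snd p)\<^sup>2 \<le> (1 + norm p)\<^sup>2"
      using norm_ge_zero[of p] zero_le_power2[of "fst p"] zero_le_power2[of "snd p"] by linarith+
  qed
  have "(1 + (fst p)\<^sup>2) * (1 + (snd p)\<^sup>2) \<le> (1 + norm p)\<^sup>2 * (1 + norm p)\<^sup>2"
    using f by (intro mult_mono) auto
  also have "\<dots> = (1 + norm p) ^ 4" by (simp add: numeral_eq_Suc)
  finally show ?thesis
    unfolding cauchy_kernel2_def by (simp add: frac_le add_pos_nonneg)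
qed

text \<open>The constant may depend on \<epsilon>: the bound only justifies integrating by parts for
  one fixed cutoff. The decay exponent a + 4 spends a powers on \<xi>^a and four on the kernel;
  \<open>e\<close> compares 1 + |\<epsilon> p| with 1 + |p|.\<close>

lemma schwartz_osc_bound:
  assumes t: "t > 0" and h: "schwartz h" and \<epsilon>: "\<epsilon> > 0"
  obtains C where "C > 0" "\<And>p. norm (h (\<epsilon> *\<^sub>R p) * osc_symbol t x y a b p) \<le> C * cauchy_kernel2 1 p"
proof -
  obtain C where C: "C > 0" "\<And>p. norm (h p) \<le> C / (1 + norm p) ^ (a + 4)"
    using schwartz_decay[OF h] by metis
  define e where "e = min 1 \<epsilon>"
  have e: "0 < e" "e \<le> 1" "e \<le> \<epsilon>" using \<epsilon> by (auto simp: e_def)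
  have "norm (h (\<epsilon> *\<^sub>R p) * osc_symbol t x y a b p) \<le> C / e ^ (a + 4) * cauchy_kernel2 1 p" for p
  proof -
    have n: "norm p \<ge> 0" by simp
    have "e * (1 + norm p) \<le> 1 + norm (\<epsilon> *\<^sub>R p)"
      using e n \<epsilon> by (simp add: distrib_left add_mono mult_right_mono)
    then have "(e * (1 + norm p)) ^ (a + 4) \<le> (1 + norm (\<epsilon> *\<^sub>R p)) ^ (a + 4)"
      using e by (intro power_mono) auto
    then have "C / (1 + norm (\<epsilon> *\<^sub>R p)) ^ (a + 4) \<le> C / (e * (1 + norm p)) ^ (a + 4)"
      using C e by (intro divide_left_mono mult_pos_pos zero_less_power) (auto simp: add_pos_nonneg)
    then have 1: "norm (h (\<epsilon> *\<^sub>R p)) \<le> C / (e * (1 + norm p)) ^ (a + 4)"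
      using C(2) order_trans by blast
    have "\<bar>fst p\<bar> \<le> 1 + norm p" using norm_fst_le[of "fst p" "snd p"] by simp
    moreover have "ell t x p ^ b \<ge> 1" using ell_ge_1[OF t] by (rule one_le_power)
    ultimately have 2: "norm (osc_symbol t x y a b p) \<le> (1 + norm p) ^ a / 1"
      unfolding norm_osc_symbol[OF t] by (intro frac_le power_mono) auto
    have "norm (h (\<epsilon> *\<^sub>R p) * osc_symbol t x y a b p) \<le> C / (e * (1 + norm p)) ^ (a + 4) * ((1 + norm p) ^ a / 1)"
      unfolding norm_mult using 1 2 by (rule mult_mono) (use C e in auto)
    also have "\<dots> = C / e ^ (a + 4) * (1 / (1 + norm p) ^ 4)"
    proof -
      have "C / (e * X) ^ (a + 4) * (X ^ a / 1) = C / e ^ (a + 4) * (1 / X ^ 4)" if "X > 0" for X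
      proof -
        have "(e * X) ^ (a + 4) = e ^ (a + 4) * (X ^ a * X ^ 4)"
          by (simp only: power_mult_distrib power_add[of X])
        then show ?thesis using that e by simp
      qed
      then show ?thesis by (simp add: add_pos_nonneg)
    qed
    also have "\<dots> \<le> C / e ^ (a + 4) * cauchy_kernel2 1 p"
      using C e by (intro mult_left_mono cauchy_kernel2_ge) auto
    finally show ?thesis .
  qed
  then show ?thesis using C e by (intro that[of "C / e ^ (a + 4)"]) auto
qed

lemma continuous_schwartz_osc:
  assumes "t > 0" "schwartz h"
  shows "continuous_on UNIV (\<lambda>p. h (\<epsilon> *\<^sub>R p) * osc_symbol t x y a b p)"
  by (intro continuous_on_mult continuous_osc_symbol assms continuous_on_compose2[OF schwartz_continuous[OF assms(2)]] continuous_intros) auto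

lemma integrable_schwartz_osc:
  assumes t: "t > 0" and h: "schwartz h" and \<epsilon>: "\<epsilon> > 0"
  shows "integrable lborel (\<lambda>p. h (\<epsilon> *\<^sub>R p) * osc_symbol t x y a b p)"
proof -
  obtain C where C: "C > 0" "\<And>p. norm (h (\<epsilon> *\<^sub>R p) * osc_symbol t x y a b p) \<le> C * cauchy_kernel2 1 p"
    using schwartz_osc_bound[OF assms] by metis
  have "integrable lborel (\<lambda>p. C * cauchy_kernel2 1 p)"
    by (intro integrable_mult_right integrable_cauchy_kernel2) simp
  then show ?thesis
    by (rule Bochner_Integration.integrable_bound)
      (use C continuous_schwartz_osc[OF t h] in \<open>auto simp: borel_measurable_continuous_onI abs_mult\<close>)
qed

definition osc_int :: "real \<Rightarrow> real \<Rightarrow> real \<Rightarrow> nat \<Rightarrow> nat \<Rightarrow> (real \<times> real \<Rightarrow> complex) \<Rightarrow> real \<Rightarrow> complex" where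
  "osc_int t x y a b h \<epsilon> = (LINT p|lborel. h (\<epsilon> *\<^sub>R p) * osc_symbol t x y a b p)"

text \<open>The \<xi>-derivative of the cutoff times the symbol (a, b + 1) has integral 0, and the
  resulting relation is solved for the symbol (a, b). Differentiating h(\<epsilon> p) brings out a
  factor \<epsilon>, which is what removes the derivative of the cutoff from the limit.\<close>

lemma osc_int_by_parts:
  assumes t: "t > 0" and h: "schwartz h" and \<epsilon>: "\<epsilon> > 0" and h': "schwartz h'"
    and dh: "\<And>u v. ((\<lambda>u. h (u, v)) has_vector_derivative h' (u, v)) (at u)"
  shows "osc_int t x y a b h \<epsilon> =
    \<i> * (of_real \<epsilon> * osc_int t x y a (b + 1) h' \<epsilon> + of_nat a * osc_int t x y (a - 1) (b + 1) h \<epsilon>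
         - 6 * of_real t * of_nat (b + 1) * osc_int t x y (a + 1) (b + 2) h \<epsilon>)
    + of_real (\<bar>x\<bar> + 1 - x) * osc_int t x y a (b + 1) h \<epsilon>"
proof -
  define S where "S a b p = osc_symbol t x y a b p" for a b p
  define F where "F p = h (\<epsilon> *\<^sub>R p) * S a (b + 1) p" for p
  define f where "f p = of_real \<epsilon> * (h' (\<epsilon> *\<^sub>R p) * S a (b + 1) p)
     + (of_nat a * (h (\<epsilon> *\<^sub>R p) * S (a - 1) (b + 1) p)
      - 6 * of_real t * of_nat (b + 1) * (h (\<epsilon> *\<^sub>R p) * S (a + 1) (b + 2) p)
      + \<i> * (h (\<epsilon> *\<^sub>R p) * S a b p)
      - \<i> * of_real (\<bar>x\<bar> + 1 - x) * (h (\<epsilon> *\<^sub>R p) * S a (b + 1) p))" for p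
  note bnd = schwartz_osc_bound[OF t _ \<epsilon>, where x = x and y = y, folded S_def]
  obtain C1 where C1: "C1 > 0" "\<And>p. norm (h' (\<epsilon> *\<^sub>R p) * S a (b + 1) p) \<le> C1 * cauchy_kernel2 1 p"
    using bnd[OF h'] by metis
  obtain C2 where C2: "C2 > 0" "\<And>p. norm (h (\<epsilon> *\<^sub>R p) * S (a - 1) (b + 1) p) \<le> C2 * cauchy_kernel2 1 p"
    using bnd[OF h] by metis
  obtain C3 where C3: "C3 > 0" "\<And>p. norm (h (\<epsilon> *\<^sub>R p) * S (a + 1) (b + 2) p) \<le> C3 * cauchy_kernel2 1 p"
    using bnd[OF h] by metis
  obtain C4 where C4: "C4 > 0" "\<And>p. norm (h (\<epsilon> *\<^sub>R p) * S a b p) \<le> C4 * cauchy_kernel2 1 p"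
    using bnd[OF h] by metis
  obtain C5 where C5: "C5 > 0" "\<And>p. norm (h (\<epsilon> *\<^sub>R p) * S a (b + 1) p) \<le> C5 * cauchy_kernel2 1 p"
    using bnd[OF h] by metis
  define m where "m = norm (\<i> * complex_of_real (\<bar>x\<bar> + 1 - x))"
  define n where "n = norm (6 * complex_of_real t * of_nat (b + 1))"
  define C where "C = \<epsilon> * C1 + (real a * C2 + n * C3 + C4 + m * C5) + C5"
  have nn: "m \<ge> 0" "n \<ge> 0" by (simp_all add: m_def n_def)
  have alg: "H * (A1 * s1 - A2 * s2 + A3 * s3 - A4 * s4) + e * H' * s4
      = e * (H' * s4) + (A1 * (H * s1) - A2 * (H * s2) + A3 * (H * s3) - A4 * (H * s4))"
    for H H' e A1 A2 A3 A4 s1 s2 s3 s4 :: complex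
    by (simp add: algebra_simps)
  have "(LINT p|lborel. f p) = 0"
  proof (rule integral_partial_deriv_eq_0[where F = F])
    fix u v :: real
    have "((\<lambda>u. \<epsilon> * u) has_real_derivative \<epsilon>) (at u)" by (auto intro!: derivative_eq_intros)
    from vector_diff_chain_at[OF this[unfolded has_real_derivative_iff_has_vector_derivative] dh[of "\<epsilon> * v" "\<epsilon> * u"]]
    have "((\<lambda>u. h (\<epsilon> *\<^sub>R (u, v))) has_vector_derivative \<epsilon> *\<^sub>R h' (\<epsilon> *\<^sub>R (u, v))) (at u)"
      by (simp add: o_def)
    from has_vector_derivative_mult[OF this osc_symbol_partial_deriv[OF t, of x y a b v u]]
    show "((\<lambda>u. F (u, v)) has_vector_derivative f (u, v)) (at u)"
      unfolding F_def f_def S_def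
      by (rule has_vector_derivative_eq_rhs) (simp only: scaleR_conv_of_real, rule alg)
  next
    show "continuous_on UNIV f"
      unfolding f_def S_def
      by (intro continuous_on_add continuous_on_diff continuous_on_mult_left continuous_schwartz_osc t h h')
    fix p
    let ?q = "cauchy_kernel2 1 p"
    have "norm (F p) \<le> C5 * ?q" unfolding F_def by (rule C5)
    also have "\<dots> \<le> C * ?q"
      unfolding C_def using C1 C2 C3 C4 C5 nn \<epsilon> by (intro mult_right_mono) auto
    finally show "norm (F p) \<le> C * ?q" .
    have "norm (f p) \<le> \<epsilon> * (C1 * ?q) + (real a * (C2 * ?q) + n * (C3 * ?q) + C4 * ?q + m * (C5 * ?q))"
      unfolding f_def
    proof (intro order_trans[OF norm_triangle_ineq] order_trans[OF norm_triangle_ineq4] add_mono)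
      show "norm (of_real \<epsilon> * (h' (\<epsilon> *\<^sub>R p) * S a (b + 1) p)) \<le> \<epsilon> * (C1 * ?q)"
        using C1(2)[of p] \<epsilon> by (subst norm_mult) (simp add: mult_left_mono)
      show "norm (of_nat a * (h (\<epsilon> *\<^sub>R p) * S (a - 1) (b + 1) p)) \<le> real a * (C2 * ?q)"
        using C2(2)[of p] by (subst norm_mult) (simp add: mult_left_mono)
      show "norm (6 * of_real t * of_nat (b + 1) * (h (\<epsilon> *\<^sub>R p) * S (a + 1) (b + 2) p)) \<le> n * (C3 * ?q)"
        unfolding n_def using C3(2)[of p] by (subst norm_mult) (intro mult_left_mono, auto)
      show "norm (\<i> * (h (\<epsilon> *\<^sub>R p) * S a b p)) \<le> C4 * ?q"
        using C4(2)[of p] by (subst norm_mult) simp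
      show "norm (\<i> * of_real (\<bar>x\<bar> + 1 - x) * (h (\<epsilon> *\<^sub>R p) * S a (b + 1) p)) \<le> m * (C5 * ?q)"
        unfolding m_def using C5(2)[of p] by (subst norm_mult) (intro mult_left_mono, auto)
    qed
    also have "\<dots> = (\<epsilon> * C1 + (real a * C2 + n * C3 + C4 + m * C5)) * ?q" by (simp add: algebra_simps)
    also have "\<dots> \<le> C * ?q" unfolding C_def using C5 by (intro mult_right_mono) auto
    finally show "norm (f p) \<le> C * ?q" .
  qed
  moreover have "(LINT p|lborel. f p) = of_real \<epsilon> * osc_int t x y a (b + 1) h' \<epsilon>
     + (of_nat a * osc_int t x y (a - 1) (b + 1) h \<epsilon>
      - 6 * of_real t * of_nat (b + 1) * osc_int t x y (a + 1) (b + 2) h \<epsilon>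
      + \<i> * osc_int t x y a b h \<epsilon>
      - \<i> * of_real (\<bar>x\<bar> + 1 - x) * osc_int t x y a (b + 1) h \<epsilon>)"
  proof -
    note ih = integrable_schwartz_osc[OF t h \<epsilon>, where x = x and y = y, folded S_def]
    note ih' = integrable_schwartz_osc[OF t h' \<epsilon>, where x = x and y = y, folded S_def]
    show ?thesis unfolding f_def osc_int_def S_def[symmetric]
      by (simp only: Bochner_Integration.integral_add Bochner_Integration.integral_diff ih ih' integrable_mult_right
           Bochner_Integration.integrable_add Bochner_Integration.integrable_diff integral_mult_right_zero)
  qed
  ultimately have zero: "\<i> * (of_real \<epsilon> * osc_int t x y a (b + 1) h' \<epsilon>
     + (of_nat a * osc_int t x y (a - 1) (b + 1) h \<epsilon>
      - 6 * of_real t * of_nat (b + 1) * osc_int t x y (a + 1) (b + 2) h \<epsilon>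
      + \<i> * osc_int t x y a b h \<epsilon>
      - \<i> * of_real (\<bar>x\<bar> + 1 - x) * osc_int t x y a (b + 1) h \<epsilon>)) = 0" by simp
  have "P = \<i> * (e + A - B) + c * Q" if "\<i> * (e + (A - B + \<i> * P - \<i> * c * Q)) = 0" for P e A B c Q :: complex
    using that by (simp add: algebra_simps)
  from this[OF zero] show ?thesis .
qed

text \<open>Writing S = 1 + \<xi>^2 + \<eta>^2, \<open>ell\<close> is at least min(t, 1) S. An order
  a - 2b of at most -4 lets S^(b - 2) absorb \<xi>^a, and the remaining S^2 dominates (1 +
  \<xi>^2)(1 + \<eta>^2).\<close>

lemma osc_symbol_le_cauchy_kernel2:
  assumes t: "t > 0" and ab: "a + 4 \<le> 2 * b"
  shows "norm (osc_symbol t x y a b p) \<le> 1 / min t 1 ^ b * cauchy_kernel2 1 p"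
proof -
  define m where "m = min t 1"
  have m: "m > 0" "m \<le> 1" "m \<le> t" using t by (auto simp: m_def)
  define u v where "u = fst p" "v = snd p"
  define S where "S = 1 + u\<^sup>2 + v\<^sup>2"
  have S: "S \<ge> 1" "S \<ge> 1 + u\<^sup>2" "S > 0" by (auto simp: S_def add_pos_nonneg)
  define d where "d = b - 2"
  have b: "b = d + 2" using ab by (simp add: d_def)
  have "m * S \<le> ell t x p"
  proof -
    have "m * (u\<^sup>2) \<le> t * (3 * u\<^sup>2)" using m t by (intro mult_mono) auto
    moreover have "m * v\<^sup>2 \<le> t * v\<^sup>2" using m by (intro mult_right_mono) auto
    ultimately show ?thesis unfolding ell_def S_def u_v_def[symmetric] using m
      by (simp add: algebra_simps)
  qed
  then have e: "(m * S) ^ b \<le> ell t x p ^ b" using m S by (intro power_mono) auto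
  have "\<bar>u\<bar> ^ a \<le> S ^ d"
  proof (cases "\<bar>u\<bar> \<le> 1")
    case True
    then have "\<bar>u\<bar> ^ a \<le> 1" by (intro power_le_one) auto
    also have "1 \<le> S ^ d" using S by (intro one_le_power)
    finally show ?thesis .
  next
    case False
    then have "\<bar>u\<bar> ^ a \<le> \<bar>u\<bar> ^ (2 * d)" using ab b by (intro power_increasing) auto
    also have "\<dots> = (u\<^sup>2) ^ d" by (simp add: power_mult)
    also have "\<dots> \<le> S ^ d" using S by (intro power_mono) auto
    finally show ?thesis .
  qed
  then have "norm (osc_symbol t x y a b p) \<le> S ^ d / (m * S) ^ b"
    unfolding norm_osc_symbol[OF t] u_v_def[symmetric] using e m S by (intro frac_le) auto
  also have "\<dots> = 1 / m ^ b * (1 / S\<^sup>2)"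
    using m S by (simp add: b power_add power_mult_distrib power2_eq_square)
  also have "\<dots> \<le> 1 / m ^ b * cauchy_kernel2 1 p"
  proof (intro mult_left_mono)
    have "(1 + u\<^sup>2) * (1 + v\<^sup>2) \<le> S * S"
      unfolding S_def by (intro mult_mono) auto
    then show "1 / S\<^sup>2 \<le> cauchy_kernel2 1 p"
      unfolding cauchy_kernel2_def u_v_def[symmetric] by (simp add: frac_le add_pos_nonneg power2_eq_square)
  qed (use m in auto)
  finally show ?thesis unfolding m_def .
qed

lemma osc_int_tendsto:
  assumes t: "t > 0"
  shows "\<exists>W. \<forall>h. schwartz h \<longrightarrow> ((\<lambda>\<epsilon>. osc_int t x y a b h \<epsilon>) \<longlongrightarrow> h 0 * W) (at_right 0)"
  \<comment> \<open>Each integration by parts lowers the order \<open>a - 2b\<close>; from order -4 on the integral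
    converges absolutely.\<close>
proof (induction "a + 4 - 2 * b" arbitrary: a b rule: less_induct)
  case less
  show ?case
  proof (cases "a + 4 \<le> 2 * b")
    case True
    have "((\<lambda>\<epsilon>. osc_int t x y a b h \<epsilon>) \<longlongrightarrow> h 0 * (LINT p|lborel. osc_symbol t x y a b p)) (at_right 0)"
      if h: "schwartz h" for h
      unfolding tendsto_at_iff_sequentially
    proof (intro allI impI)
      fix X :: "nat \<Rightarrow> real" assume X: "\<forall>i. X i \<in> {0<..} - {0}" "X \<longlonglongrightarrow> 0"
      obtain C where C: "C > 0" "\<And>p. norm (h p) \<le> C / (1 + norm p) ^ 0"
        using schwartz_decay[OF h] by metis
      have "(\<lambda>n. LINT p|lborel. h (X n *\<^sub>R p) * osc_symbol t x y a b p) \<longlonglongrightarrow> (LINT p|lborel. h 0 * osc_symbol t x y a b p)"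
      proof (rule integral_dominated_convergence[where w = "\<lambda>p. C * (1 / min t 1 ^ b * cauchy_kernel2 1 p)"])
        show "(\<lambda>p. h 0 * osc_symbol t x y a b p) \<in> borel_measurable lborel"
          by (simp add: borel_measurable_continuous_onI continuous_on_mult_left continuous_osc_symbol t)
        show "(\<lambda>p. h (X n *\<^sub>R p) * osc_symbol t x y a b p) \<in> borel_measurable lborel" for n
          using continuous_schwartz_osc[OF t h] by (simp add: borel_measurable_continuous_onI)
        show "integrable lborel (\<lambda>p. C * (1 / min t 1 ^ b * cauchy_kernel2 1 p))"
          by (intro integrable_mult_right integrable_cauchy_kernel2) simp
        show "AE p in lborel. (\<lambda>n. h (X n *\<^sub>R p) * osc_symbol t x y a b p) \<longlonglongrightarrow> h 0 * osc_symbol t x y a b p"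
        proof (rule AE_I2)
          fix p :: "real \<times> real"
          have "isCont h 0" using schwartz_continuous[OF h] continuous_on_eq_continuous_at[OF open_UNIV] by blast
          moreover have "(\<lambda>n. X n *\<^sub>R p) \<longlonglongrightarrow> 0 *\<^sub>R p" by (intro tendsto_intros X)
          ultimately have "(\<lambda>n. h (X n *\<^sub>R p)) \<longlonglongrightarrow> h 0"
            by (intro isCont_tendsto_compose[of 0 h]) auto
          then show "(\<lambda>n. h (X n *\<^sub>R p) * osc_symbol t x y a b p) \<longlonglongrightarrow> h 0 * osc_symbol t x y a b p"
            by (intro tendsto_intros)
        qed
        show "AE p in lborel. norm (h (X n *\<^sub>R p) * osc_symbol t x y a b p) \<le> C * (1 / min t 1 ^ b * cauchy_kernel2 1 p)" for n
          unfolding norm_mult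
          by (intro AE_I2 mult_mono osc_symbol_le_cauchy_kernel2 t True) (use C in auto)
      qed
      then show "((\<lambda>\<epsilon>. osc_int t x y a b h \<epsilon>) \<circ> X) \<longlonglongrightarrow> h 0 * (LINT p|lborel. osc_symbol t x y a b p)"
        by (simp add: osc_int_def o_def)
    qed
    then show ?thesis by blast
  next
    case False
    obtain W1 where W1: "\<And>h. schwartz h \<Longrightarrow> ((\<lambda>\<epsilon>. osc_int t x y a (b + 1) h \<epsilon>) \<longlongrightarrow> h 0 * W1) (at_right 0)"
    proof -
      have "\<exists>W. \<forall>h. schwartz h \<longrightarrow> ((\<lambda>\<epsilon>. osc_int t x y (a) (b + 1) h \<epsilon>) \<longlongrightarrow> h 0 * W) (at_right 0)"
        by (rule less.hyps) (use False in arith)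
      then show thesis using that by blast
    qed
    obtain W2 where W2: "\<And>h. schwartz h \<Longrightarrow> ((\<lambda>\<epsilon>. osc_int t x y (a - 1) (b + 1) h \<epsilon>) \<longlongrightarrow> h 0 * W2) (at_right 0)"
    proof -
      have "\<exists>W. \<forall>h. schwartz h \<longrightarrow> ((\<lambda>\<epsilon>. osc_int t x y (a - 1) (b + 1) h \<epsilon>) \<longlongrightarrow> h 0 * W) (at_right 0)"
        by (rule less.hyps) (use False in arith)
      then show thesis using that by blast
    qed
    obtain W3 where W3: "\<And>h. schwartz h \<Longrightarrow> ((\<lambda>\<epsilon>. osc_int t x y (a + 1) (b + 2) h \<epsilon>) \<longlongrightarrow> h 0 * W3) (at_right 0)"
    proof -
      have "\<exists>W. \<forall>h. schwartz h \<longrightarrow> ((\<lambda>\<epsilon>. osc_int t x y (a + 1) (b + 2) h \<epsilon>) \<longlongrightarrow> h 0 * W) (at_right 0)"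
        by (rule less.hyps) (use False in arith)
      then show thesis using that by blast
    qed
    \<comment> \<open>\<open>W\<close> is fixed before the cutoff, so the limit sees
      \<open>h\<close> through \<open>h 0\<close> alone. The term with h' carries the factor
      \<epsilon> and leaves no trace in \<open>W\<close>, but its limit must exist as well; as h'
      may take any value at 0, the induction has to cover all Schwartz functions and not only those
      with value 1 there.\<close>
    define W where "W = \<i> * (of_nat a * W2 - 6 * of_real t * of_nat (b + 1) * W3) + of_real (\<bar>x\<bar> + 1 - x) * W1"
    have "((\<lambda>\<epsilon>. osc_int t x y a b h \<epsilon>) \<longlongrightarrow> h 0 * W) (at_right 0)" if h: "schwartz h" for h
    proof -
      obtain h' where h': "schwartz h'" "\<And>u v. ((\<lambda>u. h (u, v)) has_vector_derivative h' (u, v)) (at u)"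
        using schwartz_partial_deriv[OF h] by metis
      have e: "((\<lambda>\<epsilon>. complex_of_real \<epsilon>) \<longlongrightarrow> of_real 0) (at_right 0)" by (intro tendsto_intros)
      have "((\<lambda>\<epsilon>. \<i> * (of_real \<epsilon> * osc_int t x y a (b + 1) h' \<epsilon> + of_nat a * osc_int t x y (a - 1) (b + 1) h \<epsilon>
         - 6 * of_real t * of_nat (b + 1) * osc_int t x y (a + 1) (b + 2) h \<epsilon>)
         + of_real (\<bar>x\<bar> + 1 - x) * osc_int t x y a (b + 1) h \<epsilon>) \<longlongrightarrow>
         \<i> * (of_real 0 * (h' 0 * W1) + of_nat a * (h 0 * W2) - 6 * of_real t * of_nat (b + 1) * (h 0 * W3))
          + of_real (\<bar>x\<bar> + 1 - x) * (h 0 * W1)) (at_right 0)"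
        by (intro tendsto_add tendsto_diff tendsto_mult tendsto_const e W1 W2 W3 h h')
      moreover have lim: "\<i> * (of_real 0 * (h' 0 * W1) + of_nat a * (h 0 * W2) - 6 * of_real t * of_nat (b + 1) * (h 0 * W3))
          + of_real (\<bar>x\<bar> + 1 - x) * (h 0 * W1) = h 0 * W"
        unfolding W_def by (simp add: algebra_simps)
      moreover have ev: "\<forall>\<^sub>F \<epsilon> in at_right 0. \<i> * (of_real \<epsilon> * osc_int t x y a (b + 1) h' \<epsilon> + of_nat a * osc_int t x y (a - 1) (b + 1) h \<epsilon>
         - 6 * of_real t * of_nat (b + 1) * osc_int t x y (a + 1) (b + 2) h \<epsilon>)
         + of_real (\<bar>x\<bar> + 1 - x) * osc_int t x y a (b + 1) h \<epsilon> = osc_int t x y a b h \<epsilon>"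
        using eventually_at_right_less[of 0]
        by eventually_elim (rule osc_int_by_parts[OF t h _ h', symmetric])
      ultimately show ?thesis using tendsto_cong[OF ev] unfolding lim by blast
    qed
    then show ?thesis by blast
  qed
qed

text \<open>This turns the definite description behind \<open>A_x\<close> into a limit along any
  single cutoff of one's choice.\<close>

lemma osc_int_tendsto_A_x:
  assumes t: "t > 0" and h: "schwartz h" "h 0 = 1"
  shows "((\<lambda>\<epsilon>. \<i> * osc_int t x y 1 0 h \<epsilon>) \<longlongrightarrow> A_x x y t) (at_right 0)"
proof -
  define f where "f = (\<lambda>(\<xi>, \<eta>). \<i> * complex_of_real \<xi> * exp (\<i> * of_real (t * \<xi> ^ 3 + t * \<xi> * \<eta>\<^sup>2 + x * \<xi> + y * \<eta>)))"
  have f: "f p = \<i> * osc_symbol t x y 1 0 p" for p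
    by (cases p) (simp add: f_def osc_symbol_def phase_def)
  have int: "(LINT p|lborel. \<kappa> (\<epsilon> *\<^sub>R p) * f p) = \<i> * osc_int t x y 1 0 \<kappa> \<epsilon>" for \<kappa> \<epsilon>
    unfolding f osc_int_def integral_mult_right_zero[symmetric] by (simp only: mult_ac)
  obtain W where W: "\<And>h. schwartz h \<Longrightarrow> ((\<lambda>\<epsilon>. osc_int t x y 1 0 h \<epsilon>) \<longlongrightarrow> h 0 * W) (at_right 0)"
    using osc_int_tendsto[OF t] by blast
  have lim: "((\<lambda>\<epsilon>. \<i> * osc_int t x y 1 0 \<kappa> \<epsilon>) \<longlongrightarrow> \<i> * W) (at_right 0)" if "schwartz \<kappa>" "\<kappa> 0 = 1" for \<kappa>
    using tendsto_mult[OF tendsto_const W[OF that(1)], of \<i>] that(2) by simp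
  have osc: "has_oscillatory_integral f (\<i> * W)"
    unfolding has_oscillatory_integral_def int using lim by blast
  have "oscillatory_integral f = \<i> * W"
    unfolding oscillatory_integral_def
  proof (rule the_equality, rule osc)
    \<comment> \<open>Uniqueness of the described value requires that some admissible cutoff exists;
      \<open>h\<close> itself serves.\<close>
    fix L assume "has_oscillatory_integral f L"
    then have "((\<lambda>\<epsilon>. \<i> * osc_int t x y 1 0 h \<epsilon>) \<longlongrightarrow> L) (at_right 0)"
      unfolding has_oscillatory_integral_def int using h by blast
    then show "L = \<i> * W" using lim[OF h] tendsto_unique trivial_limit_at_right_real by blast
  qed
  then have "A_x x y t = \<i> * W" unfolding A_x_def f_def .
  then show ?thesis using lim[OF h] by simp
qed

section \<open>Factorisation into Airy integrals\<close>

text \<open>Up to sign and scaling these are the Hermite polynomials: the j-th derivative of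
  exp(-\<alpha> x^2) is the j-th polynomial times exp(-\<alpha> x^2). The literal
  \<open>[:0, - 2 * \<alpha>:]\<close> is the monomial -2 \<alpha> x.\<close>

fun gauss_poly :: "real \<Rightarrow> nat \<Rightarrow> real poly" where
  "gauss_poly \<alpha> 0 = 1"
| "gauss_poly \<alpha> (Suc j) = pderiv (gauss_poly \<alpha> j) + [:0, - 2 * \<alpha>:] * gauss_poly \<alpha> j"

definition gauss_deriv :: "real \<Rightarrow> nat \<Rightarrow> real \<Rightarrow> real" where
  "gauss_deriv \<alpha> j x = poly (gauss_poly \<alpha> j) x * exp (- \<alpha> * x\<^sup>2)"

lemma DERIV_gauss_deriv: "(gauss_deriv \<alpha> j has_real_derivative gauss_deriv \<alpha> (Suc j) x) (at x)"
proof -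
  have "((\<lambda>x. poly (gauss_poly \<alpha> j) x * exp (- \<alpha> * x\<^sup>2)) has_real_derivative
     poly (pderiv (gauss_poly \<alpha> j)) x * exp (- \<alpha> * x\<^sup>2) + (exp (- \<alpha> * x\<^sup>2) * (- \<alpha> * (2 * x))) * poly (gauss_poly \<alpha> j) x) (at x)"
    by (rule DERIV_mult[OF poly_DERIV]) (auto intro!: derivative_eq_intros)
  then show ?thesis
    unfolding gauss_deriv_def[abs_def] by (simp add: algebra_simps)
qed

lemma poly_bound_power:
  fixes P :: "real poly"
  shows "\<exists>K n. \<forall>x. \<bar>poly P x\<bar> \<le> K * (1 + \<bar>x\<bar>) ^ n"
proof (induction P)
  case 0
  then show ?case by (intro exI[of _ 0]) simp
next
  case (pCons a P)
  then obtain K n where K: "\<And>x. \<bar>poly P x\<bar> \<le> K * (1 + \<bar>x\<bar>) ^ n" by blast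
  have "\<bar>poly (pCons a P) x\<bar> \<le> (\<bar>a\<bar> + K) * (1 + \<bar>x\<bar>) ^ Suc n" for x
  proof -
    have "\<bar>poly (pCons a P) x\<bar> \<le> \<bar>a\<bar> + \<bar>x\<bar> * \<bar>poly P x\<bar>"
      by (simp add: abs_mult[symmetric] abs_triangle_ineq)
    also have "\<dots> \<le> \<bar>a\<bar> * (1 + \<bar>x\<bar>) ^ Suc n + (1 + \<bar>x\<bar>) * (K * (1 + \<bar>x\<bar>) ^ n)"
    proof (intro add_mono mult_mono K)
      have "1 \<le> (1 + \<bar>x\<bar>) ^ Suc n" by (intro one_le_power) simp
      then show "\<bar>a\<bar> \<le> \<bar>a\<bar> * (1 + \<bar>x\<bar>) ^ Suc n" using mult_left_mono[of 1 "(1 + \<bar>x\<bar>) ^ Suc n" "\<bar>a\<bar>"] by simp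
    qed auto
    also have "\<dots> = (\<bar>a\<bar> + K) * (1 + \<bar>x\<bar>) ^ Suc n" by (simp add: algebra_simps)
    finally show ?thesis .
  qed
  then show ?case by blast
qed

lemma gauss_deriv_bounded:
  assumes \<alpha>: "\<alpha> > 0"
  shows "\<exists>C>0. \<forall>x. (1 + \<bar>x\<bar>) ^ N * \<bar>gauss_deriv \<alpha> j x\<bar> \<le> C"
proof -
  obtain K n where K: "\<And>x. \<bar>poly (gauss_poly \<alpha> j) x\<bar> \<le> K * (1 + \<bar>x\<bar>) ^ n"
    using poly_bound_power by blast
  have K0: "K \<ge> 0" using K[of 0] by simp
  obtain C where C: "C > 0" "\<And>x. x \<ge> 0 \<Longrightarrow> x ^ (N + n) * exp (- (2 * \<alpha> * x)) \<le> C"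
    using power_times_exp_bounded[of "2 * \<alpha>" "N + n"] \<alpha> by auto
  have "(1 + \<bar>x\<bar>) ^ N * \<bar>gauss_deriv \<alpha> j x\<bar> \<le> K * exp (3 * \<alpha>) * C + 1" for x
  proof -
    let ?X = "1 + \<bar>x\<bar>"
    \<comment> \<open>Replaces the Gaussian by an exponential in 1 + |x|, against which powers are
      already bounded; the price is the constant exp(3 \<alpha>).\<close>
    have "0 \<le> (\<bar>x\<bar> - 1)\<^sup>2" by simp
    then have "2 * \<bar>x\<bar> - 1 \<le> x\<^sup>2" by (simp add: power2_eq_square algebra_simps)
    then have "\<alpha> * (2 * \<bar>x\<bar> - 1) \<le> \<alpha> * x\<^sup>2" using \<alpha> by (intro mult_left_mono) auto
    then have "- \<alpha> * x\<^sup>2 \<le> 3 * \<alpha> + - (2 * \<alpha> * ?X)" by (simp add: algebra_simps)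
    then have e: "exp (- \<alpha> * x\<^sup>2) \<le> exp (3 * \<alpha>) * exp (- (2 * \<alpha> * ?X))"
      unfolding exp_add[symmetric] by simp
    have "?X ^ N * \<bar>gauss_deriv \<alpha> j x\<bar> = ?X ^ N * (\<bar>poly (gauss_poly \<alpha> j) x\<bar> * exp (- \<alpha> * x\<^sup>2))"
      by (simp add: gauss_deriv_def abs_mult)
    also have "\<dots> \<le> ?X ^ N * ((K * ?X ^ n) * (exp (3 * \<alpha>) * exp (- (2 * \<alpha> * ?X))))"
      using K[of x] e K0 by (intro mult_left_mono mult_mono) auto
    also have "\<dots> = K * exp (3 * \<alpha>) * (?X ^ (N + n) * exp (- (2 * \<alpha> * ?X)))"
      by (simp add: power_add)
    also have "\<dots> \<le> K * exp (3 * \<alpha>) * C"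
      using C(2)[of ?X] K0 by (intro mult_left_mono) auto
    finally show ?thesis by simp
  qed
  moreover have "K * exp (3 * \<alpha>) * C + 1 > 0" using K0 C by (intro add_nonneg_pos) auto
  ultimately show ?thesis by blast
qed

definition gaussian :: "real \<Rightarrow> real \<Rightarrow> real \<times> real \<Rightarrow> complex" where
  "gaussian \<alpha> \<beta> p = of_real (exp (- \<alpha> * (fst p)\<^sup>2) * exp (- \<beta> * (snd p)\<^sup>2))"

lemma gaussian_0 [simp]: "gaussian \<alpha> \<beta> 0 = 1"
  by (simp add: gaussian_def)

lemma schwartz_gaussian:
  assumes \<alpha>: "\<alpha> > 0" and \<beta>: "\<beta> > 0"
  shows "schwartz (gaussian \<alpha> \<beta>)"
proof -
  define D where "D j k p = complex_of_real (gauss_deriv \<alpha> j (fst p) * gauss_deriv \<beta> k (snd p))" for j k p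
  have "D 0 0 = gaussian \<alpha> \<beta>"
    by (rule ext) (simp add: D_def gaussian_def gauss_deriv_def)
  moreover have "(D j k has_derivative
        (\<lambda>h. of_real (fst h) * D (Suc j) k p + of_real (snd h) * D j (Suc k) p)) (at p)" for j k p
  proof -
    have "((\<lambda>p. gauss_deriv \<alpha> j (fst p)) has_derivative (\<lambda>h. fst h * gauss_deriv \<alpha> (Suc j) (fst p))) (at p)"
      by (rule DERIV_compose_FDERIV[OF DERIV_gauss_deriv]) (auto intro!: derivative_eq_intros)
    moreover have "((\<lambda>p. gauss_deriv \<beta> k (snd p)) has_derivative (\<lambda>h. snd h * gauss_deriv \<beta> (Suc k) (snd p))) (at p)"
      by (rule DERIV_compose_FDERIV[OF DERIV_gauss_deriv]) (auto intro!: derivative_eq_intros)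
    ultimately have "((\<lambda>p. gauss_deriv \<alpha> j (fst p) * gauss_deriv \<beta> k (snd p)) has_derivative
       (\<lambda>h. gauss_deriv \<alpha> j (fst p) * (snd h * gauss_deriv \<beta> (Suc k) (snd p)) + (fst h * gauss_deriv \<alpha> (Suc j) (fst p)) * gauss_deriv \<beta> k (snd p))) (at p)"
      by (rule has_derivative_mult)
    from bounded_linear.has_derivative[OF bounded_linear_of_real this] show ?thesis
      unfolding D_def[abs_def]
      by (rule has_derivative_eq_rhs) (auto simp: fun_eq_iff algebra_simps)
  qed
  moreover have "bounded (range (\<lambda>p. of_real ((1 + norm p) ^ N) * D j k p))" for j k N
  proof -
    obtain C1 where C1: "C1 > 0" "\<And>x. (1 + \<bar>x\<bar>) ^ N * \<bar>gauss_deriv \<alpha> j x\<bar> \<le> C1"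
      using gauss_deriv_bounded[OF \<alpha>] by blast
    obtain C2 where C2: "C2 > 0" "\<And>x. (1 + \<bar>x\<bar>) ^ N * \<bar>gauss_deriv \<beta> k x\<bar> \<le> C2"
      using gauss_deriv_bounded[OF \<beta>] by blast
    have "norm (of_real ((1 + norm p) ^ N) * D j k p) \<le> C1 * C2" for p
    proof -
      obtain u v where p: "p = (u, v)" by (cases p)
      have "norm p \<le> \<bar>u\<bar> + \<bar>v\<bar>" unfolding p norm_Pair using sqrt_sum_squares_le_sum_abs[of u v] by simp
      moreover have "0 \<le> \<bar>u\<bar> * \<bar>v\<bar>" by simp
      moreover have "(1 + \<bar>u\<bar>) * (1 + \<bar>v\<bar>) = 1 + \<bar>u\<bar> + \<bar>v\<bar> + \<bar>u\<bar> * \<bar>v\<bar>" by (simp add: algebra_simps)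
      ultimately have "1 + norm p \<le> (1 + \<bar>u\<bar>) * (1 + \<bar>v\<bar>)" by linarith
      then have "(1 + norm p) ^ N \<le> ((1 + \<bar>u\<bar>) * (1 + \<bar>v\<bar>)) ^ N" by (intro power_mono) auto
      then have "(1 + norm p) ^ N * (\<bar>gauss_deriv \<alpha> j u\<bar> * \<bar>gauss_deriv \<beta> k v\<bar>) \<le>
         ((1 + \<bar>u\<bar>) * (1 + \<bar>v\<bar>)) ^ N * (\<bar>gauss_deriv \<alpha> j u\<bar> * \<bar>gauss_deriv \<beta> k v\<bar>)" by (intro mult_right_mono) auto
      also have "\<dots> = ((1 + \<bar>u\<bar>) ^ N * \<bar>gauss_deriv \<alpha> j u\<bar>) * ((1 + \<bar>v\<bar>) ^ N * \<bar>gauss_deriv \<beta> k v\<bar>)"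
        by (simp only: power_mult_distrib mult_ac)
      also have "\<dots> \<le> C1 * C2" using C1 C2 by (intro mult_mono) auto
      finally show ?thesis
        by (simp add: p D_def norm_mult norm_power abs_mult del: of_real_power)
    qed
    then show ?thesis unfolding bounded_iff by blast
  qed
  ultimately show ?thesis unfolding schwartz_def by blast
qed

section \<open>Products of line integrals and the change to the variables of the
  factorisation\<close>

lemma integral_product_real:
  fixes f g :: "real \<Rightarrow> complex"
  assumes f: "integrable lborel f" and g: "integrable lborel g"
  shows "integrable lborel (\<lambda>p::real \<times> real. f (fst p) * g (snd p))"
    and "(LINT p|lborel. f (fst p) * g (snd p)) = (LINT u|lborel. f u) * (LINT v|lborel. g v)"
proof -
  have m [measurable]: "f \<in> borel_measurable borel" "g \<in> borel_measurable borel"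
    using f g by auto
  have "integrable (lborel \<Otimes>\<^sub>M lborel) (\<lambda>p. f (fst p) * g (snd p))"
  proof (rule lborel_pair.Fubini_integrable)
    show "integrable lborel (\<lambda>x. LINT y|lborel. norm (f (fst (x, y)) * g (snd (x, y))))"
      using f by (auto simp: norm_mult)
    show "AE x in lborel. integrable lborel (\<lambda>y. f (fst (x, y)) * g (snd (x, y)))"
      using g by auto
  qed measurable
  then show i: "integrable lborel (\<lambda>p::real \<times> real. f (fst p) * g (snd p))"
    by (simp add: lborel_prod)
  have "(LINT u|lborel. LINT v|lborel. f u * g v) = (LINT p|lborel. f (fst p) * g (snd p))"
    using lborel_pair.integral_fst'[of "\<lambda>p. f (fst p) * g (snd p)"] i by (simp add: lborel_prod)
  then show "(LINT p|lborel. f (fst p) * g (snd p)) = (LINT u|lborel. f u) * (LINT v|lborel. g v)"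
    by simp
qed

text \<open>Two affine substitutions on lines with Fubini between them: the first variable is
  rescaled by r at fixed v, then v is replaced by u - 2 c v at fixed u. The factors r and 2c
  multiply to the Jacobian.\<close>

lemma nn_integral_linear_change:
  fixes f :: "real \<times> real \<Rightarrow> ennreal" and r c :: real
  assumes r: "r > 0" and c: "c > 0" and f [measurable]: "f \<in> borel_measurable borel"
  shows "(\<integral>\<^sup>+p. f p \<partial>lborel) = ennreal (2 * r * c) * (\<integral>\<^sup>+p. f (r * fst p + c * snd p, r * fst p - c * snd p) \<partial>lborel)"
proof -
  have f2 [measurable]: "f \<in> borel_measurable (borel \<Otimes>\<^sub>M borel)" by (simp add: borel_prod)
  have T: "(\<lambda>p. (r * fst p + c * snd p, r * fst p - c * snd p)) \<in> borel_measurable borel"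
    by (intro borel_measurable_continuous_onI continuous_intros)
  have fT [measurable]: "(\<lambda>p. f (r * fst p + c * snd p, r * fst p - c * snd p)) \<in> borel_measurable borel"
    by (rule measurable_compose[OF T f])
  have "(\<integral>\<^sup>+p. f (r * fst p + c * snd p, r * fst p - c * snd p) \<partial>lborel)
    = (\<integral>\<^sup>+v. \<integral>\<^sup>+u. f (r * u + c * v, r * u - c * v) \<partial>lborel \<partial>lborel)"
    by (subst lborel_prod[symmetric], subst lborel_pair.nn_integral_snd[symmetric]) (simp_all add: lborel_prod)
  also have "\<dots> = (\<integral>\<^sup>+v. ennreal (1 / r) * (\<integral>\<^sup>+u. f (u, u - 2 * c * v) \<partial>lborel) \<partial>lborel)"
  proof (intro nn_integral_cong)
    fix v :: real
    have "(\<integral>\<^sup>+u. f (u, u - 2 * c * v) \<partial>lborel) = \<bar>r\<bar> * (\<integral>\<^sup>+u. f (c * v + r * u, (c * v + r * u) - 2 * c * v) \<partial>lborel)"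
      by (rule nn_integral_real_affine) (use r in auto)
    moreover have "f (c * v + r * u, (c * v + r * u) - 2 * c * v) = f (r * u + c * v, r * u - c * v)" for u
      by (simp add: algebra_simps)
    ultimately have "(\<integral>\<^sup>+u. f (u, u - 2 * c * v) \<partial>lborel) = ennreal r * (\<integral>\<^sup>+u. f (r * u + c * v, r * u - c * v) \<partial>lborel)"
      using r by simp
    then have "ennreal (1 / r) * (\<integral>\<^sup>+u. f (u, u - 2 * c * v) \<partial>lborel) = (ennreal (1 / r) * ennreal r) * (\<integral>\<^sup>+u. f (r * u + c * v, r * u - c * v) \<partial>lborel)"
      by (simp only: mult.assoc)
    also have "ennreal (1 / r) * ennreal r = 1" using r by (simp add: ennreal_mult'[symmetric])
    finally show "(\<integral>\<^sup>+u. f (r * u + c * v, r * u - c * v) \<partial>lborel) = ennreal (1 / r) * (\<integral>\<^sup>+u. f (u, u - 2 * c * v) \<partial>lborel)"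
      by simp
  qed
  also have "\<dots> = ennreal (1 / r) * (\<integral>\<^sup>+v. \<integral>\<^sup>+u. f (u, u - 2 * c * v) \<partial>lborel \<partial>lborel)"
    by (rule nn_integral_cmult) measurable
  also have "(\<integral>\<^sup>+v. \<integral>\<^sup>+u. f (u, u - 2 * c * v) \<partial>lborel \<partial>lborel) = (\<integral>\<^sup>+u. \<integral>\<^sup>+v. f (u, u - 2 * c * v) \<partial>lborel \<partial>lborel)"
    by (rule lborel_pair.Fubini') measurable
  also have "\<dots> = (\<integral>\<^sup>+u. ennreal (1 / (2 * c)) * (\<integral>\<^sup>+v. f (u, v) \<partial>lborel) \<partial>lborel)"
  proof (intro nn_integral_cong)
    fix u :: real
    have "(\<integral>\<^sup>+v. f (u, v) \<partial>lborel) = \<bar>- 2 * c\<bar> * (\<integral>\<^sup>+v. f (u, u + (- 2 * c) * v) \<partial>lborel)"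
      by (rule nn_integral_real_affine) (use c in auto)
    then have "(\<integral>\<^sup>+v. f (u, v) \<partial>lborel) = ennreal (2 * c) * (\<integral>\<^sup>+v. f (u, u - 2 * c * v) \<partial>lborel)"
      using c by (simp add: abs_mult)
    then have "ennreal (1 / (2 * c)) * (\<integral>\<^sup>+v. f (u, v) \<partial>lborel) = (ennreal (1 / (2 * c)) * ennreal (2 * c)) * (\<integral>\<^sup>+v. f (u, u - 2 * c * v) \<partial>lborel)"
      by (simp only: mult.assoc)
    also have "ennreal (1 / (2 * c)) * ennreal (2 * c) = 1" using c by (simp add: ennreal_mult'[symmetric])
    finally show "(\<integral>\<^sup>+v. f (u, u - 2 * c * v) \<partial>lborel) = ennreal (1 / (2 * c)) * (\<integral>\<^sup>+v. f (u, v) \<partial>lborel)" by simp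
  qed
  also have "\<dots> = ennreal (1 / (2 * c)) * (\<integral>\<^sup>+u. \<integral>\<^sup>+v. f (u, v) \<partial>lborel \<partial>lborel)"
    by (rule nn_integral_cmult) measurable
  also have "(\<integral>\<^sup>+u. \<integral>\<^sup>+v. f (u, v) \<partial>lborel \<partial>lborel) = (\<integral>\<^sup>+p. f p \<partial>lborel)"
    by (subst lborel_prod[symmetric], subst lborel.nn_integral_fst[symmetric]) (simp_all add: lborel_prod)
  finally have "ennreal (2 * r * c) * (\<integral>\<^sup>+p. f (r * fst p + c * snd p, r * fst p - c * snd p) \<partial>lborel)
     = (ennreal (2 * r * c) * (ennreal (1 / r) * ennreal (1 / (2 * c)))) * (\<integral>\<^sup>+p. f p \<partial>lborel)"
    by (simp only: mult.assoc)
  also have "ennreal (2 * r * c) * (ennreal (1 / r) * ennreal (1 / (2 * c))) = 1"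
    using r c by (simp add: ennreal_mult'[symmetric])
  finally show ?thesis by simp
qed

text \<open>Applied to indicators, the formula for nonnegative functions identifies Lebesgue measure
  with a weighted image of itself under the linear map. Integrating against the two descriptions
  gives the claim for every measurable \<open>f\<close>.\<close>

lemma integral_linear_change:
  fixes f :: "real \<times> real \<Rightarrow> complex" and r c :: real
  assumes r: "r > 0" and c: "c > 0" and f: "f \<in> borel_measurable borel"
  shows "(LINT p|lborel. f (r * fst p + c * snd p, r * fst p - c * snd p)) = (LINT p|lborel. f p) / of_real (2 * r * c)"
proof -
  define T where "T p = (r * fst p + c * snd p, r * fst p - c * snd p)" for p :: "real \<times> real"
  have T [measurable]: "T \<in> borel_measurable borel"
    unfolding T_def by (intro borel_measurable_continuous_onI continuous_intros)
  have "lborel = density (distr lborel lborel T) (\<lambda>_. ennreal (2 * r * c))"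
  proof (rule measure_eqI)
    fix A :: "(real \<times> real) set" assume "A \<in> sets lborel"
    then have A [measurable]: "A \<in> sets borel" by simp
    have "emeasure lborel A = (\<integral>\<^sup>+p. indicator A p \<partial>lborel)" by simp
    also have "\<dots> = ennreal (2 * r * c) * (\<integral>\<^sup>+p. indicator A (T p) \<partial>lborel)"
      unfolding T_def by (rule nn_integral_linear_change[OF r c]) measurable
    also have "\<dots> = emeasure (density (distr lborel lborel T) (\<lambda>_. ennreal (2 * r * c))) A"
    proof -
      have "(\<integral>\<^sup>+p. indicator A (T p) \<partial>lborel) = emeasure (distr lborel lborel T) A"
        using nn_integral_distr[of T lborel lborel "indicator A"] by simp
      then show ?thesis by (simp add: emeasure_density nn_integral_cmult_indicator)
    qed
    finally show "emeasure lborel A = emeasure (density (distr lborel lborel T) (\<lambda>_. ennreal (2 * r * c))) A" .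
  qed simp
  then have "(LINT p|lborel. f p) = (LINT p|density (distr lborel lborel T) (\<lambda>_. ennreal (2 * r * c)). f p)" by simp
  also have "\<dots> = (LINT p|distr lborel lborel T. (2 * r * c) *\<^sub>R f p)"
    by (rule integral_density) (use f r c in auto)
  also have "\<dots> = (LINT p|lborel. (2 * r * c) *\<^sub>R f (T p))"
    by (rule integral_distr) (use f in auto)
  also have "\<dots> = of_real (2 * r * c) * (LINT p|lborel. f (T p))"
    by (simp only: scaleR_conv_of_real integral_mult_right_zero)
  finally show ?thesis using r c unfolding T_def by simp
qed

lemma measurable_airy_integrand [measurable]:
  "(\<lambda>u. airy_integrand k \<epsilon> s (of_real u)) \<in> borel_measurable borel"
  unfolding airy_integrand_def by measurable

text \<open>In u^3 + v^3 the coefficients of \<xi>^3 and \<xi> \<eta>^2 are 2 r^3 and 6 r c^2; they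
  coincide when c^2 = r^2/3, and both equal t when t = 2 r^3. The parameters 2 r^2 and 2 c^2 turn
  the Gaussian into exp(-\<epsilon>^2 (u^2 + v^2)). Finally \<xi> = (u + v)/(2r) puts the factor
  \<xi> on one variable at a time, hence two products.\<close>

lemma gaussian_osc_symbol_factor:
  assumes r: "r > 0" and c: "c\<^sup>2 = r\<^sup>2 / 3" and t: "t = 2 * r ^ 3"
    and u: "u = r * \<xi> + c * \<eta>" and v: "v = r * \<xi> - c * \<eta>"
    and pq: "x * \<xi> + y * \<eta> = p * u + q * v"
  shows "gaussian (2 * r\<^sup>2) (2 * c\<^sup>2) (\<epsilon> *\<^sub>R (\<xi>, \<eta>)) * osc_symbol t x y 1 0 (\<xi>, \<eta>) =
    (airy_integrand 1 \<epsilon> p (of_real u) * airy_integrand 0 \<epsilon> q (of_real v)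
     + airy_integrand 0 \<epsilon> p (of_real u) * airy_integrand 1 \<epsilon> q (of_real v)) / of_real (2 * r)"
proof -
  define E where "E s w = exp (- of_real (\<epsilon>\<^sup>2) * (complex_of_real w)\<^sup>2 + \<i> * of_real w ^ 3 + \<i> * of_real s * of_real w)" for s w
  have R1: "u\<^sup>2 + v\<^sup>2 = 2 * r\<^sup>2 * \<xi>\<^sup>2 + 2 * c\<^sup>2 * \<eta>\<^sup>2"
    unfolding u v by (simp add: power2_eq_square algebra_simps)
  have "u ^ 3 + v ^ 3 = 2 * r ^ 3 * \<xi> ^ 3 + 6 * r * c\<^sup>2 * (\<xi> * \<eta>\<^sup>2)"
    unfolding u v by (simp add: power2_eq_square power3_eq_cube algebra_simps)
  also have "6 * r * c\<^sup>2 = t" unfolding c t by (simp add: power2_eq_square power3_eq_cube)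
  finally have R2: "phase t x y (\<xi>, \<eta>) = u ^ 3 + v ^ 3 + p * u + q * v"
    unfolding t phase_def using pq by simp
  have R3: "\<xi> = (u + v) / (2 * r)" using r unfolding u v by simp
  have "E p u * E q v = exp (of_real (- \<epsilon>\<^sup>2 * (u\<^sup>2 + v\<^sup>2)) + \<i> * of_real (u ^ 3 + v ^ 3 + p * u + q * v))"
    unfolding E_def exp_add[symmetric] by (rule arg_cong[of _ _ exp]) (simp add: algebra_simps)
  also have "\<dots> = exp (of_real (- \<epsilon>\<^sup>2 * (u\<^sup>2 + v\<^sup>2))) * exp (\<i> * of_real (phase t x y (\<xi>, \<eta>)))"
    unfolding R2 by (rule exp_add)
  also have "exp (of_real (- \<epsilon>\<^sup>2 * (u\<^sup>2 + v\<^sup>2))) = gaussian (2 * r\<^sup>2) (2 * c\<^sup>2) (\<epsilon> *\<^sub>R (\<xi>, \<eta>))"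
  proof -
    have "exp (- \<epsilon>\<^sup>2 * (u\<^sup>2 + v\<^sup>2)) = exp (- (2 * r\<^sup>2) * (\<epsilon> * \<xi>)\<^sup>2) * exp (- (2 * c\<^sup>2) * (\<epsilon> * \<eta>)\<^sup>2)"
      unfolding exp_add[symmetric] R1 by (simp add: power_mult_distrib algebra_simps)
    then show ?thesis
      unfolding gaussian_def exp_of_real by (simp only: scaleR_Pair fst_conv snd_conv real_scaleR_def)
  qed
  finally have "gaussian (2 * r\<^sup>2) (2 * c\<^sup>2) (\<epsilon> *\<^sub>R (\<xi>, \<eta>)) * osc_symbol t x y 1 0 (\<xi>, \<eta>) = of_real \<xi> * (E p u * E q v)"
    unfolding osc_symbol_def by simp
  also have "of_real \<xi> * (E p u * E q v) = ((of_real u * E p u) * E q v + E p u * (of_real v * E q v)) / of_real (2 * r)"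
    unfolding R3 by (simp add: field_simps)
  also have "\<dots> = (airy_integrand 1 \<epsilon> p (of_real u) * airy_integrand 0 \<epsilon> q (of_real v)
     + airy_integrand 0 \<epsilon> p (of_real u) * airy_integrand 1 \<epsilon> q (of_real v)) / of_real (2 * r)"
    unfolding airy_integrand_def E_def by simp
  finally show ?thesis .
qed

text \<open>The denominator 4 r^2 c collects 2r from \<xi> = (u + v)/(2r) and the Jacobian 2 r c.
  The values of \<open>p\<close> and \<open>q\<close> are forced by x \<xi> + y \<eta> = p u + q
  v.\<close>

lemma osc_int_gaussian:
  assumes r: "r > 0" and c: "c > 0" "c\<^sup>2 = r\<^sup>2 / 3" and t: "t = 2 * r ^ 3" and \<epsilon>: "\<epsilon> > 0"
    and p: "p = (x / r + y / c) / 2" and q: "q = (x / r - y / c) / 2"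
  shows "osc_int t x y 1 0 (gaussian (2 * r\<^sup>2) (2 * c\<^sup>2)) \<epsilon> =
    (airy_int 1 \<epsilon> p * airy_int 0 \<epsilon> q + airy_int 0 \<epsilon> p * airy_int 1 \<epsilon> q) / of_real (4 * r\<^sup>2 * c)"
proof -
  define f where "f w = (airy_integrand 1 \<epsilon> p (of_real (fst w)) * airy_integrand 0 \<epsilon> q (of_real (snd w))
     + airy_integrand 0 \<epsilon> p (of_real (fst w)) * airy_integrand 1 \<epsilon> q (of_real (snd w))) / of_real (2 * r)" for w
  have f: "f \<in> borel_measurable borel"
    unfolding f_def[abs_def] borel_prod[symmetric] by measurable
  have pw: "gaussian (2 * r\<^sup>2) (2 * c\<^sup>2) (\<epsilon> *\<^sub>R w) * osc_symbol t x y 1 0 w = f (r * fst w + c * snd w, r * fst w - c * snd w)" for w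
  proof (cases w)
    case (Pair \<xi> \<eta>)
    have "x * \<xi> + y * \<eta> = p * (r * \<xi> + c * \<eta>) + q * (r * \<xi> - c * \<eta>)"
      unfolding p q using r c(1) by (simp add: field_simps)
    from gaussian_osc_symbol_factor[OF r c(2) t refl refl this] show ?thesis
      by (simp add: Pair f_def)
  qed
  note i = integrable_airy_integrand[OF \<epsilon>]
  have "osc_int t x y 1 0 (gaussian (2 * r\<^sup>2) (2 * c\<^sup>2)) \<epsilon> = (LINT w|lborel. f w) / of_real (2 * r * c)"
    unfolding osc_int_def pw by (rule integral_linear_change[OF r c(1) f])
  also have "(LINT w|lborel. f w) = (airy_int 1 \<epsilon> p * airy_int 0 \<epsilon> q + airy_int 0 \<epsilon> p * airy_int 1 \<epsilon> q) / of_real (2 * r)"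
    unfolding f_def airy_int_def integral_product_real(2)[OF i i, symmetric]
    by (simp only: integral_divide_zero Bochner_Integration.integral_add[OF integral_product_real(1)[OF i i] integral_product_real(1)[OF i i]])
  finally show ?thesis by (simp add: power2_eq_square mult_ac)
qed

section \<open>The pointwise majorant of the kernel\<close>

lemma sqrt3_bounds: "17 / 10 < sqrt 3" "sqrt 3 < (2::real)"
proof -
  show "17 / 10 < sqrt 3" by (rule real_less_rsqrt) (simp add: power2_eq_square)
  show "sqrt 3 < (2::real)" by (rule real_less_lsqrt) simp_all
qed

text \<open>The Airy arguments X + sqrt 3 Y and X - sqrt 3 Y are both negative only if sqrt 3 |Y| <
  -X. The cone |Y| <= -X is larger on purpose: outside it the larger argument is at least a fixed
  multiple of |Y|, so its decay controls Y as well; inside it the product is simply bounded by a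
  multiple of (1 + |X|)^(1/4).\<close>

definition A_majorant :: "nat \<Rightarrow> real \<Rightarrow> real \<Rightarrow> real" where
  "A_majorant N X Y = 1 / ((1 + max 0 X) ^ N * (1 + Y\<^sup>2)) + (if \<bar>Y\<bar> \<le> - X then (1 + \<bar>X\<bar>) powr (1 / 4) else 0)"

text \<open>Outside the cone all decay comes from the larger argument m = X + sqrt 3 |Y|. Its N + 3
  powers are spent as N on X, two on Y and one on the growth of the factor at the smaller argument,
  which is at most of order 1 + m.\<close>

lemma airy_product_le_majorant:
  fixes X Y :: real and N :: nat
  defines "b0 \<equiv> \<lambda>s. 1 / (1 + max 0 s) ^ (N + 3)"
    and "b1 \<equiv> \<lambda>s. (1 + max 0 (- s)) powr (1 / 4) / (1 + max 0 s) ^ (N + 3)"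
  shows "b1 (X + sqrt 3 * Y) * b0 (X - sqrt 3 * Y) + b0 (X + sqrt 3 * Y) * b1 (X - sqrt 3 * Y) \<le> 24 * A_majorant N X Y"
proof -
  define W where "W = sqrt 3 * \<bar>Y\<bar>"
  have W: "17 / 10 * \<bar>Y\<bar> \<le> W" "W \<le> 2 * \<bar>Y\<bar>" "W \<ge> 0"
    unfolding W_def using sqrt3_bounds mult_right_mono[of "17 / 10" "sqrt 3" "\<bar>Y\<bar>"] mult_right_mono[of "sqrt 3" 2 "\<bar>Y\<bar>"]
    by auto
  have one: "1 \<le> (1 + max 0 s) ^ (N + 3)" for s :: real by (rule one_le_power) simp
  have b0: "0 \<le> b0 s" "b0 s \<le> 1" for s
    using one[of s] by (auto simp: b0_def divide_le_eq)
  have b1: "0 \<le> b1 s" "b1 s \<le> (1 + max 0 (- s)) powr (1 / 4)" for s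
    using divide_left_mono[OF one[of s], of "(1 + max 0 (- s)) powr (1 / 4)"] by (auto simp: b1_def)
  have sym: "b1 (X + sqrt 3 * Y) * b0 (X - sqrt 3 * Y) + b0 (X + sqrt 3 * Y) * b1 (X - sqrt 3 * Y)
     = b1 (X + W) * b0 (X - W) + b0 (X + W) * b1 (X - W)"
    by (cases "Y \<ge> 0") (auto simp: W_def)
  have "b1 (X + W) * b0 (X - W) + b0 (X + W) * b1 (X - W) \<le> 24 * A_majorant N X Y"
  proof (cases "\<bar>Y\<bar> \<le> - X")
    case True
    have b1': "b1 s \<le> 3 * (1 + \<bar>X\<bar>) powr (1 / 4)" if "\<bar>s\<bar> \<le> 3 * \<bar>X\<bar>" for s
    proof -
      have "b1 s \<le> (1 + max 0 (- s)) powr (1 / 4)" by (rule b1)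
      also have "\<dots> \<le> (3 * (1 + \<bar>X\<bar>)) powr (1 / 4)" using that by (intro powr_mono2) auto
      also have "\<dots> = 3 powr (1 / 4) * (1 + \<bar>X\<bar>) powr (1 / 4)" by (rule powr_mult)
      also have "\<dots> \<le> 3 powr 1 * (1 + \<bar>X\<bar>) powr (1 / 4)" by (intro mult_right_mono powr_mono) auto
      finally show ?thesis by simp
    qed
    have "b1 (X + W) * b0 (X - W) + b0 (X + W) * b1 (X - W) \<le> 3 * (1 + \<bar>X\<bar>) powr (1 / 4) * 1 + 1 * (3 * (1 + \<bar>X\<bar>) powr (1 / 4))"
      using True W by (intro add_mono mult_mono b0 b1 b1') auto
    also have "\<dots> \<le> 24 * (1 + \<bar>X\<bar>) powr (1 / 4)" by simp
    also have "\<dots> \<le> 24 * A_majorant N X Y" using True unfolding A_majorant_def by simp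
    finally show ?thesis .
  next
    case False
    define m where "m = X + W"
    have m: "m \<ge> 7 / 10 * \<bar>Y\<bar>" "m \<ge> 0" "m \<ge> max 0 X" using False W unfolding m_def by auto
    have n: "max 0 (- (X - W)) \<le> 5 * m" using False W m unfolding m_def by auto
    have "b1 m * b0 (X - W) + b0 m * b1 (X - W) \<le> (1 / (1 + m) ^ (N + 3)) * 1 + (1 / (1 + m) ^ (N + 3)) * (5 * (1 + m))"
    proof (intro add_mono mult_mono b0 b1)
      show "b1 m \<le> 1 / (1 + m) ^ (N + 3)" "b0 m \<le> 1 / (1 + m) ^ (N + 3)"
        using m by (auto simp: b1_def b0_def max_absorb1 max_absorb2)
      have "b1 (X - W) \<le> (1 + max 0 (- (X - W))) powr (1 / 4)" by (rule b1)
      also have "\<dots> \<le> (1 + max 0 (- (X - W))) powr 1" by (intro powr_mono) auto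
      also have "\<dots> \<le> 5 * (1 + m)" using n m by simp
      finally show "b1 (X - W) \<le> 5 * (1 + m)" .
    qed (use m in auto)
    also have "\<dots> \<le> (1 / (1 + m) ^ (N + 3)) * (6 * (1 + m))"
      unfolding distrib_left[symmetric] using m by (intro mult_left_mono) auto
    also have "\<dots> = 6 * (1 / ((1 + m) ^ N * (1 + m)\<^sup>2))"
    proof -
      have "1 / Z ^ (N + 3) * (6 * Z) = 6 * (1 / (Z ^ N * Z\<^sup>2))" if "Z > 0" for Z :: real
        using that by (simp add: power_add power2_eq_square power3_eq_cube)
      from this[of "1 + m"] show ?thesis using m by (simp only: add_pos_nonneg zero_less_one)
    qed
    \<comment> \<open>As (7/10)^2 exceeds 1/4, (1 + m)^2 is at least (1 + Y^2)/4; this 4 and the 6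
      make up the constant 24.\<close>
    also have "\<dots> \<le> 6 * (1 / ((1 + max 0 X) ^ N * ((1 + Y\<^sup>2) / 4)))"
    proof (intro mult_left_mono divide_left_mono mult_mono power_mono mult_pos_pos)
      have "(7 / 10 * \<bar>Y\<bar>)\<^sup>2 \<le> m\<^sup>2" using m by (intro power_mono) auto
      then have "49 / 100 * Y\<^sup>2 \<le> m\<^sup>2" by (simp add: power2_eq_square)
      moreover have "(1 + m)\<^sup>2 = 1 + 2 * m + m\<^sup>2" by (simp add: power2_eq_square algebra_simps)
      moreover have "0 \<le> Y\<^sup>2" by simp
      ultimately show "(1 + Y\<^sup>2) / 4 \<le> (1 + m)\<^sup>2" using m(2) unfolding add_divide_distrib by linarith
    qed (use m in \<open>auto simp: add_pos_nonneg\<close>)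
    also have "\<dots> = 24 * (1 / ((1 + max 0 X) ^ N * (1 + Y\<^sup>2)))" by simp
    also have "\<dots> \<le> 24 * A_majorant N X Y" using False unfolding A_majorant_def by simp
    finally show ?thesis unfolding m_def .
  qed
  then show ?thesis unfolding sym .
qed

text \<open>With \<tau> = 2r the condition t = 2 r^3 reads \<tau>^3 = 4t, the Airy arguments become
  (x + sqrt 3 y)/\<tau> and (x - sqrt 3 y)/\<tau>, and the factor 1/(4 r^2 c) becomes 2 sqrt 3 /
  \<tau>^3. The cutoff integrals obey the bound for all small \<epsilon>, so their limit does
  too.\<close>

lemma A_x_bound:
  "\<exists>K>0. \<forall>x y t \<tau>. t > 0 \<and> \<tau> > 0 \<and> \<tau> ^ 3 = 4 * t \<longrightarrow>
     norm (A_x x y t) \<le> K / \<tau> ^ 3 * A_majorant N (x / \<tau>) (y / \<tau>)"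
proof -
  define b0 where "b0 s = 1 / (1 + max 0 s) ^ (N + 3)" for s :: real
  define b1 where "b1 s = (1 + max 0 (- s)) powr (1 / 4) / (1 + max 0 s) ^ (N + 3)" for s :: real
  obtain C where C: "C > 0" "\<And>s. \<forall>\<^sub>F \<epsilon> in at_right 0. norm (airy_int 0 \<epsilon> s) \<le> C * b0 s \<and> norm (airy_int 1 \<epsilon> s) \<le> C * b1 s"
    using airy_int_bounds[of "N + 3"] unfolding b0_def b1_def by auto
  have "norm (A_x x y t) \<le> 2 * sqrt 3 * C\<^sup>2 * 24 / \<tau> ^ 3 * A_majorant N (x / \<tau>) (y / \<tau>)"
    if t: "t > 0" and \<tau>: "\<tau> > 0" "\<tau> ^ 3 = 4 * t" for x y t \<tau>
  proof -
    define r where "r = \<tau> / 2"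
    define c where "c = r / sqrt 3"
    have r: "r > 0" and c: "c > 0" "c\<^sup>2 = r\<^sup>2 / 3" using \<tau> by (auto simp: r_def c_def power_divide)
    have tr: "t = 2 * r ^ 3" using \<tau>(2) by (simp add: r_def power_divide)
    define X Y where "X = x / \<tau>" "Y = y / \<tau>"
    define p where "p = X + sqrt 3 * Y"
    define q where "q = X - sqrt 3 * Y"
    have pq: "p = (x / r + y / c) / 2" "q = (x / r - y / c) / 2"
      using \<tau>(1) by (simp_all add: p_def q_def X_Y_def r_def c_def field_simps)
    have k: "1 / (4 * r\<^sup>2 * c) = 2 * sqrt 3 / \<tau> ^ 3"
      using \<tau>(1) by (simp add: r_def c_def power2_eq_square power3_eq_cube)
    let ?G = "gaussian (2 * r\<^sup>2) (2 * c\<^sup>2)"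
    have sG: "schwartz ?G" by (rule schwartz_gaussian) (use r c in auto)
    have lim: "((\<lambda>\<epsilon>. norm (\<i> * osc_int t x y 1 0 ?G \<epsilon>)) \<longlongrightarrow> norm (A_x x y t)) (at_right 0)"
      by (intro tendsto_norm osc_int_tendsto_A_x t sG) simp
    have "\<forall>\<^sub>F \<epsilon> in at_right 0. norm (\<i> * osc_int t x y 1 0 ?G \<epsilon>) \<le> 2 * sqrt 3 / \<tau> ^ 3 * (C\<^sup>2 * (b1 p * b0 q + b0 p * b1 q))"
      using eventually_at_right_less[of 0] C(2)[of p] C(2)[of q]
    proof eventually_elim
      case (elim \<epsilon>)
      have "norm (\<i> * osc_int t x y 1 0 ?G \<epsilon>) = norm (airy_int 1 \<epsilon> p * airy_int 0 \<epsilon> q + airy_int 0 \<epsilon> p * airy_int 1 \<epsilon> q) * (1 / (4 * r\<^sup>2 * c))"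
        unfolding osc_int_gaussian[OF r c tr elim(1) pq] using r c by (simp add: norm_mult norm_divide norm_power)
      also have "\<dots> \<le> (C * b1 p * (C * b0 q) + C * b0 p * (C * b1 q)) * (1 / (4 * r\<^sup>2 * c))"
      proof (intro mult_right_mono order_trans[OF norm_triangle_ineq] add_mono)
        show "norm (airy_int 1 \<epsilon> p * airy_int 0 \<epsilon> q) \<le> C * b1 p * (C * b0 q)"
          unfolding norm_mult using elim C(1) by (intro mult_mono) (auto simp: b1_def)
        show "norm (airy_int 0 \<epsilon> p * airy_int 1 \<epsilon> q) \<le> C * b0 p * (C * b1 q)"
          unfolding norm_mult using elim C(1) by (intro mult_mono) (auto simp: b0_def)
      qed (use r c in auto)
      also have "\<dots> = 2 * sqrt 3 / \<tau> ^ 3 * (C\<^sup>2 * (b1 p * b0 q + b0 p * b1 q))"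
        unfolding k by (simp add: power2_eq_square algebra_simps)
      finally show ?case .
    qed
    then have "norm (A_x x y t) \<le> 2 * sqrt 3 / \<tau> ^ 3 * (C\<^sup>2 * (b1 p * b0 q + b0 p * b1 q))"
      by (rule tendsto_upperbound[OF lim]) simp
    also have "\<dots> \<le> 2 * sqrt 3 / \<tau> ^ 3 * (C\<^sup>2 * (24 * A_majorant N X Y))"
      using airy_product_le_majorant[where N = N and X = X and Y = Y, folded b0_def b1_def] \<tau> t
      unfolding p_def q_def b0_def b1_def
      by (intro mult_left_mono) auto
    also have "\<dots> = 2 * sqrt 3 * C\<^sup>2 * 24 / \<tau> ^ 3 * A_majorant N (x / \<tau>) (y / \<tau>)"
      unfolding X_Y_def by simp
    finally show ?thesis .
  qed
  then show ?thesis using C(1) by (intro exI[of _ "2 * sqrt 3 * C\<^sup>2 * 24"]) auto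
qed

section \<open>Convolution with the kernel\<close>

lemma bracket_ge_1: "1 \<le> bracket r"
  unfolding bracket_def by (rule ge_one_powr_ge_zero) auto

lemma bracket_sqrt: "bracket r = sqrt (1 + r\<^sup>2)"
  unfolding bracket_def by (rule powr_half_sqrt) (simp add: add_nonneg_nonneg)

lemma bracket_le: "bracket r \<le> 1 + \<bar>r\<bar>"
  using sqrt_sum_squares_le_sum_abs[of 1 r] by (simp add: bracket_sqrt)

lemma bracket_ge:
  assumes "r \<ge> 0"
  shows "(1 + r) / 2 \<le> bracket r"
  unfolding bracket_sqrt
proof (rule real_le_rsqrt)
  have "0 \<le> (1 - r)\<^sup>2" by simp
  moreover have "(1 - r)\<^sup>2 = 1 - 2 * r + r\<^sup>2" by (simp add: power2_eq_square algebra_simps)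
  moreover have "((1 + r) / 2)\<^sup>2 = (1 + 2 * r + r\<^sup>2) / 4" by (simp add: power2_eq_square algebra_simps)
  ultimately show "((1 + r) / 2)\<^sup>2 \<le> 1 + r\<^sup>2" using zero_le_power2[of r] unfolding add_divide_distrib by linarith
qed

lemma bracket_powr_le:
  assumes "r \<ge> 0" "\<sigma> \<ge> 0"
  shows "bracket r powr (- \<sigma>) \<le> 2 powr \<sigma> * (1 + r) powr (- \<sigma>)"
proof -
  have "bracket r powr (- \<sigma>) \<le> ((1 + r) / 2) powr (- \<sigma>)"
    using assms bracket_ge by (intro powr_mono2') auto
  also have "\<dots> = 2 powr \<sigma> * (1 + r) powr (- \<sigma>)"
    using assms by (simp add: powr_divide powr_minus_divide)
  finally show ?thesis .
qed

text \<open>For X = u/\<tau>, the hypothesis t <= 2u implies \<tau>^2 <= 8X, so u = X \<tau> is at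
  most of order X^(3/2). Thus decay in the scaled variable is decay in u, uniformly in t.\<close>

lemma scaled_growth:
  fixes u \<tau> t :: real
  assumes \<tau>: "\<tau> > 0" "\<tau> ^ 3 = 4 * t" and u: "u \<ge> 0" "t \<le> 2 * u"
  shows "1 + 2 * u \<le> 8 * (1 + u / \<tau>)\<^sup>2"
proof -
  define X where "X = u / \<tau>"
  have X: "X \<ge> 0" "u = X * \<tau>" using \<tau> u by (auto simp: X_def)
  have "\<tau> * \<tau>\<^sup>2 \<le> \<tau> * (8 * X)"
  proof -
    have "\<tau> * \<tau>\<^sup>2 = 4 * t" using \<tau>(2) by (simp add: power2_eq_square power3_eq_cube)
    also have "\<dots> \<le> 8 * u" using u(2) by simp
    also have "\<dots> = \<tau> * (8 * X)" by (simp add: X(2))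
    finally show ?thesis .
  qed
  then have "\<tau>\<^sup>2 \<le> 8 * X" using \<tau>(1) by simp
  then have "X\<^sup>2 * \<tau>\<^sup>2 \<le> X\<^sup>2 * (8 * X)" by (intro mult_left_mono) auto
  then have "(2 * u)\<^sup>2 \<le> 32 * X ^ 3"
    unfolding X(2) by (simp add: power2_eq_square power3_eq_cube mult_ac)
  also have "\<dots> \<le> 32 * (1 + X) ^ 3"
    using X by (intro mult_left_mono power_mono) auto
  \<comment> \<open>A perfect square above 32 is wanted; with 7^2 the final constant is 7 + 1 =
    8.\<close>
  also have "\<dots> \<le> 49 * (1 + X) ^ 4"
    using X by (intro mult_mono power_increasing) auto
  also have "\<dots> = (7 * (1 + X)\<^sup>2)\<^sup>2" by (simp add: power_mult_distrib flip: power_mult)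
  finally have "2 * u \<le> 7 * (1 + X)\<^sup>2"
    by (rule power2_le_imp_le) simp
  moreover have "1 \<le> (1 + X)\<^sup>2" using X by (intro one_le_power) simp
  ultimately show ?thesis unfolding X_def by linarith
qed

text \<open>Either u <= z/2, and z - u is comparable to z, or u > z/2 >= t/2, and
  \<open>scaled_growth\<close> applies. The bound t <= z holds in the application because \<phi> is
  evaluated around abscissa x + t.\<close>

lemma scaled_peetre:
  fixes u z \<tau> t :: real
  assumes \<tau>: "\<tau> > 0" "\<tau> ^ 3 = 4 * t" and u: "0 \<le> u" "u \<le> z" and z: "t \<le> z"
  shows "1 + z \<le> 8 * ((1 + (z - u)) * (1 + u / \<tau>)\<^sup>2)"
proof (cases "2 * u \<le> z")
  case True
  have "1 \<le> (1 + u / \<tau>)\<^sup>2" using u \<tau> by (intro one_le_power) simp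
  then have "(1 + (z - u)) * 1 \<le> (1 + (z - u)) * (1 + u / \<tau>)\<^sup>2"
    using u by (intro mult_left_mono) auto
  then have "8 * (1 + (z - u)) \<le> 8 * ((1 + (z - u)) * (1 + u / \<tau>)\<^sup>2)" by simp
  moreover have "1 + z \<le> 8 * (1 + (z - u))" using True u by simp
  ultimately show ?thesis by (rule order_trans[rotated])
next
  case False
  have "1 + z \<le> 1 + 2 * u" using False by simp
  also have "\<dots> \<le> 8 * (1 + u / \<tau>)\<^sup>2" using False z u by (intro scaled_growth[OF \<tau>]) auto
  also have "\<dots> = 8 * (1 * (1 + u / \<tau>)\<^sup>2)" by simp
  also have "\<dots> \<le> 8 * ((1 + (z - u)) * (1 + u / \<tau>)\<^sup>2)"
    using u by (intro mult_left_mono mult_right_mono) auto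
  finally show ?thesis .
qed

lemma A_majorant_nonneg: "0 \<le> A_majorant N X Y"
  unfolding A_majorant_def by (intro add_nonneg_nonneg) (auto intro!: mult_nonneg_nonneg add_nonneg_nonneg)

text \<open>In the half-plane X >= 0 the cone is met only at the origin, where both terms of the
  majorant equal 1; hence the factor 2.\<close>

lemma A_majorant_pos:
  assumes "X \<ge> 0"
  shows "A_majorant N X Y \<le> 2 / ((1 + X) ^ N * (1 + Y\<^sup>2))"
proof (cases "\<bar>Y\<bar> \<le> - X")
  case True
  then have "X = 0" "Y = 0" using assms by auto
  then show ?thesis by (simp add: A_majorant_def)
next
  case False
  then have "A_majorant N X Y = 1 / ((1 + X) ^ N * (1 + Y\<^sup>2))"
    using assms by (simp add: A_majorant_def)
  also have "\<dots> \<le> 2 / ((1 + X) ^ N * (1 + Y\<^sup>2))"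
    using assms by (intro divide_right_mono mult_nonneg_nonneg) auto
  finally show ?thesis .
qed

lemma powr_times_inverse_power_le:
  fixes X a :: real
  assumes "X \<ge> 0" "a + 2 \<le> real N"
  shows "(1 + X) powr a / (1 + X) ^ N \<le> 1 / (1 + X\<^sup>2)"
proof -
  have "(1 + X) powr a / (1 + X) ^ N = (1 + X) powr (a - real N)"
    using assms by (simp add: powr_diff powr_realpow)
  also have "\<dots> \<le> (1 + X) powr (- 2)" using assms by (intro powr_mono) auto
  also have "\<dots> = 1 / (1 + X)\<^sup>2" using assms by (simp add: powr_minus_divide)
  also have "\<dots> \<le> 1 / (1 + X\<^sup>2)"
    using assms by (intro divide_left_mono) (auto simp: power2_eq_square algebra_simps add_pos_nonneg)
  finally show ?thesis .
qed

lemma power2_powr: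
  fixes x a :: real
  assumes "x \<ge> 0"
  shows "x\<^sup>2 powr a = x powr (2 * a)"
proof -
  have "x\<^sup>2 powr a = (x powr 2) powr a" using assms by simp
  then show ?thesis by (simp only: powr_powr)
qed

text \<open>For 0 <= u <= z the decay of \<phi> at z - u is exchanged for decay in z at the cost of
  (1 + X)^(2\<sigma>). The N powers of the majorant absorb this loss and still leave two for a
  Cauchy kernel.\<close>

lemma majorant_bound_inner:
  assumes \<tau>: "\<tau> > 0" "\<tau> ^ 3 = 4 * t" and u: "0 \<le> u" "u \<le> z" and z: "t \<le> z"
    and N: "2 * \<sigma> + 3 \<le> real N" and \<sigma>: "\<sigma> > 0"
  shows "A_majorant N (u / \<tau>) (v / \<tau>) * (1 + (z - u)) powr (- \<sigma>)
     \<le> 2 * 8 powr \<sigma> * (1 + z) powr (- \<sigma>) * cauchy_kernel2 \<tau> (u, v)"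
proof -
  define X Y where "X = u / \<tau>" "Y = v / \<tau>"
  have X: "X \<ge> 0" using u \<tau> by (simp add: X_Y_def)
  have z1: "1 + z > 0" "1 + (z - u) > 0" using u by auto
  have "(8 * ((1 + (z - u)) * (1 + X)\<^sup>2)) powr (- \<sigma>) \<le> (1 + z) powr (- \<sigma>)"
    using scaled_peetre[OF \<tau> u z] \<sigma> z1 unfolding X_Y_def by (intro powr_mono2') auto
  moreover have "(8 * ((1 + (z - u)) * (1 + X)\<^sup>2)) powr (- \<sigma>) = 8 powr (- \<sigma>) * ((1 + (z - u)) powr (- \<sigma>) * (1 + X) powr (- (2 * \<sigma>)))"
    using X z1 by (simp add: powr_mult power2_powr)
  ultimately have "8 powr \<sigma> * (1 + X) powr (2 * \<sigma>) * (8 powr (- \<sigma>) * ((1 + (z - u)) powr (- \<sigma>) * (1 + X) powr (- (2 * \<sigma>))))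
      \<le> 8 powr \<sigma> * (1 + X) powr (2 * \<sigma>) * (1 + z) powr (- \<sigma>)"
    by (intro mult_left_mono) auto
  then have P: "(1 + (z - u)) powr (- \<sigma>) \<le> 8 powr \<sigma> * (1 + X) powr (2 * \<sigma>) * (1 + z) powr (- \<sigma>)"
    using X by (simp add: powr_minus field_simps)
  have "A_majorant N X Y * (1 + (z - u)) powr (- \<sigma>) \<le> 2 / ((1 + X) ^ N * (1 + Y\<^sup>2)) * (8 powr \<sigma> * (1 + X) powr (2 * \<sigma>) * (1 + z) powr (- \<sigma>))"
    using X by (intro mult_mono A_majorant_pos P) (auto simp: A_majorant_nonneg)
  also have "\<dots> = 2 * 8 powr \<sigma> * (1 + z) powr (- \<sigma>) * ((1 + X) powr (2 * \<sigma>) / (1 + X) ^ N * (1 / (1 + Y\<^sup>2)))"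
    by (simp add: field_simps)
  also have "\<dots> \<le> 2 * 8 powr \<sigma> * (1 + z) powr (- \<sigma>) * (1 / (1 + X\<^sup>2) * (1 / (1 + Y\<^sup>2)))"
    using X N by (intro mult_left_mono mult_right_mono powr_times_inverse_power_le) auto
  also have "1 / (1 + X\<^sup>2) * (1 / (1 + Y\<^sup>2)) = cauchy_kernel2 \<tau> (u, v)"
    by (simp add: cauchy_kernel2_def X_Y_def)
  finally show ?thesis unfolding X_Y_def .
qed

text \<open>For u >= z only a weighted L^2 bound of \<phi> is available, so the kernel is needed in
  L^2 with the inverse weight \<open>bracket (z - u)\<close>. Both this weight and 1 + z are at most
  8 (1 + X)^2, because u >= t. After squaring, 4 + 4\<sigma> powers are lost and two are kept for
  the Cauchy kernel, which matches 2N >= 4\<sigma> + 6; the 256 is (2 times 8)^2.\<close>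

lemma majorant_bound_outer:
  assumes \<tau>: "\<tau> > 0" "\<tau> ^ 3 = 4 * t" and t: "t > 0" and u: "z \<le> u" and z: "t \<le> z"
    and N: "2 * \<sigma> + 3 \<le> real N" and \<sigma>: "\<sigma> > 0"
  shows "(A_majorant N (u / \<tau>) (v / \<tau>) * bracket (z - u))\<^sup>2
     \<le> 256 * 8 powr (2 * \<sigma>) * (1 + z) powr (- (2 * \<sigma>)) * cauchy_kernel2 \<tau> (u, v)"
proof -
  define X Y where "X = u / \<tau>" "Y = v / \<tau>"
  have X: "X \<ge> 0" using u z t \<tau> by (simp add: X_Y_def)
  have g: "1 + 2 * u \<le> 8 * (1 + X)\<^sup>2" unfolding X_Y_def
    using u z t by (intro scaled_growth[OF \<tau>]) auto
  have b: "bracket (z - u) \<le> 8 * (1 + X)\<^sup>2" using bracket_le[of "z - u"] g u z t by simp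
  have z8: "1 + z \<le> 8 * (1 + X)\<^sup>2" using g u z t by simp
  have z1: "1 + z > 0" using z t by simp
  have "(8 * (1 + X)\<^sup>2) powr (- (2 * \<sigma>)) \<le> (1 + z) powr (- (2 * \<sigma>))"
    using z8 \<sigma> z1 by (intro powr_mono2') auto
  moreover have "(8 * (1 + X)\<^sup>2) powr (- (2 * \<sigma>)) = 8 powr (- (2 * \<sigma>)) * (1 + X) powr (- (4 * \<sigma>))"
    using X by (simp add: powr_mult power2_powr)
  ultimately have "8 powr (2 * \<sigma>) * (1 + X) powr (4 * \<sigma>) * (8 powr (- (2 * \<sigma>)) * (1 + X) powr (- (4 * \<sigma>)))
      \<le> 8 powr (2 * \<sigma>) * (1 + X) powr (4 * \<sigma>) * (1 + z) powr (- (2 * \<sigma>))"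
    by (intro mult_left_mono) auto
  then have P: "1 \<le> 8 powr (2 * \<sigma>) * (1 + X) powr (4 * \<sigma>) * (1 + z) powr (- (2 * \<sigma>))"
    using X by (simp add: powr_minus field_simps)
  have Y1: "1 \<le> 1 + Y\<^sup>2" by simp
  have Y2: "1 / (1 + Y\<^sup>2)\<^sup>2 \<le> 1 / (1 + Y\<^sup>2)"
    using self_le_power[OF Y1, of 2] Y1 by (intro divide_left_mono mult_pos_pos zero_less_power) (auto simp: add_pos_nonneg)
  have "A_majorant N X Y * bracket (z - u) \<le> 2 / ((1 + X) ^ N * (1 + Y\<^sup>2)) * (8 * (1 + X)\<^sup>2)"
    using X bracket_ge_1[of "z - u"] by (intro mult_mono A_majorant_pos b) (auto simp: A_majorant_nonneg)
  then have "(A_majorant N X Y * bracket (z - u))\<^sup>2 \<le> (2 / ((1 + X) ^ N * (1 + Y\<^sup>2)) * (8 * (1 + X)\<^sup>2))\<^sup>2"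
    using bracket_ge_1[of "z - u"] by (intro power_mono mult_nonneg_nonneg A_majorant_nonneg) auto
  also have "\<dots> = 256 * ((1 + X) ^ 4 / (1 + X) ^ (2 * N) * (1 / (1 + Y\<^sup>2)\<^sup>2))"
    by (simp add: power_mult_distrib power_divide flip: power_mult) (simp add: mult.commute)
  also have "\<dots> \<le> 256 * ((1 + X) ^ 4 / (1 + X) ^ (2 * N) * (1 / (1 + Y\<^sup>2)))"
    using X by (intro mult_left_mono Y2) auto
  also have "\<dots> \<le> 256 * ((1 + X) ^ 4 / (1 + X) ^ (2 * N) * (1 / (1 + Y\<^sup>2))) * (8 powr (2 * \<sigma>) * (1 + X) powr (4 * \<sigma>) * (1 + z) powr (- (2 * \<sigma>)))"
    using mult_left_mono[OF P, of "256 * ((1 + X) ^ 4 / (1 + X) ^ (2 * N) * (1 / (1 + Y\<^sup>2)))"] X by simp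
  also have "\<dots> = 256 * 8 powr (2 * \<sigma>) * (1 + z) powr (- (2 * \<sigma>)) * ((1 + X) powr (4 + 4 * \<sigma>) / (1 + X) ^ (2 * N) * (1 / (1 + Y\<^sup>2)))"
  proof -
    have "(1 + X) powr (4 + 4 * \<sigma>) = (1 + X) ^ 4 * (1 + X) powr (4 * \<sigma>)" using X by (simp add: powr_add powr_numeral)
    then show ?thesis by (simp add: field_simps)
  qed
  also have "\<dots> \<le> 256 * 8 powr (2 * \<sigma>) * (1 + z) powr (- (2 * \<sigma>)) * (1 / (1 + X\<^sup>2) * (1 / (1 + Y\<^sup>2)))"
    using X N by (intro mult_left_mono mult_right_mono powr_times_inverse_power_le) auto
  also have "1 / (1 + X\<^sup>2) * (1 / (1 + Y\<^sup>2)) = cauchy_kernel2 \<tau> (u, v)"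
    by (simp add: cauchy_kernel2_def X_Y_def)
  finally show ?thesis unfolding X_Y_def .
qed

text \<open>No measurability is needed: the integral of a non-integrable function is 0.\<close>

lemma norm_integral_le_nn_integral:
  fixes f :: "'a \<Rightarrow> complex"
  assumes "(\<integral>\<^sup>+x. ennreal (norm (f x)) \<partial>M) \<le> ennreal B" "B \<ge> 0"
  shows "norm (LINT x|M. f x) \<le> B"
proof (cases "integrable M f")
  case True
  have "ennreal (norm (LINT x|M. f x)) \<le> ennreal B"
    using integral_norm_bound_ennreal[OF True] assms(1) by (rule order_trans)
  then show ?thesis using assms(2) by (simp add: ennreal_le_iff)
next
  case False
  then show ?thesis using assms(2) by (simp add: not_integrable_integral_eq)
qed

text \<open>\<phi> is only Lebesgue measurable, so composing it with p \<mapsto> a - p requires that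
  the reflection respects null sets. Affine invariance of the completed measure gives this and the
  equality of the integrals.\<close>

lemma nn_integral_lebesgue_reflect:
  fixes f :: "real \<times> real \<Rightarrow> ennreal"
  assumes f: "f \<in> borel_measurable lebesgue"
  shows "(\<integral>\<^sup>+p. f (a - p) \<partial>lebesgue) = (\<integral>\<^sup>+p. f p \<partial>lebesgue)"
    and "(\<lambda>p. f (a - p)) \<in> borel_measurable lebesgue"
proof -
  have T: "(\<lambda>p. a + (\<Sum>j\<in>Basis. (- 1 * (p \<bullet> j)) *\<^sub>R j)) = (\<lambda>p::real \<times> real. a - p)"
    by (simp add: fun_eq_iff sum_negf euclidean_representation)
  have m: "(\<lambda>p. a - p) \<in> lebesgue \<rightarrow>\<^sub>M (lebesgue :: (real \<times> real) measure)"
    using lebesgue_affine_measurable[of "\<lambda>_. - 1" a] unfolding T by simp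
  have "(lebesgue :: (real \<times> real) measure) = density (distr lebesgue lebesgue (\<lambda>p. a - p)) (\<lambda>_. ennreal (\<Prod>j\<in>(Basis :: (real \<times> real) set). \<bar>- 1\<bar>))"
    using lebesgue_affine_euclidean[of "\<lambda>_. - 1" a] unfolding T by simp
  then have "(lebesgue :: (real \<times> real) measure) = distr lebesgue lebesgue (\<lambda>p. a - p)"
    by (simp add: density_1)
  then have "(\<integral>\<^sup>+p. f p \<partial>lebesgue) = (\<integral>\<^sup>+p. f p \<partial>distr lebesgue lebesgue (\<lambda>p. a - p))" by simp
  also have "\<dots> = (\<integral>\<^sup>+p. f (a - p) \<partial>lebesgue)"
    by (rule nn_integral_distr[OF m]) (use f in simp)
  finally show "(\<integral>\<^sup>+p. f (a - p) \<partial>lebesgue) = (\<integral>\<^sup>+p. f p \<partial>lebesgue)" ..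
  show "(\<lambda>p. f (a - p)) \<in> borel_measurable lebesgue"
    by (rule measurable_compose[OF m f])
qed

text \<open>On the line u = z the argument z - u of \<phi> is 0, where the pointwise bound says
  nothing and the L^2 bound does not reach; the line is null.\<close>

lemma AE_fst_neq: "AE p in (lebesgue :: (real \<times> real) measure). fst p \<noteq> z"
proof -
  have "negligible {p :: real \<times> real. (1, 0) \<bullet> p = z}"
    by (rule negligible_hyperplane) (simp add: zero_prod_def)
  moreover have "{p :: real \<times> real. (1, 0) \<bullet> p = z} = {p. fst p = z}"
    by (auto simp: inner_prod_def)
  ultimately have "{p :: real \<times> real. fst p = z} \<in> null_sets lebesgue"
    by (simp add: negligible_iff_null_sets)
  then show ?thesis by (auto dest: AE_not_in)
qed

section \<open>The contribution of the half-plane u < 0\<close>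

lemma nn_integral_powr_tail:
  fixes a z :: real
  assumes a: "a > 1" and z: "z > - 1"
  shows "(\<integral>\<^sup>+r. ennreal ((1 + z + r) powr (- a)) * indicator {0..} r \<partial>lborel) = ennreal ((1 + z) powr (1 - a) / (a - 1))"
proof -
  define F where "F r = (1 + z + r) powr (1 - a) / (1 - a)" for r
  have "(\<integral>\<^sup>+r. ennreal ((1 + z + r) powr (- a)) * indicator {0..} r \<partial>lborel) = ennreal (0 - F 0)"
  proof (rule nn_integral_FTC_atLeast)
    show "DERIV F r :> (1 + z + r) powr (- a)" if "0 \<le> r" for r
      unfolding F_def using that z a by (auto intro!: derivative_eq_intros)
    have "filterlim (\<lambda>r. 1 + z + r) at_top at_top"
      by (rule filterlim_tendsto_add_at_top[OF tendsto_const filterlim_ident])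
    then have "((\<lambda>r. (1 + z + r) powr (1 - a)) \<longlongrightarrow> 0) at_top"
      by (rule tendsto_neg_powr[rotated]) (use a in simp)
    then show "(F \<longlongrightarrow> 0) at_top" unfolding F_def[abs_def] by (rule tendsto_divide_zero)
  qed auto
  also have "0 - F 0 = (1 + z) powr (1 - a) / (a - 1)"
    using a by (simp add: F_def field_simps)
  finally show ?thesis .
qed

text \<open>The left side is the v-integral over the slice u = -r: \<pi>\<tau> from the Cauchy term,
  and the width 2r of the cone times its weight. In the application s is 1 + z + r. As \<tau> <= 2s,
  both parts are of order \<tau>^(-1/4) s^(5/4), with constants 16 and 6.\<close>

lemma width_bound:
  fixes \<tau> s r :: real
  assumes \<tau>: "\<tau> > 0" "\<tau> \<le> 2 * s" and r: "0 \<le> r" "r \<le> s" and s: "s \<ge> 1"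
  shows "pi * \<tau> + 2 * r * (1 + r / \<tau>) powr (1 / 4) \<le> 22 * \<tau> powr (- 1 / 4) * s powr (5 / 4)"
proof -
  have p: "\<tau> powr (1 / 4) * \<tau> powr (- 1 / 4) = 1" using \<tau> by (simp add: powr_add[symmetric])
  have s5: "s powr (5 / 4) = s * s powr (1 / 4)" using s powr_add[of s 1 "1 / 4"] by simp
  have "\<tau> * \<tau> powr (1 / 4) \<le> (2 * s) * (2 * s) powr (1 / 4)"
    using \<tau> s by (intro mult_mono powr_mono2) auto
  also have "(2 * s) powr (1 / 4) = 2 powr (1 / 4) * s powr (1 / 4)" using s by (simp add: powr_mult)
  also have "2 powr (1 / 4 :: real) \<le> 2 powr 1" by (intro powr_mono) auto
  finally have 1: "\<tau> * \<tau> powr (1 / 4) \<le> 4 * (s * s powr (1 / 4))" using s by (simp add: mult_right_mono mult_left_mono)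
  have "(1 + r / \<tau>) powr (1 / 4) * \<tau> powr (1 / 4) = (\<tau> + r) powr (1 / 4)"
  proof -
    have "(1 + r / \<tau>) powr (1 / 4) * \<tau> powr (1 / 4) = ((1 + r / \<tau>) * \<tau>) powr (1 / 4)"
      by (rule powr_mult[symmetric])
    also have "(1 + r / \<tau>) * \<tau> = \<tau> + r" using \<tau> by (simp add: field_simps)
    finally show ?thesis .
  qed
  also have "\<dots> \<le> (3 * s) powr (1 / 4)" using \<tau> r by (intro powr_mono2) auto
  also have "\<dots> = 3 powr (1 / 4) * s powr (1 / 4)" by (rule powr_mult)
  also have "\<dots> \<le> 3 powr 1 * s powr (1 / 4)" by (intro mult_right_mono powr_mono) auto
  finally have h: "(1 + r / \<tau>) powr (1 / 4) * \<tau> powr (1 / 4) \<le> 3 * s powr (1 / 4)" by simp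
  have 2: "2 * r * ((1 + r / \<tau>) powr (1 / 4) * \<tau> powr (1 / 4)) \<le> 2 * s * (3 * s powr (1 / 4))"
    by (rule mult_mono) (use r h in auto)
  have "pi * \<tau> + 2 * r * (1 + r / \<tau>) powr (1 / 4)
     = \<tau> powr (- 1 / 4) * (pi * (\<tau> * \<tau> powr (1 / 4)) + 2 * r * ((1 + r / \<tau>) powr (1 / 4) * \<tau> powr (1 / 4)))"
  proof -
    have "A + B = q * (A' + B')" if "A' = A * h" "B' = B * h" "h * q = 1" for A B A' B' h q :: real
    proof -
      have "q * (A' + B') = (A + B) * (h * q)" unfolding that(1,2) by (simp add: algebra_simps)
      then show ?thesis using that(3) by simp
    qed
    note alg = this[OF _ _ p]
    show ?thesis by (rule alg) (simp_all only: mult.assoc)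
  qed
  also have "\<dots> \<le> \<tau> powr (- 1 / 4) * (4 * (4 * (s * s powr (1 / 4))) + 2 * s * (3 * s powr (1 / 4)))"
  proof (intro mult_left_mono add_mono 2)
    show "pi * (\<tau> * \<tau> powr (1 / 4)) \<le> 4 * (4 * (s * s powr (1 / 4)))"
      by (rule mult_mono) (use 1 pi_less_4 \<tau> in auto)
  qed simp
  also have "\<dots> = 22 * \<tau> powr (- 1 / 4) * s powr (5 / 4)" unfolding s5 by simp
  finally show ?thesis .
qed

text \<open>This is \<open>A_majorant\<close> at (u/\<tau>, v/\<tau>) times the decay of \<phi>,
  written out for u < 0: there (1 + max 0 X)^N equals 1, and the cone condition is invariant under
  the scaling by \<tau>.\<close>

definition inner_majorant :: "real \<Rightarrow> real \<Rightarrow> real \<Rightarrow> real \<times> real \<Rightarrow> real" where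
  "inner_majorant \<sigma> z \<tau> p = (if fst p < 0 then (1 + (z - fst p)) powr (- \<sigma>) *
      (1 / (1 + (snd p / \<tau>)\<^sup>2) + (if \<bar>snd p\<bar> \<le> - fst p then (1 + \<bar>fst p\<bar> / \<tau>) powr (1 / 4) else 0)) else 0)"

lemma measurable_inner_majorant [measurable]: "inner_majorant \<sigma> z \<tau> \<in> borel_measurable borel"
  unfolding inner_majorant_def[abs_def] borel_prod[symmetric] by measurable

text \<open>After integration over the slices the integrand is (1 + z + r)^(5/4 - \<sigma>), which
  is integrable exactly for \<sigma> > 9/4. Its tail integral yields the exponent 9/4 - \<sigma> and
  the factor 1/(\<sigma> - 9/4).\<close>

lemma nn_integral_inner_majorant:
  assumes \<tau>: "\<tau> > 0" "\<tau> \<le> 2 * (1 + z)" and z: "z > 0" and \<sigma>: "\<sigma> > 9 / 4"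
  shows "(\<integral>\<^sup>+p. ennreal (inner_majorant \<sigma> z \<tau> p) \<partial>lborel) \<le>
     ennreal (22 / (\<sigma> - 9 / 4) * \<tau> powr (- 1 / 4) * (1 + z) powr (9 / 4 - \<sigma>))"
proof -
  define k where "k r = (1 + z + r) powr (- (\<sigma> - 5 / 4))" for r
  have inner: "(\<integral>\<^sup>+v. ennreal (inner_majorant \<sigma> z \<tau> (- r, v)) \<partial>lborel) \<le> ennreal (22 * \<tau> powr (- 1 / 4)) * (ennreal (k r) * indicator {0..} r)" for r
  proof (cases "r > 0")
    case True
    let ?w = "(1 + z + r) powr (- \<sigma>)" and ?h = "(1 + r / \<tau>) powr (1 / 4)"
    have "ennreal (inner_majorant \<sigma> z \<tau> (- r, v)) = ennreal ?w * (ennreal (1 / (1 + (v / \<tau>)\<^sup>2)) + ennreal ?h * indicator {- r..r} v)" for v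
    proof -
      have "inner_majorant \<sigma> z \<tau> (- r, v) = ?w * (1 / (1 + (v / \<tau>)\<^sup>2) + ?h * indicator {- r..r} v)"
        using True by (auto simp: inner_majorant_def indicator_def abs_le_iff add.assoc)
      also have "ennreal \<dots> = ennreal ?w * ennreal (1 / (1 + (v / \<tau>)\<^sup>2) + ?h * indicator {- r..r} v)"
        by (rule ennreal_mult') simp
      also have "ennreal (1 / (1 + (v / \<tau>)\<^sup>2) + ?h * indicator {- r..r} v) = ennreal (1 / (1 + (v / \<tau>)\<^sup>2)) + ennreal (?h * indicator {- r..r} v)"
        by (rule ennreal_plus) (auto simp: add_nonneg_nonneg)
      also have "ennreal (?h * indicator {- r..r} v) = ennreal ?h * indicator {- r..r} v"
        by (auto simp: indicator_def)
      finally show ?thesis .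
    qed
    then have "(\<integral>\<^sup>+v. ennreal (inner_majorant \<sigma> z \<tau> (- r, v)) \<partial>lborel) = ennreal ?w * (ennreal (pi * \<tau>) + ennreal ?h * ennreal (2 * r))"
      using True nn_integral_cauchy_kernel[OF \<tau>(1), of 0]
      by (simp add: nn_integral_cmult nn_integral_add nn_integral_cmult_indicator)
    also have "\<dots> = ennreal (?w * (pi * \<tau> + 2 * r * ?h))"
    proof -
      have "ennreal ?h * ennreal (2 * r) = ennreal (2 * r * ?h)"
        using True by (subst ennreal_mult'[symmetric]) (auto simp: mult.commute)
      moreover have "ennreal (pi * \<tau>) + ennreal (2 * r * ?h) = ennreal (pi * \<tau> + 2 * r * ?h)"
        by (rule ennreal_plus[symmetric]) (use True \<tau> in auto)
      moreover have "ennreal ?w * ennreal (pi * \<tau> + 2 * r * ?h) = ennreal (?w * (pi * \<tau> + 2 * r * ?h))"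
        by (rule ennreal_mult'[symmetric]) simp
      ultimately show ?thesis by (simp only:)
    qed
    also have "\<dots> \<le> ennreal (?w * (22 * \<tau> powr (- 1 / 4) * (1 + z + r) powr (5 / 4)))"
      using True z \<tau> by (intro ennreal_leI mult_left_mono width_bound) auto
    also have "?w * (22 * \<tau> powr (- 1 / 4) * (1 + z + r) powr (5 / 4)) = 22 * \<tau> powr (- 1 / 4) * k r"
      unfolding k_def by (simp add: powr_add[symmetric] algebra_simps)
    also have "ennreal (22 * \<tau> powr (- 1 / 4) * k r) = ennreal (22 * \<tau> powr (- 1 / 4)) * (ennreal (k r) * indicator {0..} r)"
      using True by (simp add: ennreal_mult' k_def)
    finally show ?thesis .
  next
    case False
    then have "inner_majorant \<sigma> z \<tau> (- r, v) = 0" for v by (simp add: inner_majorant_def)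
    then show ?thesis by simp
  qed
  have m2 [measurable]: "(\<lambda>p. ennreal (inner_majorant \<sigma> z \<tau> p)) \<in> borel_measurable (borel \<Otimes>\<^sub>M borel)"
    by (simp add: borel_prod)
  have mu [measurable]: "(\<lambda>u. \<integral>\<^sup>+v. ennreal (inner_majorant \<sigma> z \<tau> (u, v)) \<partial>lborel) \<in> borel_measurable borel"
    by measurable
  have "(\<integral>\<^sup>+p. ennreal (inner_majorant \<sigma> z \<tau> p) \<partial>lborel) = (\<integral>\<^sup>+u. \<integral>\<^sup>+v. ennreal (inner_majorant \<sigma> z \<tau> (u, v)) \<partial>lborel \<partial>lborel)"
    by (subst lborel_prod[symmetric], subst lborel.nn_integral_fst[symmetric]) (simp_all add: lborel_prod)
  also have "\<dots> = (\<integral>\<^sup>+r. \<integral>\<^sup>+v. ennreal (inner_majorant \<sigma> z \<tau> (- r, v)) \<partial>lborel \<partial>lborel)"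
    using nn_integral_real_affine[OF mu, of "- 1" 0] by simp
  also have "\<dots> \<le> (\<integral>\<^sup>+r. ennreal (22 * \<tau> powr (- 1 / 4)) * (ennreal (k r) * indicator {0..} r) \<partial>lborel)"
    by (intro nn_integral_mono inner)
  also have "\<dots> = ennreal (22 * \<tau> powr (- 1 / 4)) * (\<integral>\<^sup>+r. ennreal (k r) * indicator {0..} r \<partial>lborel)"
    unfolding k_def by (rule nn_integral_cmult) measurable
  also have "(\<integral>\<^sup>+r. ennreal (k r) * indicator {0..} r \<partial>lborel) = ennreal ((1 + z) powr (1 - (\<sigma> - 5 / 4)) / ((\<sigma> - 5 / 4) - 1))"
    unfolding k_def by (rule nn_integral_powr_tail) (use \<sigma> z in auto)
  also have "ennreal (22 * \<tau> powr (- 1 / 4)) * \<dots> = ennreal (22 / (\<sigma> - 9 / 4) * \<tau> powr (- 1 / 4) * (1 + z) powr (9 / 4 - \<sigma>))"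
    using \<sigma> by (simp add: ennreal_mult'[symmetric] mult_ac)
  finally show ?thesis .
qed

section \<open>The pointwise bound of the integrand and its integration\<close>

definition left_energy :: "(real \<times> real \<Rightarrow> real) \<Rightarrow> real \<times> real \<Rightarrow> real" where
  "left_energy \<phi> p = (if fst p < 0 then (bracket (fst p) powr (- 1) * \<phi> p)\<^sup>2 else 0)"

lemma left_energy_lebesgue:
  assumes "in_L2_on {(x, y). x < 0} (\<lambda>(x, y). bracket x powr (- 1) * \<phi> (x, y))"
    and "L2_norm_on {(x, y). x < 0} (\<lambda>(x, y). bracket x powr (- 1) * \<phi> (x, y)) \<le> C" "C > 0"
  shows "left_energy \<phi> \<in> borel_measurable lebesgue"
    and "(\<integral>\<^sup>+p. ennreal (left_energy \<phi> p) \<partial>lebesgue) \<le> ennreal (C\<^sup>2)"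
proof -
  let ?S = "{(x :: real, y :: real). x < 0}"
  let ?f = "\<lambda>(x, y). bracket x powr (- 1) * \<phi> (x, y)"
  have eq: "left_energy \<phi> = (\<lambda>p. indicator ?S p *\<^sub>R (?f p)\<^sup>2)"
    by (auto simp: left_energy_def indicator_def fun_eq_iff)
  have int: "integrable lebesgue (left_energy \<phi>)"
    using assms(1) unfolding in_L2_on_def set_integrable_def eq by simp
  then show "left_energy \<phi> \<in> borel_measurable lebesgue" by simp
  have nn: "left_energy \<phi> p \<ge> 0" for p by (simp add: left_energy_def)
  have "sqrt (LINT p|lebesgue. left_energy \<phi> p) \<le> C"
    using assms(2) unfolding L2_norm_on_def set_lebesgue_integral_def eq by simp
  then have "(LINT p|lebesgue. left_energy \<phi> p) \<le> C\<^sup>2"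
    by (rule sqrt_le_D)
  then show "(\<integral>\<^sup>+p. ennreal (left_energy \<phi> p) \<partial>lebesgue) \<le> ennreal (C\<^sup>2)"
    using int nn by (subst nn_integral_eq_integral) (auto intro: ennreal_leI)
qed

text \<open>The coefficient with \<open>16 powr \<sigma>\<close> serves 0 <= u < z, the inner
  majorant u < 0, and the coefficient with \<open>K\<^sup>2\<close> together with the energy u > z.
  All terms are nonnegative, so their sum dominates in each region and can be integrated over the
  whole plane without splitting the domain.\<close>

lemma Phi_integrand_bound:
  fixes \<phi> :: "real \<times> real \<Rightarrow> real"
  assumes \<tau>: "\<tau> > 0" "\<tau> ^ 3 = 4 * t" and t: "t > 0" and z: "t \<le> z" and C: "C > 0" and K: "K > 0"
    and N: "2 * \<sigma> + 3 \<le> real N" and \<sigma>: "\<sigma> > 0"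
    and A: "\<And>u v. norm (A_x u v t) \<le> K / \<tau> ^ 3 * A_majorant N (u / \<tau>) (v / \<tau>)"
    and \<phi>: "\<And>u v. u > 0 \<Longrightarrow> \<bar>\<phi> (u, v)\<bar> \<le> C * bracket u powr (- \<sigma>)"
    and uz: "u \<noteq> z"
  shows "norm (A_x u v t * of_real (\<phi> (z - u, y - v))) \<le>
     (2 * K * 16 powr \<sigma> + 128 * K\<^sup>2 * 8 powr (2 * \<sigma>)) * C * (1 + z) powr (- \<sigma>) / \<tau> ^ 3 * cauchy_kernel2 \<tau> (u, v)
     + K * 2 powr \<sigma> * C / \<tau> ^ 3 * inner_majorant \<sigma> z \<tau> (u, v)
     + 1 / (2 * C) * (1 + z) powr (- \<sigma>) / \<tau> ^ 3 * left_energy \<phi> (z - u, y - v)" (is "?L \<le> (?c1 + ?c2) * C * ?w / _ * ?q + ?I + ?E")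
proof -
  have n: "?c1 \<ge> 0" "?c2 \<ge> 0" "?w \<ge> 0" "?q \<ge> 0" using K by auto
  have inn: "inner_majorant \<sigma> z \<tau> (u, v) \<ge> 0"
    unfolding inner_majorant_def by (auto intro!: mult_nonneg_nonneg add_nonneg_nonneg)
  have I0: "?I \<ge> 0" using K C \<tau>(1) by (intro mult_nonneg_nonneg inn) auto
  have E0: "?E \<ge> 0" using C \<tau>(1) by (intro mult_nonneg_nonneg) (auto simp: left_energy_def)
  have c10: "?c1 * C * ?w / \<tau> ^ 3 * ?q \<ge> 0" and c20: "?c2 * C * ?w / \<tau> ^ 3 * ?q \<ge> 0" using n C \<tau>(1) by auto
  have split: "(?c1 + ?c2) * C * ?w / \<tau> ^ 3 * ?q = ?c1 * C * ?w / \<tau> ^ 3 * ?q + ?c2 * C * ?w / \<tau> ^ 3 * ?q"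
    by (simp add: algebra_simps add_divide_distrib)
  define a where "a = A_majorant N (u / \<tau>) (v / \<tau>)"
  have a: "a \<ge> 0" by (simp add: a_def A_majorant_nonneg)
  have L: "?L \<le> K / \<tau> ^ 3 * a * \<bar>\<phi> (z - u, y - v)\<bar>"
    using A[of u v] unfolding norm_mult norm_of_real a_def by (rule mult_right_mono) simp
  show ?thesis
  proof (cases "u < z")
    case True
    have "\<bar>\<phi> (z - u, y - v)\<bar> \<le> C * bracket (z - u) powr (- \<sigma>)" using \<phi> True by simp
    also have "\<dots> \<le> C * (2 powr \<sigma> * (1 + (z - u)) powr (- \<sigma>))"
      using True \<sigma> C by (intro mult_left_mono bracket_powr_le) auto
    finally have "?L \<le> K / \<tau> ^ 3 * a * (C * (2 powr \<sigma> * (1 + (z - u)) powr (- \<sigma>)))"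
      using L K a \<tau>(1) by (meson order_trans mult_left_mono mult_nonneg_nonneg divide_nonneg_nonneg less_imp_le zero_le_power)
    also have "\<dots> = K * 2 powr \<sigma> * C / \<tau> ^ 3 * (a * (1 + (z - u)) powr (- \<sigma>))" by simp
    finally have L': "?L \<le> K * 2 powr \<sigma> * C / \<tau> ^ 3 * (a * (1 + (z - u)) powr (- \<sigma>))" .
    show ?thesis
    proof (cases "u < 0")
      case False
      have "a * (1 + (z - u)) powr (- \<sigma>) \<le> 2 * 8 powr \<sigma> * ?w * ?q"
        unfolding a_def using False True by (intro majorant_bound_inner[OF \<tau> _ _ z N \<sigma>]) auto
      then have "K * 2 powr \<sigma> * C / \<tau> ^ 3 * (a * (1 + (z - u)) powr (- \<sigma>)) \<le> K * 2 powr \<sigma> * C / \<tau> ^ 3 * (2 * 8 powr \<sigma> * ?w * ?q)"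
        using K C \<tau>(1) by (intro mult_left_mono) auto
      also have "\<dots> = ?c1 * C * ?w / \<tau> ^ 3 * ?q"
        using powr_mult[of 2 8 \<sigma>] by simp
      finally show ?thesis using L' split c20 I0 E0 by linarith
    next
      case True
      have e: "a * (1 + (z - u)) powr (- \<sigma>) = inner_majorant \<sigma> z \<tau> (u, v)"
        unfolding a_def inner_majorant_def A_majorant_def
        using True \<tau>(1) by (simp add: max_def divide_less_0_iff field_simps abs_le_iff not_le not_less)
      show ?thesis using L'[unfolded e] split c10 c20 E0 by linarith
    qed
  next
    case False
    then have zu: "z < u" using uz by simp
    define b where "b = bracket (z - u)"
    have b: "b \<ge> 1" by (simp add: b_def bracket_ge_1)
    define f where "f = \<bar>\<phi> (z - u, y - v)\<bar>"
    \<comment> \<open>The balancing weight: the squared kernel carries (1 + z)^(-2\<sigma>) /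
      \<tau>^6 and the energy integrates to at most C^2, so with this \<open>l\<close> both halves
      receive the prefactor C (1 + z)^(-\<sigma>) / \<tau>^3, the second one after
      integration.\<close>
    define l where "l = C * \<tau> ^ 3 * (1 + z) powr \<sigma>"
    have z1: "1 + z > 0" using z t by simp
    have l: "l > 0" using C \<tau>(1) z1 by (simp add: l_def)
    define P where "P = K / \<tau> ^ 3 * (a * b)"
    define Q where "Q = f / b"
    have en: "left_energy \<phi> (z - u, y - v) = Q\<^sup>2"
      using zu b unfolding left_energy_def Q_def f_def b_def
      by (simp add: power_mult_distrib power_divide powr_minus_divide)
    \<comment> \<open>Weighted AM-GM in place of Cauchy-Schwarz, so that one integrable majorant serves all
      regions.\<close>
    have "P * Q \<le> l / 2 * P\<^sup>2 + 1 / (2 * l) * Q\<^sup>2"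
    proof -
      have "0 \<le> (l * P - Q)\<^sup>2 / (2 * l)" using l by simp
      also have "\<dots> = l / 2 * P\<^sup>2 + 1 / (2 * l) * Q\<^sup>2 - P * Q"
        using l by (simp add: power2_eq_square field_simps)
      finally show ?thesis by simp
    qed
    moreover have "P * Q = K / \<tau> ^ 3 * a * f" using b by (simp add: P_def Q_def)
    moreover have "l / 2 * P\<^sup>2 \<le> ?c2 * C * ?w / \<tau> ^ 3 * ?q"
    proof -
      have "(a * b)\<^sup>2 \<le> 256 * 8 powr (2 * \<sigma>) * (1 + z) powr (- (2 * \<sigma>)) * ?q"
        unfolding a_def b_def using zu by (intro majorant_bound_outer[OF \<tau> t _ z N \<sigma>]) auto
      then have le: "l / 2 * (K / \<tau> ^ 3)\<^sup>2 * (a * b)\<^sup>2 \<le> l / 2 * (K / \<tau> ^ 3)\<^sup>2 * (256 * 8 powr (2 * \<sigma>) * (1 + z) powr (- (2 * \<sigma>)) * ?q)"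
        using l by (intro mult_left_mono) auto
      have eq: "l / 2 * (K / \<tau> ^ 3)\<^sup>2 * (256 * 8 powr (2 * \<sigma>) * (1 + z) powr (- (2 * \<sigma>)) * ?q)
          = 128 * K\<^sup>2 * 8 powr (2 * \<sigma>) * C * ((1 + z) powr \<sigma> * (1 + z) powr (- (2 * \<sigma>))) / \<tau> ^ 3 * ?q"
      proof -
        have "C * T * Z / 2 * (K / T)\<^sup>2 * (256 * e * f * q) = 128 * K\<^sup>2 * e * C * (Z * f) / T * q"
          if "T > 0" for T Z e f q
          using that by (simp add: power2_eq_square field_simps)
        note alg = this
        show ?thesis unfolding l_def by (rule alg) (use \<tau>(1) in simp)
      qed
      have w: "(1 + z) powr \<sigma> * (1 + z) powr (- (2 * \<sigma>)) = ?w"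
        by (simp add: powr_add[symmetric])
      have P: "l / 2 * P\<^sup>2 = l / 2 * (K / \<tau> ^ 3)\<^sup>2 * (a * b)\<^sup>2"
        by (simp only: P_def power_mult_distrib mult.assoc)
      show ?thesis using le unfolding P eq w .
    qed
    moreover have "1 / (2 * l) * Q\<^sup>2 = ?E"
      unfolding en l_def using z1 by (simp add: powr_minus field_simps)
    ultimately show ?thesis using L split c10 I0 unfolding f_def by linarith
  qed
qed

lemma nn_integral_lebesgue_cmult:
  fixes g :: "real \<times> real \<Rightarrow> real"
  assumes "k \<ge> 0" and "g \<in> borel_measurable lebesgue"
    and "(\<integral>\<^sup>+p. ennreal (g p) \<partial>lebesgue) \<le> ennreal B" and "B \<ge> 0"
  shows "(\<integral>\<^sup>+p. ennreal (k * g p) \<partial>lebesgue) \<le> ennreal (k * B)"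
proof -
  have "(\<integral>\<^sup>+p. ennreal (k * g p) \<partial>lebesgue) = ennreal k * (\<integral>\<^sup>+p. ennreal (g p) \<partial>lebesgue)"
    using assms(1,2) by (simp add: ennreal_mult' nn_integral_cmult)
  also have "\<dots> \<le> ennreal k * ennreal B" by (intro mult_left_mono assms(3)) simp
  also have "\<dots> = ennreal (k * B)" using assms(1) by (simp add: ennreal_mult')
  finally show ?thesis .
qed

text \<open>The half-plane u < 0 dictates \<tau>^(-13/4) (1 + z)^(9/4 - \<sigma>). The kernel term
  and the energy term carry (1 + z)^(-\<sigma>) with \<tau>^(-1) and \<tau>^(-3) instead; they are
  brought to the same form by \<tau> <= 2 (1 + z), which follows from \<tau>^3 = 4t <= 4z.\<close>

lemma Phi_x_bound:
  fixes \<phi> :: "real \<times> real \<Rightarrow> real"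
  assumes \<tau>: "\<tau> > 0" "\<tau> ^ 3 = 4 * t" and t: "t > 0" and x: "x > 0" and C: "C > 0" and K: "K > 0"
    and N: "2 * \<sigma> + 3 \<le> real N" and \<sigma>: "\<sigma> > 9 / 4"
    and A: "\<And>u v. norm (A_x u v t) \<le> K / \<tau> ^ 3 * A_majorant N (u / \<tau>) (v / \<tau>)"
    and \<phi>: "\<And>u v. u > 0 \<Longrightarrow> \<bar>\<phi> (u, v)\<bar> \<le> C * bracket u powr (- \<sigma>)"
    and L2: "in_L2_on {(x, y). x < 0} (\<lambda>(x, y). bracket x powr (- 1) * \<phi> (x, y))"
      "L2_norm_on {(x, y). x < 0} (\<lambda>(x, y). bracket x powr (- 1) * \<phi> (x, y)) \<le> C"
  shows "norm (Phi_x \<phi> x y t) \<le>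
     (8 * pi\<^sup>2 * (2 * K * 16 powr \<sigma> + 128 * K\<^sup>2 * 8 powr (2 * \<sigma>)) + 22 * K * 2 powr \<sigma> / (\<sigma> - 9 / 4) + 4)
     * (C * \<tau> powr (- 13 / 4) * (1 + (x + t)) powr (9 / 4 - \<sigma>))"
proof -
  define z where "z = x + t"
  define c where "c = 2 * K * 16 powr \<sigma> + 128 * K\<^sup>2 * 8 powr (2 * \<sigma>)"
  define d where "d = K * 2 powr \<sigma>"
  define w where "w = (1 + z) powr (- \<sigma>)"
  define B where "B = \<tau> powr (- 13 / 4) * (1 + z) powr (9 / 4 - \<sigma>)"
  have z: "z > 0" "t \<le> z" using x t by (auto simp: z_def)
  have cd: "c \<ge> 0" "d \<ge> 0" "w \<ge> 0" using K by (auto simp: c_def d_def w_def)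
  have \<tau>z: "\<tau> \<le> 2 * (1 + z)"
  proof -
    have "\<tau> ^ Suc 2 \<le> (2 * (1 + z)) ^ Suc 2"
    proof -
      have "1 + z \<le> (1 + z) ^ 3" using z by (intro self_le_power) auto
      moreover have "(2 * (1 + z)) ^ 3 = 8 * (1 + z) ^ 3" unfolding power_mult_distrib by simp
      ultimately have "4 * t \<le> (2 * (1 + z)) ^ 3" using z by linarith
      then show ?thesis using \<tau>(2) by (simp add: eval_nat_numeral)
    qed
    then show ?thesis by (rule power_le_imp_le_base) (use z in simp)
  qed
  define k1 where "k1 = c * C * w / \<tau> ^ 3"
  define k2 where "k2 = d * C / \<tau> ^ 3"
  define k3 where "k3 = 1 / (2 * C) * w / \<tau> ^ 3"
  have k: "k1 \<ge> 0" "k2 \<ge> 0" "k3 \<ge> 0" using cd C \<tau>(1) by (auto simp: k1_def k2_def k3_def)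
  define f1 where "f1 p = ennreal (k1 * cauchy_kernel2 \<tau> p)" for p
  define f2 where "f2 p = ennreal (k2 * inner_majorant \<sigma> z \<tau> p)" for p
  define f3 where "f3 p = ennreal (k3 * left_energy \<phi> ((z, y) - p))" for p
  have inn: "inner_majorant \<sigma> z \<tau> p \<ge> 0" for p
    unfolding inner_majorant_def by (auto intro!: mult_nonneg_nonneg add_nonneg_nonneg)
  have le: "left_energy \<phi> p \<ge> 0" for p by (simp add: left_energy_def)
  note lE = left_energy_lebesgue[OF L2 C]
  have lm: "(\<lambda>p. ennreal (left_energy \<phi> p)) \<in> borel_measurable lebesgue" using lE(1) by measurable
  note refl = nn_integral_lebesgue_reflect[OF lm, of "(z, y)"]
  have lEr: "(\<lambda>p. left_energy \<phi> ((z, y) - p)) \<in> borel_measurable lebesgue"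
  proof -
    have "(\<lambda>p. enn2real (ennreal (left_energy \<phi> ((z, y) - p)))) \<in> borel_measurable lebesgue"
      using refl(2) by measurable
    then show ?thesis using le by simp
  qed
  have m1: "cauchy_kernel2 \<tau> \<in> borel_measurable lebesgue" and m2: "inner_majorant \<sigma> z \<tau> \<in> borel_measurable lebesgue"
    by (auto intro!: measurable_completion)
  have J1: "(\<integral>\<^sup>+p. f1 p \<partial>lebesgue) \<le> ennreal (k1 * (pi * \<tau>)\<^sup>2)"
    unfolding f1_def using nn_integral_cauchy_kernel2[OF \<tau>(1)]
    by (intro nn_integral_lebesgue_cmult k m1) (auto simp: nn_integral_completion)
  have J2: "(\<integral>\<^sup>+p. f2 p \<partial>lebesgue) \<le> ennreal (k2 * (22 / (\<sigma> - 9 / 4) * \<tau> powr (- 1 / 4) * (1 + z) powr (9 / 4 - \<sigma>)))"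
    unfolding f2_def using nn_integral_inner_majorant[OF \<tau>(1) \<tau>z z(1) \<sigma>] \<sigma>
    by (intro nn_integral_lebesgue_cmult k m2) (auto simp: nn_integral_completion)
  have J3: "(\<integral>\<^sup>+p. f3 p \<partial>lebesgue) \<le> ennreal (k3 * C\<^sup>2)"
    unfolding f3_def using lE(2) refl(1)
    by (intro nn_integral_lebesgue_cmult k lEr) auto
  have pow: "\<tau> powr a \<le> 8 * (1 + z) powr (9 / 4)" if "0 \<le> a" "a \<le> 9 / 4" for a
  proof -
    have "\<tau> powr a \<le> (2 * (1 + z)) powr a" using \<tau>(1) \<tau>z that by (intro powr_mono2) auto
    also have "\<dots> \<le> (2 * (1 + z)) powr (9 / 4)" using z that by (intro powr_mono) auto
    also have "\<dots> = 2 powr (9 / 4) * (1 + z) powr (9 / 4)" by (rule powr_mult)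
    also have "\<dots> \<le> 2 powr 3 * (1 + z) powr (9 / 4)" by (intro mult_right_mono powr_mono) auto
    finally show ?thesis by simp
  qed
  \<comment> \<open>Used with b = -1, where the area (\<pi>\<tau>)^2 of the Cauchy kernel meets
    \<tau>^(-3), and with b = -3 for the energy. The first value accounts for the limit 9/4 in
    \<open>pow\<close>.\<close>
  have \<tau>p: "\<tau> powr b \<le> 8 * \<tau> powr (- 13 / 4) * (1 + z) powr (9 / 4)" if "- 13 / 4 \<le> b" "b \<le> - 1" for b
  proof -
    have "\<tau> powr b = \<tau> powr (- 13 / 4) * \<tau> powr (b + 13 / 4)" by (simp add: powr_add[symmetric])
    also have "\<dots> \<le> \<tau> powr (- 13 / 4) * (8 * (1 + z) powr (9 / 4))" using that by (intro mult_left_mono pow) auto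
    finally show ?thesis by simp
  qed
  have wB: "w * (8 * \<tau> powr (- 13 / 4) * (1 + z) powr (9 / 4)) = 8 * B"
    unfolding w_def B_def using powr_add[of "1 + z" "9 / 4" "- \<sigma>"] by simp
  have p3: "1 / \<tau> ^ 3 = \<tau> powr (- 3)" using \<tau>(1) by (simp add: powr_minus_divide)
  have T1: "k1 * (pi * \<tau>)\<^sup>2 \<le> 8 * pi\<^sup>2 * c * (C * B)"
  proof -
    have "k1 * (pi * \<tau>)\<^sup>2 = pi\<^sup>2 * c * C * (w * \<tau> powr (- 1))"
      using \<tau>(1) by (simp add: k1_def power2_eq_square power3_eq_cube powr_minus_divide)
    also have "\<dots> \<le> pi\<^sup>2 * c * C * (w * (8 * \<tau> powr (- 13 / 4) * (1 + z) powr (9 / 4)))"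
      using cd C by (intro mult_left_mono \<tau>p) auto
    also have "\<dots> = 8 * pi\<^sup>2 * c * (C * B)" unfolding wB by simp
    finally show ?thesis .
  qed
  have T2: "k2 * (22 / (\<sigma> - 9 / 4) * \<tau> powr (- 1 / 4) * (1 + z) powr (9 / 4 - \<sigma>)) = 22 * d / (\<sigma> - 9 / 4) * (C * B)"
  proof -
    have e: "\<tau> powr (- 13 / 4) = 1 / \<tau> ^ 3 * \<tau> powr (- 1 / 4)" unfolding p3 by (simp add: powr_add[symmetric])
    show ?thesis unfolding k2_def B_def e by (simp add: mult_ac)
  qed
  have T3: "k3 * C\<^sup>2 \<le> 4 * (C * B)"
  proof -
    have "k3 * C\<^sup>2 = C / 2 * (w * (1 / \<tau> ^ 3))"
      using C by (simp add: k3_def power2_eq_square)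
    also have "\<dots> \<le> C / 2 * (w * (8 * \<tau> powr (- 13 / 4) * (1 + z) powr (9 / 4)))"
      unfolding p3 using cd C by (intro mult_left_mono \<tau>p) auto
    also have "\<dots> = 4 * (C * B)" unfolding wB by simp
    finally show ?thesis .
  qed
  have nonneg: "C * B \<ge> 0" using C by (simp add: B_def)
  have "(\<integral>\<^sup>+p. ennreal (norm (case p of (x', y') \<Rightarrow> A_x x' y' t * of_real (\<phi> (x + t - x', y - y')))) \<partial>lebesgue)
     \<le> (\<integral>\<^sup>+p. f1 p + f2 p + f3 p \<partial>lebesgue)"
  proof (rule nn_integral_mono_AE)
    show "AE p in lebesgue. ennreal (norm (case p of (x', y') \<Rightarrow> A_x x' y' t * of_real (\<phi> (x + t - x', y - y')))) \<le> f1 p + f2 p + f3 p"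
      using AE_fst_neq[of z]
    proof eventually_elim
      case (elim p)
      obtain u v where p: "p = (u, v)" by (cases p)
      have "norm (A_x u v t * of_real (\<phi> (z - u, y - v))) \<le> k1 * cauchy_kernel2 \<tau> (u, v) + k2 * inner_majorant \<sigma> z \<tau> (u, v) + k3 * left_energy \<phi> (z - u, y - v)"
        unfolding k1_def k2_def k3_def c_def d_def w_def
        by (rule Phi_integrand_bound[OF \<tau> t z(2) C K N _ A \<phi>]) (use \<sigma> elim p in auto)
      then have "ennreal (norm (A_x u v t * of_real (\<phi> (z - u, y - v)))) \<le> ennreal (k1 * cauchy_kernel2 \<tau> (u, v) + k2 * inner_majorant \<sigma> z \<tau> (u, v) + k3 * left_energy \<phi> (z - u, y - v))"
        by (rule ennreal_leI)
      also have "\<dots> = f1 p + f2 p + f3 p"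
        unfolding f1_def f2_def f3_def p using k inn le by (simp add: ennreal_plus)
      finally show ?case by (simp add: p z_def)
    qed
  qed
  also have "\<dots> = (\<integral>\<^sup>+p. f1 p \<partial>lebesgue) + (\<integral>\<^sup>+p. f2 p \<partial>lebesgue) + (\<integral>\<^sup>+p. f3 p \<partial>lebesgue)"
  proof -
    have [measurable]: "f1 \<in> borel_measurable lebesgue" "f2 \<in> borel_measurable lebesgue" "f3 \<in> borel_measurable lebesgue"
      unfolding f1_def f2_def f3_def using m1 m2 lEr by auto
    show ?thesis by (simp add: nn_integral_add)
  qed
  also have "\<dots> \<le> ennreal (8 * pi\<^sup>2 * c * (C * B)) + ennreal (22 * d / (\<sigma> - 9 / 4) * (C * B)) + ennreal (4 * (C * B))"
    using J1 J2 J3 ennreal_leI[OF T1] ennreal_leI[OF T3] unfolding T2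
    by (intro add_mono) (auto intro: order_trans)
  also have "\<dots> = ennreal (8 * pi\<^sup>2 * c * (C * B) + 22 * d / (\<sigma> - 9 / 4) * (C * B) + 4 * (C * B))"
    using nonneg cd \<sigma> by (simp add: ennreal_plus)
  finally have "norm (Phi_x \<phi> x y t) \<le> 8 * pi\<^sup>2 * c * (C * B) + 22 * d / (\<sigma> - 9 / 4) * (C * B) + 4 * (C * B)"
    unfolding Phi_x_def
    by (rule norm_integral_le_nn_integral) (use nonneg cd \<sigma> in auto)
  then show ?thesis unfolding c_def d_def B_def z_def by (simp add: algebra_simps)
qed

theorem proposition10p2:
  fixes \<sigma> :: real
  assumes "\<sigma> > 9 / 4"
  shows "\<exists>K>0. \<forall>(\<phi> :: real \<times> real \<Rightarrow> real) (C\<^sub>1 :: real).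
    C\<^sub>1 > 0 \<and>
    \<phi> \<in> borel_measurable lebesgue \<and>
    (\<forall>x y. x > 0 \<longrightarrow> \<bar>\<phi> (x, y)\<bar> \<le> C\<^sub>1 * bracket x powr (- \<sigma>)) \<and>
    in_L2_on {(x, y). x < 0} (\<lambda>(x, y). bracket x powr (- 1) * \<phi> (x, y)) \<and>
    L2_norm_on {(x, y). x < 0} (\<lambda>(x, y). bracket x powr (- 1) * \<phi> (x, y)) \<le> C\<^sub>1
    \<longrightarrow>
    (\<forall>t x y. t > 0 \<and> x > 0 \<longrightarrow>
      (t < 1 \<longrightarrow>
        norm (Phi_x \<phi> x y t) \<le>
          K * (C\<^sub>1 * t powr (- 13 / 12) * bracket x powr (- \<sigma> + 9 / 4))) \<and>
      (t > 1 \<longrightarrow>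
        norm (Phi_x \<phi> x y t) \<le>
          K * (C\<^sub>1 * t powr (- 13 / 12) *
            bracket x powr (- min (\<sigma> - 9 / 4) (2 / 3 * \<sigma> - 5 / 12)))))"
proof -
  \<comment> \<open>\<open>N\<close> is chosen from \<sigma> alone, so the constants
    \<open>K\<close> and \<open>M\<close> depend on nothing else.\<close>
  obtain N :: nat where N: "2 * \<sigma> + 3 \<le> real N" using real_arch_simple by blast
  obtain K where K: "K > 0" and A: "\<And>x y t \<tau>. t > 0 \<and> \<tau> > 0 \<and> \<tau> ^ 3 = 4 * t \<Longrightarrow>
     norm (A_x x y t) \<le> K / \<tau> ^ 3 * A_majorant N (x / \<tau>) (y / \<tau>)"
    using A_x_bound[of N] by blast
  define M where "M = 8 * pi\<^sup>2 * (2 * K * 16 powr \<sigma> + 128 * K\<^sup>2 * 8 powr (2 * \<sigma>)) + 22 * K * 2 powr \<sigma> / (\<sigma> - 9 / 4) + 4"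
  have M: "M > 0" unfolding M_def using K assms by (intro add_nonneg_pos add_nonneg_nonneg) auto
  have main: "norm (Phi_x \<phi> x y t) \<le> M * (C * t powr (- 13 / 12) * bracket x powr (- \<sigma> + 9 / 4))"
    if C: "C > 0" and \<phi>: "\<forall>x y. x > 0 \<longrightarrow> \<bar>\<phi> (x, y)\<bar> \<le> C * bracket x powr (- \<sigma>)"
      and L2: "in_L2_on {(x, y). x < 0} (\<lambda>(x, y). bracket x powr (- 1) * \<phi> (x, y))"
        "L2_norm_on {(x, y). x < 0} (\<lambda>(x, y). bracket x powr (- 1) * \<phi> (x, y)) \<le> C"
      and t: "t > 0" and x: "x > 0"
    for \<phi> :: "real \<times> real \<Rightarrow> real" and C t x y
  proof -
    define \<tau> where "\<tau> = (4 * t) powr (1 / 3)"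
    have \<tau>0: "\<tau> > 0" using t by (simp add: \<tau>_def)
    have \<tau>: "\<tau> ^ 3 = 4 * t"
      using t powr_realpow[OF \<tau>0, of 3] by (simp add: \<tau>_def powr_powr)
    have "\<tau> powr (- 13 / 4) = (4 * t) powr (- 13 / 12)" by (simp add: \<tau>_def powr_powr)
    also have "\<dots> \<le> t powr (- 13 / 12)" using t by (intro powr_mono2') auto
    finally have tp: "\<tau> powr (- 13 / 4) \<le> t powr (- 13 / 12)" .
    \<comment> \<open>The exponent 9/4 - \<sigma> is negative, so passing from 1 + x + t down to
      \<open>bracket x\<close> enlarges the bound.\<close>
    have "bracket x \<le> 1 + (x + t)" using bracket_le[of x] x t by simp
    then have bp: "(1 + (x + t)) powr (9 / 4 - \<sigma>) \<le> bracket x powr (- \<sigma> + 9 / 4)"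
      using bracket_ge_1[of x] assms powr_mono2'[of "9 / 4 - \<sigma>" "bracket x" "1 + (x + t)"] by (simp add: add.commute)
    have "norm (Phi_x \<phi> x y t) \<le> M * (C * \<tau> powr (- 13 / 4) * (1 + (x + t)) powr (9 / 4 - \<sigma>))"
      unfolding M_def
      by (rule Phi_x_bound[OF \<tau>0 \<tau> t x C K N assms _ _ L2]) (use A t \<tau>0 \<tau> \<phi> in auto)
    also have "\<dots> \<le> M * (C * t powr (- 13 / 12) * bracket x powr (- \<sigma> + 9 / 4))"
      using M C tp bp by (intro mult_left_mono mult_mono) auto
    finally show ?thesis .
  qed
  \<comment> \<open>Powers of \<open>bracket x\<close>, which is at least 1, increase with the
    exponent, and the minimum is at most \<sigma> - 9/4.\<close>
  have large: "bracket x powr (- \<sigma> + 9 / 4) \<le> bracket x powr (- min (\<sigma> - 9 / 4) (2 / 3 * \<sigma> - 5 / 12))" for x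
    using bracket_ge_1[of x] by (intro powr_mono) auto
  show ?thesis
  proof (intro exI[of _ M] conjI allI impI M; (elim conjE)?)
    fix \<phi> :: "real \<times> real \<Rightarrow> real" and C t x y :: real
    assume h: "C > 0" "\<forall>x y. x > 0 \<longrightarrow> \<bar>\<phi> (x, y)\<bar> \<le> C * bracket x powr (- \<sigma>)"
      "in_L2_on {(x, y). x < 0} (\<lambda>(x, y). bracket x powr (- 1) * \<phi> (x, y))"
      "L2_norm_on {(x, y). x < 0} (\<lambda>(x, y). bracket x powr (- 1) * \<phi> (x, y)) \<le> C"
      and tx: "t > 0" "x > 0"
    \<comment> \<open>The two conclusions are links of one chain: this bound settles t < 1, and its
      weakening by \<open>large\<close> settles t > 1.\<close>
    show "norm (Phi_x \<phi> x y t) \<le> M * (C * t powr (- 13 / 12) * bracket x powr (- \<sigma> + 9 / 4))"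
      by (rule main[OF h tx])
    also have "\<dots> \<le> M * (C * t powr (- 13 / 12) * bracket x powr (- min (\<sigma> - 9 / 4) (2 / 3 * \<sigma> - 5 / 12)))"
      using M h(1) by (intro mult_left_mono large) auto
    finally show "norm (Phi_x \<phi> x y t) \<le> M * (C * t powr (- 13 / 12) * bracket x powr (- min (\<sigma> - 9 / 4) (2 / 3 * \<sigma> - 5 / 12)))" .
  qed
qed

end
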